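(* Let $r\ge0$, let $\mathcal{L}$ be a smooth real function on $T^r_nX$ and let $s\ge2r$. Then there exists a globally defined $1$-form $\mathcal{E}(\mathcal{L})$ on $T^s_nX$ such that in the induced chart $V^s$ of every chart $V$ of $X$ $$\mathcal{E}(\mathcal{L})=\mathcal{E}_A(\mathcal{L})\,dx^A,\qquad \mathcal{E}_A(\mathcal{L})=\sum_{|J|\le r}(-1)^{|J|}d_J\partial^J_A\mathcal{L}.$$
   Context: $X$ is a smooth manifold of dimension $N\ge n\ge1$. $T^r_nX$ is the manifold of $(r,n)$-velocities, i.e. $r$-jets $j^r_0\gamma$ at $0$ of smooth maps (immersions) $\gamma$ from a neighbourhood of $0\in\mathbb{R}^n$ to $X$. A chart $(V,(x^A))$, $A=1,\dots,N$, of $X$ induces the chart $V^r$ (the velocities with $\gamma(0)\in V$) with coordinates $x^A_{j_1,\dots,j_k}(j^r_0\gamma)=\partial^k(x^A\circ\gamma)/\partial t^{j_1}\cdots\partial t^{j_k}|_0$, $0\le k\le r$, symmetric in the lower indices. Functions on $T^r_nX$ are pulled back to $T^s_nX$, $s\ge r$, along the canonical projection. Multi-indices $J=(j_1,\dots,j_k)$ are sequences in $\{1,\dots,n\}$, $|J|=k$; sums over multi-indices run over all sequences. $\partial^{j_1,\dots,j_k}_A=\frac{r_1!\cdots r_n!}{k!}\frac{\partial}{\partial x^A_{j_1,\dots,j_k}}$, where $r_l$ is the number of occurrences of $l$ in $(j_1,\dots,j_k)$. Formal derivatives on $T^s_nX$: $d_i=\sum_{|J|\le s-1}x^A_{iJ}\partial^J_A$;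 they commute and $d_J=\prod_{j\in J}d_j$. *)

theory Defs
  imports "HOL-Analysis.Analysis"
begin

section \<open>Smooth functions of finitely many real coordinates\<close>

text \<open>
  The dimension of the velocity manifolds depends on the order of the jets, so coordinate spaces
  cannot be indexed by a type alone. The Euclidean space with (finite) coordinate set \<open>I\<close> is
  the topspace \<open>I \<rightarrow>\<^sub>E UNIV\<close> of the library's \<^term>\<open>powertop_real I\<close>; for a finite
  type \<open>'n\<close> the space of dimension \<open>CARD('n)\<close> is the case \<open>I = UNIV\<close>.
\<close>

definition pd :: "'i \<Rightarrow> (('i \<Rightarrow> real) \<Rightarrow> real) \<Rightarrow> ('i \<Rightarrow> real) \<Rightarrow> real" where
  "pd i f x = deriv (\<lambda>h. f (x(i := h))) (x i)"

primrec pds :: "'i list \<Rightarrow> (('i \<Rightarrow> real) \<Rightarrow> real) \<Rightarrow> ('i \<Rightarrow> real) \<Rightarrow> real" where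
  "pds [] f = f"
| "pds (i # J) f = pd i (pds J f)"

text \<open>
  For an open set \<open>U\<close>: all iterated partial derivatives exist and are continuous on \<open>U\<close>.
  The values of \<open>f\<close> outside \<open>U\<close> do not matter.
\<close>

definition smooth_on :: "'i set \<Rightarrow> ('i \<Rightarrow> real) set \<Rightarrow> (('i \<Rightarrow> real) \<Rightarrow> real) \<Rightarrow> bool" where
  "smooth_on I U f \<longleftrightarrow>
     (\<forall>J \<in> lists I.
        continuous_map (subtopology (powertop_real I) U) euclideanreal (pds J f) \<and>
        (\<forall>i\<in>I. \<forall>x\<in>U. (\<lambda>h. pds J f (x(i := h))) differentiable (at (x i))))"

section \<open>Smooth manifolds\<close>

text \<open>
  A chart is a pair of its domain and its coordinate map, whose \<open>i\<close>-th coordinate at \<open>p\<close> is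
  \<open>\<phi> p i\<close>. Values of \<open>\<phi>\<close> outside the domain are irrelevant.
\<close>

type_synonym ('m, 'i) chart = "'m set \<times> ('m \<Rightarrow> 'i \<Rightarrow> real)"

definition is_chart :: "'i set \<Rightarrow> ('m, 'i) chart \<Rightarrow> bool" where
  "is_chart I = (\<lambda>(V, \<phi>). inj_on \<phi> V \<and> openin (powertop_real I) (\<phi> ` V))"

definition smooth_transition :: "'i set \<Rightarrow> ('m, 'i) chart \<Rightarrow> ('m, 'i) chart \<Rightarrow> bool" where
  "smooth_transition I = (\<lambda>(V, \<phi>) (W, \<psi>).
     openin (powertop_real I) (\<phi> ` (V \<inter> W)) \<and>
     (\<forall>i\<in>I. smooth_on I (\<phi> ` (V \<inter> W)) (\<lambda>u. \<psi> (inv_into V \<phi> u) i)))"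

definition compatible :: "'i set \<Rightarrow> ('m, 'i) chart \<Rightarrow> ('m, 'i) chart \<Rightarrow> bool" where
  "compatible I c d \<longleftrightarrow> smooth_transition I c d \<and> smooth_transition I d c"

definition points :: "('m, 'i) chart set \<Rightarrow> 'm set" where
  "points \<A> = (\<Union>c\<in>\<A>. fst c)"

definition smooth_atlas :: "'i set \<Rightarrow> ('m, 'i) chart set \<Rightarrow> bool" where
  "smooth_atlas I \<A> \<longleftrightarrow> (\<forall>c\<in>\<A>. is_chart I c) \<and> (\<forall>c\<in>\<A>. \<forall>d\<in>\<A>. compatible I c d)"

definition atlas_topology :: "'i set \<Rightarrow> ('m, 'i) chart set \<Rightarrow> 'm topology" where
  "atlas_topology I \<A> =
     topology (\<lambda>W. W \<subseteq> points \<A> \<and> (\<forall>(V, \<phi>)\<in>\<A>. openin (powertop_real I) (\<phi> ` (W \<inter> V))))"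

text \<open>
  The manifold is the set \<^term>\<open>points \<A>\<close> with the maximal atlas \<open>\<A>\<close>, so that the charts
  of the manifold are exactly the members of \<open>\<A>\<close>; its dimension is the cardinality of \<open>I\<close>.
\<close>

definition smooth_manifold :: "'i set \<Rightarrow> ('m, 'i) chart set \<Rightarrow> bool" where
  "smooth_manifold I \<A> \<longleftrightarrow>
     finite I \<and> smooth_atlas I \<A> \<and>
     (\<forall>c. is_chart I c \<and> fst c \<subseteq> points \<A> \<and> (\<forall>d\<in>\<A>. compatible I c d) \<longrightarrow> c \<in> \<A>) \<and>
     Hausdorff_space (atlas_topology I \<A>) \<and> second_countable (atlas_topology I \<A>)"

definition smooth_function :: "'i set \<Rightarrow> ('m, 'i) chart set \<Rightarrow> ('m \<Rightarrow> real) \<Rightarrow> bool" where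
  "smooth_function I \<A> f \<longleftrightarrow>
     (\<forall>(V, \<phi>)\<in>\<A>. smooth_on I (\<phi> ` V) (\<lambda>u. f (inv_into V \<phi> u)))"

definition smooth_near :: "'i set \<Rightarrow> ('m, 'i) chart set \<Rightarrow> 'm \<Rightarrow> ('m \<Rightarrow> real) \<Rightarrow> bool" where
  "smooth_near I \<A> p f \<longleftrightarrow>
     (\<exists>W. openin (atlas_topology I \<A>) W \<and> p \<in> W \<and>
        (\<forall>(V, \<phi>)\<in>\<A>. smooth_on I (\<phi> ` (W \<inter> V)) (\<lambda>u. f (inv_into V \<phi> u))))"

section \<open>Tangent vectors and 1-forms\<close>

definition coord_deriv :: "('m, 'i) chart \<Rightarrow> 'i \<Rightarrow> ('m \<Rightarrow> real) \<Rightarrow> 'm \<Rightarrow> real" where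
  "coord_deriv = (\<lambda>(V, \<phi>) i f p. pd i (\<lambda>u. f (inv_into V \<phi> u)) (\<phi> p))"

text \<open>
  Tangent vectors at \<open>p\<close> act on the functions that are smooth in a neighbourhood of \<open>p\<close>; they
  take the dummy value \<open>0\<close> on all other functions, so that a vector does not depend on the
  chart it is written in.
\<close>

definition coord_vector ::
  "'i set \<Rightarrow> ('m, 'i) chart set \<Rightarrow> ('m, 'i) chart \<Rightarrow> 'i \<Rightarrow> 'm \<Rightarrow> ('m \<Rightarrow> real) \<Rightarrow> real" where
  "coord_vector I \<A> c i p = (\<lambda>f. if smooth_near I \<A> p f then coord_deriv c i f p else 0)"

definition tangent_space ::
  "'i set \<Rightarrow> ('m, 'i) chart set \<Rightarrow> 'm \<Rightarrow> (('m \<Rightarrow> real) \<Rightarrow> real) set" where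
  "tangent_space I \<A> p =
     {(\<lambda>f. \<Sum>i\<in>I. a i * coord_vector I \<A> c i p f) | c a. c \<in> \<A> \<and> p \<in> fst c}"

text \<open>
  A 1-form assigns to each point \<open>p\<close> a linear functional on the tangent space at \<open>p\<close>, such that
  the components with respect to each chart are smooth.
\<close>

definition one_form ::
  "'i set \<Rightarrow> ('m, 'i) chart set \<Rightarrow> ('m \<Rightarrow> (('m \<Rightarrow> real) \<Rightarrow> real) \<Rightarrow> real) \<Rightarrow> bool" where
  "one_form I \<A> \<omega> \<longleftrightarrow>
     (\<forall>p\<in>points \<A>. \<forall>v\<in>tangent_space I \<A> p. \<forall>w\<in>tangent_space I \<A> p. \<forall>a b.
        \<omega> p (\<lambda>f. a * v f + b * w f) = a * \<omega> p v + b * \<omega> p w) \<and>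
     (\<forall>(V, \<phi>)\<in>\<A>. \<forall>i\<in>I.
        smooth_on I (\<phi> ` V)
          (\<lambda>u. \<omega> (inv_into V \<phi> u) (coord_vector I \<A> (V, \<phi>) i (inv_into V \<phi> u))))"

definition differential :: "('m \<Rightarrow> real) \<Rightarrow> 'm \<Rightarrow> (('m \<Rightarrow> real) \<Rightarrow> real) \<Rightarrow> real" where
  "differential f p v = v f"

section \<open>Manifolds of velocities\<close>

definition smooth_map ::
  "('x, 'N) chart set \<Rightarrow> (('n \<Rightarrow> real) set) \<Rightarrow> (('n \<Rightarrow> real) \<Rightarrow> 'x) \<Rightarrow> bool" where
  "smooth_map \<A> U \<gamma> \<longleftrightarrow>
     (\<forall>t\<in>U. \<exists>(V, \<phi>)\<in>\<A>. \<exists>W. openin (powertop_real UNIV) W \<and> t \<in> W \<and> W \<subseteq> U \<and> \<gamma> ` W \<subseteq> V \<and>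
        (\<forall>A. smooth_on UNIV W (\<lambda>u. \<phi> (\<gamma> u) A)))"

definition immersion ::
  "('x, 'N) chart set \<Rightarrow> (('n::finite \<Rightarrow> real) set) \<Rightarrow> (('n \<Rightarrow> real) \<Rightarrow> 'x) \<Rightarrow> bool" where
  "immersion \<A> U \<gamma> \<longleftrightarrow> smooth_map \<A> U \<gamma> \<and>
     (\<forall>t\<in>U. \<forall>(V, \<phi>)\<in>\<A>. \<gamma> t \<in> V \<longrightarrow>
        (\<forall>w. (\<forall>A. (\<Sum>j\<in>UNIV. w j * pd j (\<lambda>u. \<phi> (\<gamma> u) A) t) = 0) \<longrightarrow> (\<forall>j. w j = 0)))"

text \<open>
  The flag \<open>reg\<close> distinguishes the two conventions in use: velocities are jets of immersions
  (regular velocities) if \<open>reg\<close> holds, and jets of arbitrary smooth maps otherwise.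
\<close>

definition velocity_maps ::
  "bool \<Rightarrow> ('x, 'N) chart set \<Rightarrow> (('n::finite \<Rightarrow> real) \<Rightarrow> 'x) set" where
  "velocity_maps reg \<A> =
     {\<gamma>. \<exists>U. openin (powertop_real UNIV) U \<and> (\<lambda>_. 0) \<in> U \<and>
        (if reg then immersion \<A> U \<gamma> else smooth_map \<A> U \<gamma>)}"

text \<open>A jet at \<open>0\<close> is an equivalence class of maps.\<close>

type_synonym ('n, 'x) jet = "(('n \<Rightarrow> real) \<Rightarrow> 'x) set"

definition jet ::
  "bool \<Rightarrow> ('x, 'N) chart set \<Rightarrow> nat \<Rightarrow> (('n::finite \<Rightarrow> real) \<Rightarrow> 'x) \<Rightarrow> ('n, 'x) jet" where
  "jet reg \<A> r \<gamma> =
     {\<delta> \<in> velocity_maps reg \<A>. \<delta> (\<lambda>_. 0) = \<gamma> (\<lambda>_. 0) \<and>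
        (\<forall>(V, \<phi>)\<in>\<A>. \<gamma> (\<lambda>_. 0) \<in> V \<longrightarrow>
           (\<forall>A J. length J \<le> r \<longrightarrow>
              pds J (\<lambda>t. \<phi> (\<delta> t) A) (\<lambda>_. 0) = pds J (\<lambda>t. \<phi> (\<gamma> t) A) (\<lambda>_. 0)))}"

text \<open>The induced chart domain \<open>V\<^sup>r\<close>.\<close>

definition velocities_over ::
  "bool \<Rightarrow> ('x, 'N) chart set \<Rightarrow> nat \<Rightarrow> 'x set \<Rightarrow> ('n::finite, 'x) jet set" where
  "velocities_over reg \<A> r V = {jet reg \<A> r \<gamma> | \<gamma>. \<gamma> \<in> velocity_maps reg \<A> \<and> \<gamma> (\<lambda>_. 0) \<in> V}"

definition representative :: "('n, 'x) jet \<Rightarrow> ('n \<Rightarrow> real) \<Rightarrow> 'x" where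
  "representative p = (SOME \<gamma>. \<gamma> \<in> p)"

text \<open>The canonical projection onto the velocities of order \<open>r\<close>.\<close>

definition jet_proj ::
  "bool \<Rightarrow> ('x, 'N) chart set \<Rightarrow> nat \<Rightarrow> ('n::finite, 'x) jet \<Rightarrow> ('n, 'x) jet" where
  "jet_proj reg \<A> r p = jet reg \<A> r (representative p)"

text \<open>The function \<open>x\<^sup>A\<^sub>J\<close> for a sequence \<open>J\<close>.\<close>

definition velocity_coord :: "('x \<Rightarrow> 'N \<Rightarrow> real) \<Rightarrow> 'N \<Rightarrow> 'n list \<Rightarrow> ('n, 'x) jet \<Rightarrow> real" where
  "velocity_coord \<phi> A J p = pds J (\<lambda>t. \<phi> (representative p t) A) (\<lambda>_. 0)"

text \<open>
  The functions \<open>x\<^sup>A\<^sub>J\<close> are symmetric in the entries of \<open>J\<close>, so the independent coordinates are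
  indexed by multisets: the coordinate \<open>x\<^sup>A\<^sub>J\<close> has the index \<open>(A, mset J)\<close>. The partial derivative
  with respect to \<open>x\<^sup>A\<^sub>J\<close> is taken with respect to these independent coordinates.
\<close>

definition velocity_index :: "nat \<Rightarrow> ('N \<times> 'n multiset) set" where
  "velocity_index r = {(A, M). size M \<le> r}"

definition velocity_chart_map ::
  "nat \<Rightarrow> ('x \<Rightarrow> 'N \<Rightarrow> real) \<Rightarrow> ('n, 'x) jet \<Rightarrow> 'N \<times> 'n multiset \<Rightarrow> real" where
  "velocity_chart_map r \<phi> p =
     restrict (\<lambda>(A, M). velocity_coord \<phi> A (SOME J. mset J = M) p) (velocity_index r)"

definition velocity_chart ::
  "bool \<Rightarrow> ('x, 'N) chart set \<Rightarrow> nat \<Rightarrow> ('x, 'N) chart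
     \<Rightarrow> (('n::finite, 'x) jet, 'N \<times> 'n multiset) chart" where
  "velocity_chart reg \<A> r = (\<lambda>(V, \<phi>). (velocities_over reg \<A> r V, velocity_chart_map r \<phi>))"

definition velocity_atlas ::
  "bool \<Rightarrow> ('x, 'N) chart set \<Rightarrow> nat \<Rightarrow> (('n::finite, 'x) jet, 'N \<times> 'n multiset) chart set" where
  "velocity_atlas reg \<A> r = velocity_chart reg \<A> r ` \<A>"

section \<open>Formal derivatives and the Euler-Lagrange expressions\<close>

text \<open>
  All operators below act on functions on (the chart domain in) the velocities of order \<open>s\<close>.
  First \<open>\<partial>\<^sup>J\<^sub>A\<close>, with its combinatorial factor.
\<close>

definition vel_deriv ::
  "bool \<Rightarrow> ('x, 'N) chart set \<Rightarrow> nat \<Rightarrow> ('x, 'N) chart \<Rightarrow> 'N \<Rightarrow> 'n list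
     \<Rightarrow> (('n::finite, 'x) jet \<Rightarrow> real) \<Rightarrow> ('n, 'x) jet \<Rightarrow> real" where
  "vel_deriv reg \<A> s c A J f p =
     (\<Prod>l\<in>UNIV. fact (count_list J l)) / fact (length J) *
     coord_deriv (velocity_chart reg \<A> s c) (A, mset J) f p"

definition formal_deriv ::
  "bool \<Rightarrow> ('x, 'N::finite) chart set \<Rightarrow> nat \<Rightarrow> ('x, 'N) chart \<Rightarrow> 'n
     \<Rightarrow> (('n::finite, 'x) jet \<Rightarrow> real) \<Rightarrow> ('n, 'x) jet \<Rightarrow> real" where
  "formal_deriv reg \<A> s c i f p =
     (\<Sum>A\<in>UNIV. \<Sum>J | length J < s.
        velocity_coord (snd c) A (i # J) p * vel_deriv reg \<A> s c A J f p)"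

definition formal_derivs ::
  "bool \<Rightarrow> ('x, 'N::finite) chart set \<Rightarrow> nat \<Rightarrow> ('x, 'N) chart \<Rightarrow> 'n list
     \<Rightarrow> (('n::finite, 'x) jet \<Rightarrow> real) \<Rightarrow> ('n, 'x) jet \<Rightarrow> real" where
  "formal_derivs reg \<A> s c J f = foldr (formal_deriv reg \<A> s c) J f"

text \<open>\<open>L\<close> is a function on the velocities of order \<open>r\<close>; the result lives in order \<open>s\<close>.\<close>

definition euler_lagrange ::
  "bool \<Rightarrow> ('x, 'N::finite) chart set \<Rightarrow> nat \<Rightarrow> nat \<Rightarrow> (('n::finite, 'x) jet \<Rightarrow> real)
     \<Rightarrow> ('x, 'N) chart \<Rightarrow> 'N \<Rightarrow> ('n, 'x) jet \<Rightarrow> real" where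
  "euler_lagrange reg \<A> r s L c A p =
     (\<Sum>J | length J \<le> r.
        (-1) ^ length J *
        formal_derivs reg \<A> s c J (vel_deriv reg \<A> s c A J (\<lambda>q. L (jet_proj reg \<A> r q))) p)"

end

theory Submission
  imports Defs "HOL-Combinatorics.Multiset_Permutations"
begin

text \<open>
  Along a curve \<open>\<gamma>\<close>, the formal derivative \<open>d\<^sub>i\<close> of a function \<open>f\<close> of low enough order is the ordinary
  partial derivative of \<open>t \<mapsto> f (j\<^sub>t \<gamma>)\<close>, where \<open>j\<^sub>t \<gamma>\<close> is the jet of \<open>\<gamma>\<close> at \<open>t\<close>. This makes
  formal derivatives independent of the chart and turns the Euler-Lagrange expressions into
  \<open>\<Sum>\<^sub>M (-1)\<^bsup>|M|\<^esup> \<partial>\<^sub>M ((\<partial>L / \<partial>x\<^sup>A\<^sub>M) (j\<^sub>t \<gamma>))\<close> at \<open>t = 0\<close>, a sum over multisets \<open>M\<close>.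

  For a change of charts \<open>y' = F y\<close> one has \<open>y'\<^sup>B\<^sub>K = d\<^sub>K F\<^sup>B\<close>, and by induction on \<open>K\<close> the derivative of
  \<open>d\<^sub>K F\<^sup>B\<close> by \<open>y\<^sup>A\<^sub>M\<close> is the sum of \<open>d\<^sub>T (\<partial>F\<^sup>B / \<partial>y\<^sup>A)\<close> over the splittings of the sequence \<open>K\<close> into
  subsequences \<open>S\<close>, \<open>T\<close> with \<open>S\<close> representing \<open>M\<close>. After the chain rule, the covariance of the
  Euler-Lagrange expressions is the Leibniz-type identity
  \<open>\<Sum>\<^bsub>(S,T)\<^esub> (-1)\<^bsup>|S|\<^esup> \<partial>\<^sub>S (P \<partial>\<^sub>T Q) = (-1)\<^bsup>|K|\<^esup> (\<partial>\<^sub>K P) Q\<close>. Finally, \<open>dx\<^sup>A\<close> transforms with the inverse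
  Jacobian, so the sum \<open>E\<^sub>A dx\<^sup>A\<close> does not depend on the chart.
\<close>

section \<open>Calculus on the coordinate spaces\<close>

text \<open>The formal derivative on velocities of order s is truncated: coordinates of order s + 1
  are missing, so d_i is differentiation along curves only on functions of order below s. The
  extreme summand applies r formal derivatives to a function of order r; the last of them acts on
  order 2r - 1, which is where 2r <= s comes from. In general the truncated operators do not agree
  in different charts. This forces the detour through curves, where a change of charts is mere
  composition.

  The Leibniz-type identity is integration by parts without an integral. It is applied with P a
  derivative of the transformed Lagrangian by a jet coordinate and Q an entry of the Jacobian, both
  along the curve.

  A second obstacle is that 1-forms are tested in the charts of the velocity manifold, whose images
  must be known to be open: every admissible tuple of coordinates has to be realised as a jet.
  Taylor polynomials do this, and n <= N supplies immersions when s = 0. Finally, tangent vectors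
  return a dummy value on functions that are not smooth near the point, so x^A has to be shown
  smooth in all velocity charts before dx^A can be evaluated.\<close>

definition cube :: "'i set \<Rightarrow> ('i \<Rightarrow> real) \<Rightarrow> real \<Rightarrow> ('i \<Rightarrow> real) set" where
  "cube I x d = {y \<in> extensional I. \<forall>i\<in>I. \<bar>y i - x i\<bar> < d}"

lemma cube_eq_PiE: "cube I x d = PiE I (\<lambda>i. ball (x i) d)"
  by (auto simp: cube_def PiE_def Pi_def dist_real_def abs_minus_commute)

lemma openin_powertop_real_iff:
  assumes "finite I"
  shows "openin (powertop_real I) U \<longleftrightarrow>
    U \<subseteq> extensional I \<and> (\<forall>x\<in>U. \<exists>d>0. cube I x d \<subseteq> U)"
proof
  assume U: "openin (powertop_real I) U"
  have "U \<subseteq> extensional I"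
    using openin_subset[OF U] by (auto simp: PiE_def)
  moreover have "\<exists>d>0. cube I x d \<subseteq> U" if x: "x \<in> U" for x
  proof -
    obtain V where V: "\<forall>i\<in>I. open (V i)" "x \<in> PiE I V" "PiE I V \<subseteq> U"
      using U x unfolding openin_product_topology_alt by auto
    have "\<forall>i\<in>I. \<exists>e>0. ball (x i) e \<subseteq> V i"
      using V by (auto simp: open_contains_ball PiE_iff)
    then obtain e where e: "\<forall>i\<in>I. e i > 0 \<and> ball (x i) (e i) \<subseteq> V i"
      by metis
    define d where "d = Min (insert 1 (e ` I))"
    have "d > 0" "\<forall>i\<in>I. d \<le> e i"
      using e assms by (auto simp: d_def)
    moreover have "cube I x d \<subseteq> PiE I V"
      unfolding cube_eq_PiE using e \<open>\<forall>i\<in>I. d \<le> e i\<close>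
      by (intro PiE_mono) (meson order_trans subset_ball)
    ultimately show ?thesis using V by blast
  qed
  ultimately show "U \<subseteq> extensional I \<and> (\<forall>x\<in>U. \<exists>d>0. cube I x d \<subseteq> U)" by blast
next
  assume U: "U \<subseteq> extensional I \<and> (\<forall>x\<in>U. \<exists>d>0. cube I x d \<subseteq> U)"
  show "openin (powertop_real I) U"
    unfolding openin_product_topology_alt
  proof
    fix x assume x: "x \<in> U"
    then obtain d where d: "d > 0" "cube I x d \<subseteq> U" using U by blast
    show "\<exists>V. finite {i \<in> I. V i \<noteq> topspace euclideanreal} \<and>
      (\<forall>i\<in>I. openin euclideanreal (V i)) \<and> x \<in> PiE I V \<and> PiE I V \<subseteq> U"
      using d x U assms unfolding cube_eq_PiE
      by (intro exI[of _ "\<lambda>i. ball (x i) d"]) (auto simp: PiE_def)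
  qed
qed

lemma openin_cubeE:
  assumes "finite I" "openin (powertop_real I) U" "x \<in> U"
  obtains d where "d > 0" "cube I x d \<subseteq> U"
  using assms by (auto simp: openin_powertop_real_iff)

lemma openin_powertop_real_extensional:
  assumes "openin (powertop_real I) U" "x \<in> U"
  shows "x \<in> extensional I"
  using openin_subset[OF assms(1)] assms(2) by (auto simp: PiE_def)

lemma fun_upd_in_extensional: "x \<in> extensional I \<Longrightarrow> i \<in> I \<Longrightarrow> x(i := h) \<in> extensional I"
  by (auto simp: extensional_def)

text \<open>A partial derivative only sees the line through the point in one direction. Near the
  point that line stays in the open set, which makes \<open>pd\<close> local; the congruence rules
  for derivatives rest on this.\<close>

lemma eventually_fun_upd_openin:
  assumes "finite I" "openin (powertop_real I) U" "x \<in> U" "i \<in> I"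
  shows "\<forall>\<^sub>F h in nhds (x i). x(i := h) \<in> U"
proof -
  obtain d where d: "d > 0" "cube I x d \<subseteq> U"
    using openin_cubeE assms(1-3) .
  have "x(i := h) \<in> U" if "dist h (x i) < d" for h
    using d that openin_powertop_real_extensional[OF assms(2,3)] \<open>i \<in> I\<close>
    by (intro subsetD[OF d(2)]) (auto simp: cube_def fun_upd_in_extensional dist_real_def)
  then show ?thesis
    using d(1) by (auto simp: eventually_nhds_metric)
qed

abbreviation cont_on :: "'i set \<Rightarrow> ('i \<Rightarrow> real) set \<Rightarrow> (('i \<Rightarrow> real) \<Rightarrow> real) \<Rightarrow> bool" where
  "cont_on I U f \<equiv> continuous_map (subtopology (powertop_real I) U) euclideanreal f"

lemma topspace_openin_powertop:
  "openin (powertop_real I) U \<Longrightarrow> topspace (subtopology (powertop_real I) U) = U"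
  using openin_subset by fastforce

lemma cont_on_cubeE:
  assumes "finite I" "openin (powertop_real I) U" "cont_on I U f" "x \<in> U" "e > 0"
  obtains d where "d > 0" "cube I x d \<subseteq> U" "\<forall>y\<in>cube I x d. \<bar>f y - f x\<bar> < e"
proof -
  have "openin (subtopology (powertop_real I) U) {y \<in> U. f y \<in> ball (f x) e}"
    using openin_continuous_map_preimage[OF assms(3), of "ball (f x) e"]
    by (simp add: topspace_openin_powertop[OF assms(2)] flip: topspace_subtopology)
  then have "openin (powertop_real I) {y \<in> U. f y \<in> ball (f x) e}"
    using assms(2) openin_trans_full by blast
  then obtain d where "d > 0" "cube I x d \<subseteq> {y \<in> U. f y \<in> ball (f x) e}"
    by (rule openin_cubeE[OF assms(1), of _ x]) (use assms(4,5) in auto)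
  then show thesis
    by (intro that[of d]) (auto simp: dist_real_def)
qed

lemma cont_on_subset: "cont_on I U f \<Longrightarrow> V \<subseteq> U \<Longrightarrow> cont_on I V f"
  by (metis continuous_map_from_subtopology_mono)

lemma cont_on_cong:
  assumes "openin (powertop_real I) U" "\<And>x. x \<in> U \<Longrightarrow> f x = g x" "cont_on I U f"
  shows "cont_on I U g"
  using continuous_map_eq[OF assms(3), of g] assms(2)
  by (simp add: topspace_openin_powertop[OF assms(1)] del: topspace_subtopology)

lemma cont_on_coord: "i \<in> I \<Longrightarrow> cont_on I U (\<lambda>x. x i)"
  using continuous_map_product_projection[of i I "\<lambda>_. euclideanreal"]
  by (rule continuous_map_from_subtopology)

lemma continuous_map_restrict_family:
  assumes "\<And>j. j \<in> K \<Longrightarrow> cont_on I U (g j)" 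
  shows "continuous_map (subtopology (powertop_real I) U) (powertop_real K) (\<lambda>x. \<lambda>j\<in>K. g j x)"
  using assms by (auto simp: continuous_map_componentwise)

lemma cont_on_compose:
  assumes "openin (powertop_real I) U" "\<And>j. j \<in> K \<Longrightarrow> cont_on I U (g j)" "cont_on K V f"
    "\<And>x. x \<in> U \<Longrightarrow> (\<lambda>j\<in>K. g j x) \<in> V"
  shows "cont_on I U (\<lambda>x. f (\<lambda>j\<in>K. g j x))"
proof -
  have "continuous_map (subtopology (powertop_real I) U) (subtopology (powertop_real K) V)
     (\<lambda>x. \<lambda>j\<in>K. g j x)"
    using continuous_map_restrict_family[of K I U g] assms
    by (auto simp: continuous_map_in_subtopology topspace_openin_powertop[OF assms(1)]
      simp del: topspace_subtopology)
  from continuous_map_compose[OF this assms(3)] show ?thesis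
    by (simp add: o_def)
qed

lemma openin_preimage:
  assumes "openin (powertop_real I) U" "\<And>j. j \<in> K \<Longrightarrow> cont_on I U (g j)"
    "openin (powertop_real K) V"
  shows "openin (powertop_real I) {x \<in> U. (\<lambda>j\<in>K. g j x) \<in> V}"
  using openin_continuous_map_preimage[OF continuous_map_restrict_family[OF assms(2)] assms(3)]
    openin_trans_full[OF _ assms(1)]
  by (simp add: topspace_openin_powertop[OF assms(1)] flip: topspace_subtopology)

section \<open>Partial derivatives and functions of class C^k\<close>

definition pdifferentiable :: "'i \<Rightarrow> (('i \<Rightarrow> real) \<Rightarrow> real) \<Rightarrow> ('i \<Rightarrow> real) \<Rightarrow> bool" where
  "pdifferentiable i f x \<longleftrightarrow> (\<lambda>h. f (x(i := h))) differentiable (at (x i))"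

lemma pd_eqI:
  "((\<lambda>h. f (x(i := h))) has_real_derivative D) (at (x i)) \<Longrightarrow> pd i f x = D"
  unfolding pd_def by (rule DERIV_imp_deriv)

lemma has_real_derivative_pd:
  "pdifferentiable i f x \<Longrightarrow>
   ((\<lambda>h. f (x(i := h))) has_real_derivative pd i f x) (at (x i))"
  unfolding pd_def pdifferentiable_def by (simp add: DERIV_deriv_iff_real_differentiable)

lemma pdifferentiableI:
  "((\<lambda>h. f (x(i := h))) has_real_derivative D) (at (x i)) \<Longrightarrow> pdifferentiable i f x"
  unfolding pdifferentiable_def real_differentiable_def by blast

lemma pd_cong:
  assumes "finite I" "openin (powertop_real I) U" "\<And>x. x \<in> U \<Longrightarrow> f x = g x" "x \<in> U" "i \<in> I"
  shows "pd i f x = pd i g x"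
  unfolding pd_def
  by (rule deriv_cong_ev[OF _ refl])
    (use eventually_fun_upd_openin[OF assms(1,2,4,5)] assms(3) in \<open>auto elim: eventually_mono\<close>)

lemma pds_cong:
  assumes "finite I" "openin (powertop_real I) U" "\<And>x. x \<in> U \<Longrightarrow> f x = g x" "x \<in> U" "J \<in> lists I"
  shows "pds J f x = pds J g x"
  using assms(5) \<open>x \<in> U\<close>
proof (induction J arbitrary: x)
  case (Cons j J)
  then show ?case
    using pd_cong[OF assms(1,2), of "pds J f" "pds J g" x j] by auto
qed (use assms(3) in simp)

lemma pds_append: "pds (J @ K) f = pds J (pds K f)"
  by (induction J) auto

lemma pdifferentiable_cong:
  assumes "finite I" "openin (powertop_real I) U" "\<And>x. x \<in> U \<Longrightarrow> f x = g x" "x \<in> U" "i \<in> I"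
    "pdifferentiable i f x"
  shows "pdifferentiable i g x"
proof -
  have "\<forall>\<^sub>F h in nhds (x i). f (x(i := h)) = g (x(i := h))"
    using eventually_fun_upd_openin[OF assms(1,2,4,5)] by eventually_elim (rule assms(3))
  then show ?thesis
    using assms(6) DERIV_cong_ev[OF refl _ refl]
    unfolding pdifferentiable_def real_differentiable_def by metis
qed

text \<open>A finite-degree version of \<open>smooth_on\<close>, introduced for induction: the
  derivative of a product or a composite involves the given functions again, but only to one degree
  less.\<close>

primrec ck :: "nat \<Rightarrow> 'i set \<Rightarrow> ('i \<Rightarrow> real) set \<Rightarrow> (('i \<Rightarrow> real) \<Rightarrow> real) \<Rightarrow> bool" where
  "ck 0 I U f \<longleftrightarrow> cont_on I U f"
| "ck (Suc k) I U f \<longleftrightarrow> cont_on I U f \<and>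
     (\<forall>i\<in>I. (\<forall>x\<in>U. pdifferentiable i f x) \<and> ck k I U (pd i f))"

text \<open>\<open>ck\<close> peels off the derivative applied first, which is the last entry of
  \<open>J\<close>, whereas \<open>pds\<close> peels off the first entry. Hence lists are taken
  apart at their end.\<close>

lemma ck_iff:
  "ck k I U f \<longleftrightarrow> (\<forall>J\<in>lists I. (length J \<le> k \<longrightarrow> cont_on I U (pds J f)) \<and>
     (length J < k \<longrightarrow> (\<forall>i\<in>I. \<forall>x\<in>U. pdifferentiable i (pds J f) x)))"
  (is "_ \<longleftrightarrow> (\<forall>J\<in>lists I. ?P k J f)")
proof (induction k arbitrary: f)
  case (Suc k)
  have eq: "pds (J @ [i]) f = pds J (pd i f)" for J i
    by (simp add: pds_append)
  show ?case (is "?l = ?r")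
  proof
    assume l: ?l
    show ?r
    proof
      fix J assume J: "J \<in> lists I"
      show "?P (Suc k) J f"
      proof (cases J rule: rev_cases)
        case Nil
        then show ?thesis using l pdifferentiable_def by simp
      next
        case (snoc K i)
        then have K: "K \<in> lists I" "i \<in> I" using J by auto
        then have "?P k K (pd i f)" using l Suc.IH by auto
        then show ?thesis by (simp add: snoc eq)
      qed
    qed
  next
    assume r: ?r
    have "ck k I U (pd i f)" if i: "i \<in> I" for i
      unfolding Suc.IH
    proof
      fix J assume "J \<in> lists I"
      then show "?P k J (pd i f)"
        using r[rule_format, of "J @ [i]"] i by (simp add: eq)
    qed
    with bspec[OF r, of "[]"] show ?l by simp
  qed
qed simp

lemma smooth_on_iff_ck: "smooth_on I U f \<longleftrightarrow> (\<forall>k. ck k I U f)"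
  unfolding smooth_on_def ck_iff pdifferentiable_def by (meson lessI order_refl)

lemma ck_imp_cont_on: "ck k I U f \<Longrightarrow> cont_on I U f"
  by (cases k) auto

lemma ck_Suc_pd:
  assumes "ck (Suc k) I U f" "i \<in> I"
  shows "ck k I U (pd i f)" and "x \<in> U \<Longrightarrow> pdifferentiable i f x"
  using assms by simp_all

lemma ck_SucD: "ck (Suc k) I U f \<Longrightarrow> ck k I U f"
  by (simp add: ck_iff)

lemma ck_subset: "ck k I U f \<Longrightarrow> V \<subseteq> U \<Longrightarrow> ck k I V f"
  by (induction k arbitrary: f) (auto intro: cont_on_subset)

lemma ck_cong:
  assumes "finite I" "openin (powertop_real I) U" "\<And>x. x \<in> U \<Longrightarrow> f x = g x" "ck k I U f"
  shows "ck k I U g"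
  using assms(3,4)
proof (induction k arbitrary: f g)
  case 0
  then show ?case using cont_on_cong[OF assms(2), of f g] by simp
next
  case (Suc k)
  have f: "cont_on I U f" "pdifferentiable i f x" "ck k I U (pd i f)" if "i \<in> I" "x \<in> U" for i x
    using Suc.prems(2) that by simp_all
  have "ck k I U (pd i g)" if i: "i \<in> I" for i
  proof (rule Suc.IH[of "pd i f"])
    show "pd i f x = pd i g x" if "x \<in> U" for x
      by (rule pd_cong[OF assms(1,2) Suc.prems(1) that i])
  qed (use Suc.prems(2) i in simp)
  moreover have "pdifferentiable i g x" if "i \<in> I" "x \<in> U" for i x
    by (rule pdifferentiable_cong[OF assms(1,2) Suc.prems(1) that(2,1) f(2)[OF that]])
  moreover have "cont_on I U g"
    by (rule cont_on_cong[OF assms(2) Suc.prems(1)]) (use Suc.prems(2) in auto)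
  ultimately show ?case by simp
qed

lemma smooth_onD:
  assumes "smooth_on I U f"
  shows smooth_on_imp_cont_on: "cont_on I U f"
    and smooth_on_pd: "i \<in> I \<Longrightarrow> smooth_on I U (pd i f)"
    and smooth_on_pdifferentiable:
      "i \<in> I \<Longrightarrow> x \<in> U \<Longrightarrow> pdifferentiable i f x"
proof -
  have *: "ck (Suc k) I U f" for k
    using assms by (simp add: smooth_on_iff_ck)
  show "cont_on I U f" using *[of 0] by simp
  show "smooth_on I U (pd i f)" if "i \<in> I"
    using * that by (auto simp: smooth_on_iff_ck)
  show "pdifferentiable i f x" if "i \<in> I" "x \<in> U"
    using *[of 0] that by simp
qed

lemma smooth_on_pds: "smooth_on I U f \<Longrightarrow> J \<in> lists I \<Longrightarrow> smooth_on I U (pds J f)"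
  by (induction J) (auto intro: smooth_on_pd)

lemma smooth_on_subset:
  assumes "smooth_on I U f" "V \<subseteq> U"
  shows "smooth_on I V f"
  using ck_subset[OF _ assms(2)] assms(1) by (simp add: smooth_on_iff_ck)

lemma smooth_on_cong:
  assumes "finite I" "openin (powertop_real I) U" "\<And>x. x \<in> U \<Longrightarrow> f x = g x" "smooth_on I U f"
  shows "smooth_on I U g"
  using ck_cong[OF assms(1-3)] assms(4) by (simp add: smooth_on_iff_ck)

lemma pd_const: "pd i (\<lambda>_. c) = (\<lambda>_. 0)"
  by (auto simp: pd_def)

lemma pd_coord: "pd i (\<lambda>x. x j) = (\<lambda>_. if i = j then 1 else 0)"
  by (auto simp: pd_def)

lemma pdifferentiable_const: "pdifferentiable i (\<lambda>_. c) x"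
  by (simp add: pdifferentiable_def)

lemma pdifferentiable_coord: "pdifferentiable i (\<lambda>x. x j) x"
  by (cases "i = j") (simp_all add: pdifferentiable_def)

lemma pdifferentiable_add:
  "pdifferentiable i f x \<Longrightarrow> pdifferentiable i g x \<Longrightarrow> pdifferentiable i (\<lambda>x. f x + g x) x"
  by (simp add: pdifferentiable_def)

lemma pdifferentiable_mult:
  "pdifferentiable i f x \<Longrightarrow> pdifferentiable i g x \<Longrightarrow> pdifferentiable i (\<lambda>x. f x * g x) x"
  by (simp add: pdifferentiable_def)

lemma pd_add:
  assumes "pdifferentiable i f x" "pdifferentiable i g x"
  shows "pd i (\<lambda>x. f x + g x) x = pd i f x + pd i g x"
  by (intro pd_eqI DERIV_add has_real_derivative_pd assms)

lemma pd_mult: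
  assumes "pdifferentiable i f x" "pdifferentiable i g x"
  shows "pd i (\<lambda>x. f x * g x) x = pd i f x * g x + f x * pd i g x"
  using DERIV_mult[OF assms[THEN has_real_derivative_pd]]
  by (intro pd_eqI) (simp add: algebra_simps)

lemma pd_sum:
  assumes "\<And>a. a \<in> S \<Longrightarrow> pdifferentiable i (f a) x"
  shows "pd i (\<lambda>x. \<Sum>a\<in>S. f a x) x = (\<Sum>a\<in>S. pd i (f a) x)"
  by (intro pd_eqI DERIV_sum has_real_derivative_pd assms)

lemma ck_const: "ck k I U (\<lambda>_. c)"
  by (induction k arbitrary: c) (auto simp: pd_const pdifferentiable_const)

lemma ck_coord: "i \<in> I \<Longrightarrow> ck k I U (\<lambda>x. x i)"
  by (cases k) (auto simp: pd_coord cont_on_coord ck_const pdifferentiable_coord)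

lemma ck_add:
  assumes "finite I" "openin (powertop_real I) U" "ck k I U f" "ck k I U g"
  shows "ck k I U (\<lambda>x. f x + g x)"
  using assms(3,4)
proof (induction k arbitrary: f g)
  case 0
  then show ?case by (auto intro: continuous_map_add)
next
  case (Suc k)
  have "ck k I U (pd i (\<lambda>x. f x + g x))" if "i \<in> I" for i
    by (rule ck_cong[OF assms(1,2) _ Suc.IH[of "pd i f" "pd i g"]])
      (use Suc.prems that in \<open>auto simp: pd_add\<close>)
  then show ?case
    using Suc.prems by (auto intro: continuous_map_add pdifferentiable_add)
qed

lemma ck_mult:
  assumes "finite I" "openin (powertop_real I) U" "ck k I U f" "ck k I U g"
  shows "ck k I U (\<lambda>x. f x * g x)"
  using assms(3,4)
proof (induction k arbitrary: f g)
  case 0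
  then show ?case by (auto intro: continuous_map_real_mult)
next
  case (Suc k)
  have "ck k I U (pd i (\<lambda>x. f x * g x))" if "i \<in> I" for i
    by (rule ck_cong[OF assms(1,2) _ ck_add[OF assms(1,2) Suc.IH[of "pd i f" g] Suc.IH[of f "pd i g"]]])
      (use Suc.prems that ck_SucD[OF Suc.prems(1)] ck_SucD[OF Suc.prems(2)] in \<open>auto simp: pd_mult\<close>)
  then show ?case
    using Suc.prems by (auto intro: continuous_map_real_mult pdifferentiable_mult)
qed

lemma ck_sum:
  assumes "finite I" "openin (powertop_real I) U" "\<And>a. a \<in> S \<Longrightarrow> ck k I U (f a)"
  shows "ck k I U (\<lambda>x. \<Sum>a\<in>S. f a x)"
  using assms(3)
  by (induction S rule: infinite_finite_induct) (auto simp: ck_const intro: ck_add[OF assms(1,2)])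

lemma smooth_on_const: "smooth_on I U (\<lambda>_. c)"
  by (simp add: smooth_on_iff_ck ck_const)

lemma smooth_on_coord: "i \<in> I \<Longrightarrow> smooth_on I U (\<lambda>x. x i)"
  by (simp add: smooth_on_iff_ck ck_coord)

lemma smooth_on_mult:
  assumes "finite I" "openin (powertop_real I) U" "smooth_on I U f" "smooth_on I U g"
  shows "smooth_on I U (\<lambda>x. f x * g x)"
  using ck_mult[OF assms(1,2)] assms(3,4) by (simp add: smooth_on_iff_ck)

lemma smooth_on_sum:
  assumes "finite I" "openin (powertop_real I) U" "\<And>a. a \<in> S \<Longrightarrow> smooth_on I U (f a)"
  shows "smooth_on I U (\<lambda>x. \<Sum>a\<in>S. f a x)"
  using ck_sum[OF assms(1,2), of S _ f] assms(3) by (simp add: smooth_on_iff_ck)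

section \<open>Mean values, chain rule, symmetry of second derivatives\<close>

lemma MVT_closed_segment:
  fixes f :: "real \<Rightarrow> real"
  assumes "\<And>z. z \<in> closed_segment a b \<Longrightarrow> (f has_real_derivative f' z) (at z)"
  obtains z where "z \<in> closed_segment a b" "f b - f a = f' z * (b - a)"
proof -
  consider "a < b" | "a = b" | "b < a" by linarith
  then show thesis
  proof cases
    case 1
    then obtain z where z: "z > a" "z < b" "f b - f a = (b - a) * f' z"
      using MVT2[of a b f f'] assms by (auto simp: closed_segment_eq_real_ivl)
    show ?thesis
      by (rule that[of z]) (use z 1 in \<open>auto simp: closed_segment_eq_real_ivl\<close>)
  next
    case 2
    then show ?thesis using that[of a] by auto
  next
    case 3
    then obtain z where z: "z > b" "z < a" "f a - f b = (a - b) * f' z"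
      using MVT2[of b a f f'] assms by (auto simp: closed_segment_eq_real_ivl)
    show ?thesis
      by (rule that[of z]) (use z 3 in \<open>auto simp: closed_segment_eq_real_ivl algebra_simps\<close>)
  qed
qed

lemma closed_segment_abs_le:
  fixes z :: real
  assumes "z \<in> closed_segment a b"
  shows "\<bar>z - a\<bar> \<le> \<bar>b - a\<bar>"
  using assms by (auto simp: closed_segment_eq_real_ivl split: if_splits)

text \<open>Walk from \<open>x\<close> to \<open>y\<close> one coordinate at a time and use the
  one-dimensional mean value theorem on each leg; \<open>S\<close> collects the coordinates that may
  have changed. The intermediate points are no farther from \<open>x\<close> than \<open>y\<close>
  in any coordinate, so they converge to \<open>x\<close> when \<open>y\<close> does.\<close>

lemma telescoping_mean_value:
  assumes "finite S" "S \<subseteq> I" "x \<in> extensional I" "y \<in> cube I x d" "\<forall>i\<in>I - S. y i = x i"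
    and diff: "\<And>i z. i \<in> I \<Longrightarrow> z \<in> cube I x d \<Longrightarrow> pdifferentiable i f z"
  shows "\<exists>\<xi>. (\<forall>j\<in>S. \<xi> j \<in> cube I x d \<and> (\<forall>i\<in>I. \<bar>\<xi> j i - x i\<bar> \<le> \<bar>y i - x i\<bar>)) \<and>
     f y - f x = (\<Sum>j\<in>S. pd j f (\<xi> j) * (y j - x j))"
  using assms(1,2,4,5)
proof (induction S arbitrary: y rule: finite_induct)
  case empty
  have "y = x"
    by (rule extensionalityI[of _ I]) (use empty assms in \<open>auto simp: cube_def\<close>)
  then show ?case by simp
next
  case (insert a S)
  \<comment> \<open>The point before the last leg: coordinate \<open>a\<close> is still that of
    \<open>x\<close>.\<close>
  define y' where "y' = y(a := x a)"
  have a: "a \<in> I" using insert by simp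
  have ext: "y \<in> extensional I" using insert by (simp add: cube_def)
  have dpos: "d > 0" using insert.prems a unfolding cube_def by fastforce
  have y': "y' \<in> cube I x d"
    using insert.prems dpos ext a unfolding y'_def cube_def by (auto simp: fun_upd_in_extensional)
  have "\<forall>i\<in>I - S. y' i = x i"
    using insert.prems by (auto simp: y'_def)
  then obtain \<xi> where \<xi>: "\<forall>j\<in>S. \<xi> j \<in> cube I x d \<and> (\<forall>i\<in>I. \<bar>\<xi> j i - x i\<bar> \<le> \<bar>y' i - x i\<bar>)"
     "f y' - f x = (\<Sum>j\<in>S. pd j f (\<xi> j) * (y' j - x j))"
    using insert.IH[of y'] y' insert.prems(1) by blast
  have seg: "y(a := z) \<in> cube I x d" if "z \<in> closed_segment (x a) (y a)" for z
  proof -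
    have "\<bar>z - x a\<bar> \<le> \<bar>y a - x a\<bar>" using closed_segment_abs_le[OF that] .
    moreover have "\<bar>y a - x a\<bar> < d" using insert.prems a by (auto simp: cube_def)
    ultimately show ?thesis
      using insert.prems a ext unfolding cube_def by (auto simp: fun_upd_in_extensional)
  qed
  obtain z where z: "z \<in> closed_segment (x a) (y a)"
    "f (y(a := y a)) - f (y(a := x a)) = pd a f (y(a := z)) * (y a - x a)"
  proof (rule MVT_closed_segment[of "x a" "y a" "\<lambda>h. f (y(a := h))" "\<lambda>z. pd a f (y(a := z))"])
    fix z assume "z \<in> closed_segment (x a) (y a)"
    from has_real_derivative_pd[OF diff[OF a seg[OF this]]]
    show "((\<lambda>h. f (y(a := h))) has_real_derivative pd a f (y(a := z))) (at z)"
      by simp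
  qed auto
  have zle: "\<bar>z - x a\<bar> \<le> \<bar>y a - x a\<bar>" using closed_segment_abs_le[OF z(1)] .
  let ?\<xi> = "\<xi>(a := y(a := z))"
  have S: "(\<Sum>j\<in>S. pd j f (?\<xi> j) * (y j - x j)) = (\<Sum>j\<in>S. pd j f (\<xi> j) * (y' j - x j))"
    by (rule sum.cong) (use insert.hyps in \<open>auto simp: y'_def\<close>)
  have le: "\<bar>y' i - x i\<bar> \<le> \<bar>y i - x i\<bar>" for i by (auto simp: y'_def)
  show ?case
  proof (intro exI[of _ ?\<xi>] conjI ballI)
    fix j assume "j \<in> insert a S"
    then show "?\<xi> j \<in> cube I x d" using \<xi>(1) seg z(1) by auto
    fix i assume "i \<in> I"
    then show "\<bar>?\<xi> j i - x i\<bar> \<le> \<bar>y i - x i\<bar>"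
      using \<xi>(1) \<open>j \<in> insert a S\<close> zle le[of i] by (auto intro: order_trans)
  next
    show "f y - f x = (\<Sum>j\<in>insert a S. pd j f (?\<xi> j) * (y j - x j))"
      using insert.hyps S z(2) \<xi>(2) by (simp add: y'_def)
  qed
qed

text \<open>The difference quotient of \<open>f\<close> along the curve is the telescoped sum, with
  partial derivatives taken at intermediate points. These points are squeezed towards
  \<open>c t0\<close>, and continuity of the partial derivatives gives the limit.\<close>

lemma chain_rule_curve:
  assumes I: "finite I" and V: "openin (powertop_real I) V" and f: "ck (Suc 0) I V f"
    and c0: "c t0 \<in> V" and ext: "\<And>t. c t \<in> extensional I"
    and der: "\<And>i. i \<in> I \<Longrightarrow> ((\<lambda>t. c t i) has_real_derivative c' i) (at t0)"
  shows "((\<lambda>t. f (c t)) has_real_derivative (\<Sum>i\<in>I. pd i f (c t0) * c' i)) (at t0)"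
proof -
  let ?x = "c t0"
  obtain d where d: "d > 0" "cube I ?x d \<subseteq> V" using openin_cubeE[OF I V c0] .
  have diff: "pdifferentiable i f z" if "i \<in> I" "z \<in> cube I ?x d" for i z
    using ck_Suc_pd(2)[OF f that(1)] that(2) d(2) by blast
  have cont: "((\<lambda>t. c t i) \<longlongrightarrow> ?x i) (at t0)" if "i \<in> I" for i
    using DERIV_isCont[OF der[OF that]] by (simp add: isCont_def)
  have "\<forall>\<^sub>F t in at t0. \<forall>i\<in>I. \<bar>c t i - ?x i\<bar> < e" if "e > 0" for e
    unfolding eventually_ball_finite_distrib[OF I]
    using tendstoD[OF cont that] by (simp add: dist_real_def)
  then have ev: "\<forall>\<^sub>F t in at t0. c t \<in> cube I ?x e" if "e > 0" for e
    using that ext by (simp add: cube_def)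
  define P where "P y \<xi> \<longleftrightarrow>
     (\<forall>j\<in>I. \<xi> j \<in> cube I ?x d \<and> (\<forall>i\<in>I. \<bar>\<xi> j i - ?x i\<bar> \<le> \<bar>y i - ?x i\<bar>)) \<and>
     f y - f ?x = (\<Sum>j\<in>I. pd j f (\<xi> j) * (y j - ?x j))" for y \<xi>
  have ex: "\<exists>\<xi>. P y \<xi>" if "y \<in> cube I ?x d" for y
    unfolding P_def by (rule telescoping_mean_value[OF I subset_refl ext that _ diff]) simp
  \<comment> \<open>Choice turns the intermediate points into a function of \<open>t\<close>. Its
    value is arbitrary when \<open>c t\<close> leaves the cube, which does not happen close to
    \<open>t0\<close>.\<close>
  define \<xi> where "\<xi> t = (SOME \<xi>. P (c t) \<xi>)" for t
  have \<xi>: "P (c t) (\<xi> t)" if "c t \<in> cube I ?x d" for t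
    unfolding \<xi>_def by (rule someI_ex[OF ex[OF that]])
  have lim: "((\<lambda>t. pd j f (\<xi> t j)) \<longlongrightarrow> pd j f ?x) (at t0)" if j: "j \<in> I" for j
  proof (rule tendstoI)
    fix e :: real assume "e > 0"
    have cj: "cont_on I V (pd j f)" using ck_Suc_pd(1)[OF f j] by simp
    obtain d' where d': "d' > 0" "cube I ?x d' \<subseteq> V" "\<forall>y\<in>cube I ?x d'. \<bar>pd j f y - pd j f ?x\<bar> < e"
      using cont_on_cubeE[OF I V cj c0 \<open>e > 0\<close>] .
    show "\<forall>\<^sub>F t in at t0. dist (pd j f (\<xi> t j)) (pd j f ?x) < e"
      using ev[OF d(1)] ev[OF d'(1)]
    proof eventually_elim
      case (elim t)
      have "\<xi> t j \<in> cube I ?x d'"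
      proof -
        have 1: "\<xi> t j \<in> cube I ?x d" "\<bar>\<xi> t j i - ?x i\<bar> \<le> \<bar>c t i - ?x i\<bar>" if "i \<in> I" for i
          using \<xi>[OF elim(1)] j that unfolding P_def by blast+
        have "\<bar>c t i - ?x i\<bar> < d'" if "i \<in> I" for i
          using elim(2) that unfolding cube_def by blast
        with 1 have "\<bar>\<xi> t j i - ?x i\<bar> < d'" if "i \<in> I" for i
          using that le_less_trans by blast
        with 1(1)[OF j] show ?thesis by (simp add: cube_def)
      qed
      then show ?case using d'(3) by (simp add: dist_real_def)
    qed
  qed
  have "((\<lambda>t. \<Sum>j\<in>I. pd j f (\<xi> t j) * ((c t j - ?x j) / (t - t0))) \<longlongrightarrow>
     (\<Sum>i\<in>I. pd i f ?x * c' i)) (at t0)"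
    by (intro tendsto_sum tendsto_mult lim) (use der in \<open>simp_all add: has_field_derivative_iff\<close>)
  moreover have "\<forall>\<^sub>F t in at t0. (\<Sum>j\<in>I. pd j f (\<xi> t j) * ((c t j - ?x j) / (t - t0))) =
     (f (c t) - f ?x) / (t - t0)"
    using ev[OF d(1)] by eventually_elim (use \<xi> in \<open>simp add: P_def sum_divide_distrib\<close>)
  ultimately show ?thesis
    unfolding has_field_derivative_iff by (rule Lim_transform_eventually)
qed

text \<open>The curve is the coordinate line \<open>h \<mapsto> x(i := h)\<close> mapped by
  \<open>g\<close>. The restriction to \<open>K\<close> makes its values points of the target
  coordinate space.\<close>

lemma chain_rule:
  assumes I: "finite I" and U: "openin (powertop_real I) U"
    and K: "finite K" and V: "openin (powertop_real K) V" and f: "ck (Suc 0) K V f"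
    and g: "\<And>j. j \<in> K \<Longrightarrow> pdifferentiable i (g j) x"
    and x: "(\<lambda>j\<in>K. g j x) \<in> V"
  shows "((\<lambda>h. f (\<lambda>j\<in>K. g j (x(i := h)))) has_real_derivative
      (\<Sum>j\<in>K. pd j f (\<lambda>j\<in>K. g j x) * pd i (g j) x)) (at (x i))"
    and "pd i (\<lambda>x. f (\<lambda>j\<in>K. g j x)) x = (\<Sum>j\<in>K. pd j f (\<lambda>j\<in>K. g j x) * pd i (g j) x)"
proof -
  have "((\<lambda>h. f (\<lambda>j\<in>K. g j (x(i := h)))) has_real_derivative
      (\<Sum>j\<in>K. pd j f (\<lambda>j\<in>K. g j (x(i := x i))) * pd i (g j) x)) (at (x i))"
    using chain_rule_curve[OF K V f, of "\<lambda>h. \<lambda>j\<in>K. g j (x(i := h))" "x i" "\<lambda>j. pd i (g j) x"]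
      has_real_derivative_pd[OF g] x by simp
  then show *: "((\<lambda>h. f (\<lambda>j\<in>K. g j (x(i := h)))) has_real_derivative
      (\<Sum>j\<in>K. pd j f (\<lambda>j\<in>K. g j x) * pd i (g j) x)) (at (x i))"
    by simp
  show "pd i (\<lambda>x. f (\<lambda>j\<in>K. g j x)) x = (\<Sum>j\<in>K. pd j f (\<lambda>j\<in>K. g j x) * pd i (g j) x)"
    using * by (rule pd_eqI)
qed

text \<open>By the chain rule a derivative of the composite is a sum of products of a composite with
  \<open>pd j f\<close>, to which the induction hypothesis applies, and a derivative of
  \<open>g j\<close>. The induction therefore varies \<open>f\<close> and keeps
  \<open>g\<close>.\<close>

lemma ck_compose:
  assumes I: "finite I" and U: "openin (powertop_real I) U"
    and K: "finite K" and V: "openin (powertop_real K) V"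
    and f: "ck k K V f" and g: "\<And>j. j \<in> K \<Longrightarrow> ck k I U (g j)"
    and gU: "\<And>x. x \<in> U \<Longrightarrow> (\<lambda>j\<in>K. g j x) \<in> V"
  shows "ck k I U (\<lambda>x. f (\<lambda>j\<in>K. g j x))"
  using f g
proof (induction k arbitrary: f)
  case 0
  then show ?case using cont_on_compose[OF U, of K g V f, OF _ _ gU] by (simp only: ck.simps)
next
  case (Suc k)
  have f1: "ck (Suc 0) K V f" 
    using Suc.prems(1) ck_imp_cont_on unfolding ck.simps by blast
  have g': "ck k I U (g j)" if "j \<in> K" for j using ck_SucD Suc.prems(2)[OF that] by blast
  have gd: "pdifferentiable i (g j) x" if "i \<in> I" "x \<in> U" "j \<in> K" for i x j
    using Suc.prems(2)[OF \<open>j \<in> K\<close>] that by simp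
  note chain = chain_rule[OF I U K V f1, where g = g]
  have "ck k I U (pd i (\<lambda>x. f (\<lambda>j\<in>K. g j x)))" if i: "i \<in> I" for i
  proof (rule ck_cong[OF I U])
    show "ck k I U (\<lambda>x. \<Sum>j\<in>K. pd j f (\<lambda>j\<in>K. g j x) * pd i (g j) x)"
    proof (intro ck_sum ck_mult I U)
      fix j assume j: "j \<in> K"
      show "ck k I U (\<lambda>x. pd j f (\<lambda>j\<in>K. g j x))"
        by (rule Suc.IH[of "pd j f", OF _ g']) (use Suc.prems(1) j in auto)
      show "ck k I U (pd i (g j))"
        using Suc.prems(2)[OF j] i by simp
    qed
    show "(\<Sum>j\<in>K. pd j f (\<lambda>j\<in>K. g j x) * pd i (g j) x) = pd i (\<lambda>x. f (\<lambda>j\<in>K. g j x)) x"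
      if "x \<in> U" for x
      using chain(2)[OF gd[OF i that] gU[OF that]] by (rule sym)
  qed
  moreover have "cont_on I U (\<lambda>x. f (\<lambda>j\<in>K. g j x))"
    by (rule cont_on_compose[OF U ck_imp_cont_on[OF g'] ck_imp_cont_on[OF f1] gU])
  moreover have "pdifferentiable i (\<lambda>x. f (\<lambda>j\<in>K. g j x)) x" if "i \<in> I" "x \<in> U" for i x
    by (rule pdifferentiableI[OF chain(1)[OF gd[OF that] gU[OF that(2)]]])
  ultimately show ?case
    by (simp del: restrict_apply)
qed

lemma smooth_on_compose:
  assumes "finite I" "openin (powertop_real I) U" "finite K" "openin (powertop_real K) V"
    "smooth_on K V f" "\<And>j. j \<in> K \<Longrightarrow> smooth_on I U (g j)"
    "\<And>x. x \<in> U \<Longrightarrow> (\<lambda>j\<in>K. g j x) \<in> V"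
  shows "smooth_on I U (\<lambda>x. f (\<lambda>j\<in>K. g j x))"
  unfolding smooth_on_iff_ck
proof
  fix k
  have "ck k K V f" "\<And>j. j \<in> K \<Longrightarrow> ck k I U (g j)"
    using assms(5,6) by (simp_all add: smooth_on_iff_ck)
  then show "ck k I U (\<lambda>x. f (\<lambda>j\<in>K. g j x))"
    using assms(7) by (rule ck_compose[OF assms(1-4), where g = g])
qed

text \<open>Two mean value theorems in succession: in \<open>u\<close> for the difference over the
  step in \<open>v\<close>, then in \<open>v\<close> for the resulting derivative.\<close>

lemma mixed_second_difference:
  fixes g :: "real \<Rightarrow> real \<Rightarrow> real"
  assumes "\<And>u v. \<bar>u - a\<bar> \<le> h \<Longrightarrow> \<bar>v - b\<bar> \<le> h \<Longrightarrow> ((\<lambda>u. g u v) has_real_derivative g1 u v) (at u)"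
    "\<And>u v. \<bar>u - a\<bar> \<le> h \<Longrightarrow> \<bar>v - b\<bar> \<le> h \<Longrightarrow> ((\<lambda>v. g1 u v) has_real_derivative g12 u v) (at v)"
    "h > 0"
  shows "\<exists>u v. \<bar>u - a\<bar> \<le> h \<and> \<bar>v - b\<bar> \<le> h \<and>
    g (a + h) (b + h) - g (a + h) b - (g a (b + h) - g a b) = h * h * g12 u v"
proof -
  have "((\<lambda>u. g u (b + h) - g u b) has_real_derivative g1 u (b + h) - g1 u b) (at u)"
    if "a \<le> u" "u \<le> a + h" for u
    by (intro DERIV_diff assms(1)) (use that assms(3) in auto)
  then obtain u where u: "u > a" "u < a + h"
    "(g (a + h) (b + h) - g (a + h) b) - (g a (b + h) - g a b) = (a + h - a) * (g1 u (b + h) - g1 u b)"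
    using MVT2[of a "a + h" "\<lambda>u. g u (b + h) - g u b" "\<lambda>u. g1 u (b + h) - g1 u b"] assms(3) by auto
  obtain v where v: "v > b" "v < b + h" "g1 u (b + h) - g1 u b = (b + h - b) * g12 u v"
    using MVT2[of b "b + h" "g1 u" "g12 u"] assms(2,3) u by auto
  have "\<bar>u - a\<bar> \<le> h" "\<bar>v - b\<bar> \<le> h"
    using u(1,2) v(1,2) by simp_all
  moreover have "g (a + h) (b + h) - g (a + h) b - (g a (b + h) - g a b) = h * h * g12 u v"
    using u(3) v(3) by simp
  ultimately show ?thesis by blast
qed

text \<open>One second difference over a square of side \<open>h\<close> equals \<open>h * h\<close>
  times a value of either mixed derivative near \<open>x\<close>, depending on the variable treated
  first. Continuity of both mixed derivatives at \<open>x\<close> then identifies their values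
  there.\<close>

lemma pd_commute:
  assumes I: "finite I" and U: "openin (powertop_real I) U" and f: "ck (Suc (Suc 0)) I U f"
    and x: "x \<in> U" and i: "i \<in> I" and j: "j \<in> I"
  shows "pd i (pd j f) x = pd j (pd i f) x"
proof (cases "i = j")
  case False
  have f': "ck (Suc 0) I U (pd k f)" "\<And>z. z \<in> U \<Longrightarrow> pdifferentiable k f z" if "k \<in> I" for k
    using ck_Suc_pd[OF f that] by blast+
  have f'': "cont_on I U (pd l (pd k f))" "\<And>z. z \<in> U \<Longrightarrow> pdifferentiable l (pd k f) z"
    if "k \<in> I" "l \<in> I" for k l
    using ck_Suc_pd[OF f'(1)[OF that(1)] that(2)] by simp_all
  have "pd i (pd j f) x - pd j (pd i f) x = 0"
  proof (rule dense_eq0_I)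
    fix e :: real assume "e > 0"
    then have e: "e / 2 > 0" by simp
    obtain d1 where d1: "d1 > 0" "cube I x d1 \<subseteq> U"
      "\<forall>y\<in>cube I x d1. \<bar>pd i (pd j f) y - pd i (pd j f) x\<bar> < e / 2"
      using cont_on_cubeE[OF I U f''(1)[OF j i] x e] .
    obtain d2 where d2: "d2 > 0" "cube I x d2 \<subseteq> U"
      "\<forall>y\<in>cube I x d2. \<bar>pd j (pd i f) y - pd j (pd i f) x\<bar> < e / 2"
      using cont_on_cubeE[OF I U f''(1)[OF i j] x e] .
    \<comment> \<open>Halving places the closed square of side \<open>h\<close> inside both open
      cubes.\<close>
    define h where "h = min d1 d2 / 2"
    have h: "h > 0" "h < d1" "h < d2" using d1(1) d2(1) by (auto simp: h_def)
    define X where "X u v = x(i := u, j := v)" for u v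
    have X': "X u v = x(j := v, i := u)" for u v using False by (auto simp: X_def)
    have Xc: "X u v \<in> cube I x d1" "X u v \<in> cube I x d2" "X u v \<in> U"
      if "\<bar>u - x i\<bar> \<le> h" "\<bar>v - x j\<bar> \<le> h" for u v
    proof -
      have "X u v \<in> extensional I"
        unfolding X_def using openin_powertop_real_extensional[OF U x] i j
        by (intro fun_upd_in_extensional)
      then show "X u v \<in> cube I x d1" "X u v \<in> cube I x d2"
        using that h by (auto simp: cube_def X_def)
      then show "X u v \<in> U" using d1(2) by blast
    qed
    have X1: "((\<lambda>u. F (X u v)) has_real_derivative pd i F (X u v)) (at u)"
      if "pdifferentiable i F (X u v)" for F u v
      using has_real_derivative_pd[OF that] by (simp add: X')
    have X2: "((\<lambda>v. F (X u v)) has_real_derivative pd j F (X u v)) (at v)"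
      if "pdifferentiable j F (X u v)" for F u v
      using has_real_derivative_pd[OF that] by (simp add: X_def)
    have D1: "((\<lambda>u. f (X u v)) has_real_derivative pd i f (X u v)) (at u)"
      and D21: "((\<lambda>v. pd i f (X u v)) has_real_derivative pd j (pd i f) (X u v)) (at v)"
      if "\<bar>u - x i\<bar> \<le> h" "\<bar>v - x j\<bar> \<le> h" for u v
      by (rule X1[OF f'(2)[OF i Xc(3)[OF that]]], rule X2[OF f''(2)[OF i j Xc(3)[OF that]]])
    have D2: "((\<lambda>v. f (X u v)) has_real_derivative pd j f (X u v)) (at v)"
      and D12: "((\<lambda>u. pd j f (X u v)) has_real_derivative pd i (pd j f) (X u v)) (at u)"
      if "\<bar>v - x j\<bar> \<le> h" "\<bar>u - x i\<bar> \<le> h" for u v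
      by (rule X2[OF f'(2)[OF j Xc(3)[OF that(2,1)]]], rule X1[OF f''(2)[OF j i Xc(3)[OF that(2,1)]]])
    let ?\<Delta> = "f (X (x i + h) (x j + h)) - f (X (x i + h) (x j)) - (f (X (x i) (x j + h)) - f (X (x i) (x j)))"
    have "\<exists>u v. \<bar>u - x i\<bar> \<le> h \<and> \<bar>v - x j\<bar> \<le> h \<and> ?\<Delta> = h * h * pd j (pd i f) (X u v)"
      by (rule mixed_second_difference[of "x i" h "x j" "\<lambda>u v. f (X u v)" "\<lambda>u v. pd i f (X u v)"
          "\<lambda>u v. pd j (pd i f) (X u v)"], erule (1) D1, erule (1) D21, rule h(1))
    then obtain u v where uv: "\<bar>u - x i\<bar> \<le> h" "\<bar>v - x j\<bar> \<le> h" "?\<Delta> = h * h * pd j (pd i f) (X u v)"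
      by (elim exE conjE) (rule that)
    \<comment> \<open>The same four values grouped the other way, with the two coordinates
      exchanged.\<close>
    have "\<exists>v u. \<bar>v - x j\<bar> \<le> h \<and> \<bar>u - x i\<bar> \<le> h \<and>
        f (X (x i + h) (x j + h)) - f (X (x i) (x j + h)) - (f (X (x i + h) (x j)) - f (X (x i) (x j)))
          = h * h * pd i (pd j f) (X u v)"
      by (rule mixed_second_difference[of "x j" h "x i" "\<lambda>v u. f (X u v)" "\<lambda>v u. pd j f (X u v)"
            "\<lambda>v u. pd i (pd j f) (X u v)"], erule (1) D2, erule (1) D12, rule h(1))
    then obtain u' v' where uv': "\<bar>u' - x i\<bar> \<le> h" "\<bar>v' - x j\<bar> \<le> h"
      "f (X (x i + h) (x j + h)) - f (X (x i) (x j + h)) - (f (X (x i + h) (x j)) - f (X (x i) (x j)))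
          = h * h * pd i (pd j f) (X u' v')"
      by (elim exE conjE) (rule that)
    have "?\<Delta> = h * h * pd i (pd j f) (X u' v')" using uv'(3) by linarith
    then have "h * h * pd j (pd i f) (X u v) = h * h * pd i (pd j f) (X u' v')"
      by (rule trans[OF uv(3)[symmetric]])
    then have "pd j (pd i f) (X u v) = pd i (pd j f) (X u' v')"
      using h(1) by simp
    moreover have "\<bar>pd j (pd i f) (X u v) - pd j (pd i f) x\<bar> < e / 2"
      by (rule bspec[OF d2(3) Xc(2)[OF uv(1,2)]])
    moreover have "\<bar>pd i (pd j f) (X u' v') - pd i (pd j f) x\<bar> < e / 2"
      by (rule bspec[OF d1(3) Xc(1)[OF uv'(1,2)]])
    ultimately show "\<bar>pd i (pd j f) x - pd j (pd i f) x\<bar> \<le> e" by linarith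
  qed
  then show ?thesis by simp
qed simp

lemma smooth_on_pd_commute:
  assumes "finite I" "openin (powertop_real I) U" "smooth_on I U f" "x \<in> U" "i \<in> I" "j \<in> I"
  shows "pd i (pd j f) x = pd j (pd i f) x"
  using pd_commute[OF assms(1,2) _ assms(4-6)] assms(3) unfolding smooth_on_iff_ck by blast

text \<open>This is what permits indexing jet coordinates by multisets. The induction removes the
  last entry \<open>j\<close> of \<open>J\<close>, so an occurrence of \<open>j\<close> in
  \<open>K\<close> is first carried to the end, past one entry after another.\<close>

lemma pds_mset_cong:
  assumes I: "finite I" and U: "openin (powertop_real I) U" and "smooth_on I U f" "x \<in> U"
    and "J \<in> lists I" "mset J = mset K"
  shows "pds J f x = pds K f x"
  using assms(3-6)
proof (induction J arbitrary: K f x rule: rev_induct)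
  case (snoc j J)
  have "j \<in> set K" using mset_eq_setD[OF snoc.prems(4)] by auto
  then obtain K1 K2 where K: "K = K1 @ j # K2" by (meson split_list)
  have J: "J \<in> lists I" "j \<in> I" using snoc.prems(3) by auto
  have KI: "K \<in> lists I"
    using snoc.prems(3) mset_eq_setD[OF snoc.prems(4)] unfolding in_lists_conv_set by blast
  then have K2: "K1 \<in> lists I" "K2 \<in> lists I" using K by auto
  have move: "pds (j # K2) f y = pds (K2 @ [j]) f y" if "y \<in> U" for y
    using K2(2) that
  proof (induction K2 arbitrary: y)
    case (Cons k L)
    note L = Cons.hyps
    have "pds (j # k # L) f y = pd k (pds (j # L) f) y"
      using smooth_on_pd_commute[OF I U smooth_on_pds[OF snoc.prems(1) L(2)] Cons.prems J(2) L(1)]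
      by simp
    also have "\<dots> = pd k (pds (L @ [j]) f) y"
      by (rule pd_cong[OF I U Cons.IH Cons.prems L(1)])
    finally show ?case by simp
  qed simp
  have "pds (J @ [j]) f x = pds J (pd j f) x" by (simp add: pds_append)
  also have "\<dots> = pds (K1 @ K2) (pd j f) x"
    by (rule snoc.IH[OF smooth_on_pd[OF snoc.prems(1) J(2)] snoc.prems(2) J(1)])
      (use snoc.prems(4) K in simp)
  also have "\<dots> = pds K1 (pds (K2 @ [j]) f) x" by (simp add: pds_append)
  also have "\<dots> = pds K1 (pds (j # K2) f) x"
    by (rule pds_cong[OF I U move[symmetric] snoc.prems(2) K2(1)])
  also have "\<dots> = pds K f x" by (simp add: K pds_append)
  finally show ?case .
qed simp

section \<open>Total derivatives and jets of curves in coordinates\<close>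

lemma finite_multisets_size_le: "finite {M :: 'a::finite multiset. size M \<le> s}"
proof -
  have "{M :: 'a multiset. size M \<le> s} \<subseteq> mset ` {xs. set xs \<subseteq> UNIV \<and> length xs \<le> s}"
  proof
    fix M :: "'a multiset" assume M: "M \<in> {M. size M \<le> s}"
    obtain J where J: "mset J = M" using ex_mset[of M] by (elim exE)
    then have "length J \<le> s" using M by auto
    then show "M \<in> mset ` {xs. set xs \<subseteq> UNIV \<and> length xs \<le> s}"
      by (intro image_eqI[of _ _ J]) (simp_all add: J)
  qed
  then show ?thesis
    by (rule finite_subset) (intro finite_imageI finite_lists_length_le finite)
qed

lemma velocity_index_eq: "velocity_index s = UNIV \<times> {M. size M \<le> s}"
  by (auto simp: velocity_index_def)

lemma mem_velocity_index [simp]: "a \<in> velocity_index s \<longleftrightarrow> size (snd a) \<le> s"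
  by (cases a) (simp add: velocity_index_def)

lemma finite_velocity_index [simp]: "finite (velocity_index s :: ('N::finite \<times> 'n::finite multiset) set)"
  by (simp add: velocity_index_eq finite_multisets_size_le)

text \<open>The choice of an ordering made in \<open>velocity_chart_map\<close>; with the same
  choice, chart coordinates of a jet are literally values of \<open>curve_jet\<close>.\<close>

definition list_of_mset :: "'a multiset \<Rightarrow> 'a list" where
  "list_of_mset M = (SOME J. mset J = M)"

lemma mset_list_of_mset [simp]: "mset (list_of_mset M) = M"
  unfolding list_of_mset_def by (rule someI_ex) (rule ex_mset)

lemma length_list_of_mset [simp]: "length (list_of_mset M) = size M"
  by (metis mset_list_of_mset size_mset)

section \<open>Jets of curves and truncated total derivatives\<close>

definition curve_jet ::
  "nat \<Rightarrow> ('N \<Rightarrow> ('n \<Rightarrow> real) \<Rightarrow> real) \<Rightarrow> ('n \<Rightarrow> real) \<Rightarrow> 'N \<times> 'n multiset \<Rightarrow> real" where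
  "curve_jet s y t = (\<lambda>a\<in>velocity_index s. pds (list_of_mset (snd a)) (y (fst a)) t)"

text \<open>The formal derivative in the independent coordinates: summing over multisets replaces
  the weighted sum over sequences. Coordinates of top order are left out because their shifted
  partners would have order \<open>Suc s\<close>.\<close>

definition total_deriv ::
  "nat \<Rightarrow> 'n \<Rightarrow> (('N \<times> 'n multiset \<Rightarrow> real) \<Rightarrow> real) \<Rightarrow> ('N \<times> 'n multiset \<Rightarrow> real) \<Rightarrow> real" where
  "total_deriv s i g u = (\<Sum>a\<in>{a. size (snd a) < s}. u (fst a, add_mset i (snd a)) * pd a g u)"

definition total_derivs ::
  "nat \<Rightarrow> 'n list \<Rightarrow> (('N \<times> 'n multiset \<Rightarrow> real) \<Rightarrow> real) \<Rightarrow> ('N \<times> 'n multiset \<Rightarrow> real) \<Rightarrow> real" where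
  "total_derivs s J g = foldr (total_deriv s) J g"

text \<open>Order at most \<open>k\<close> is expressed by vanishing partial derivatives, the form
  in which it enters the chain rule and is passed on to derivatives.\<close>

definition jet_order_le ::
  "nat \<Rightarrow> nat \<Rightarrow> ('N \<times> 'n multiset \<Rightarrow> real) set \<Rightarrow> (('N \<times> 'n multiset \<Rightarrow> real) \<Rightarrow> real) \<Rightarrow> bool" where
  "jet_order_le k s U g \<longleftrightarrow> (\<forall>a\<in>velocity_index s. k < size (snd a) \<longrightarrow> (\<forall>u\<in>U. pd a g u = 0))"

lemma total_derivs_simps [simp]: "total_derivs s [] g = g" "total_derivs s (i # J) g = total_deriv s i (total_derivs s J g)"
  by (simp_all add: total_derivs_def)

lemma finite_lower_index: "finite {a :: 'N::finite \<times> 'n::finite multiset. size (snd a) < s}"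
  by (rule finite_subset[OF _ finite_velocity_index[of s]]) auto

lemma curve_jet_extensional: "curve_jet s y t \<in> extensional (velocity_index s)"
  by (simp add: curve_jet_def)

lemma curve_jet_mset:
  fixes y :: "'N \<Rightarrow> ('n::finite \<Rightarrow> real) \<Rightarrow> real"
  assumes "openin (powertop_real UNIV) W" "\<And>A. smooth_on UNIV W (y A)" "t \<in> W" "length J \<le> s"
  shows "curve_jet s y t (A, mset J) = pds J (y A) t"
  using pds_mset_cong[OF finite assms(1,2,3), of J "list_of_mset (mset J)"] assms(4)
  by (simp add: curve_jet_def)

lemma smooth_on_curve_jet:
  assumes "\<And>A. smooth_on UNIV W (y A)" "a \<in> velocity_index s"
  shows "smooth_on UNIV W (\<lambda>t. curve_jet s y t a)"
  using smooth_on_pds[OF assms(1), of "list_of_mset (snd a)"] assms(2) by (simp add: curve_jet_def)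

lemma pd_curve_jet:
  fixes y :: "'N \<Rightarrow> ('n::finite \<Rightarrow> real) \<Rightarrow> real"
  assumes "openin (powertop_real UNIV) W" "\<And>A. smooth_on UNIV W (y A)" "t \<in> W" "size (snd a) < s"
  shows "pd i (\<lambda>t. curve_jet s y t a) t = curve_jet s y t (fst a, add_mset i (snd a))"
  using curve_jet_mset[where y = y and J = "i # list_of_mset (snd a)" and s = s and A = "fst a", OF assms(1-3)] assms(4)
  by (simp add: curve_jet_def)

lemma total_deriv_cong:
  fixes g :: "('N::finite \<times> 'n::finite multiset \<Rightarrow> real) \<Rightarrow> real"
  assumes "openin (powertop_real (velocity_index s)) U" "\<And>u. u \<in> U \<Longrightarrow> g u = h u" "u \<in> U"
  shows "total_deriv s i g u = total_deriv s i h u"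
  unfolding total_deriv_def
  using pd_cong[OF finite_velocity_index assms(1,2,3)] by (intro sum.cong) auto

lemma total_derivs_cong:
  fixes g :: "('N::finite \<times> 'n::finite multiset \<Rightarrow> real) \<Rightarrow> real"
  assumes "openin (powertop_real (velocity_index s)) U" "\<And>u. u \<in> U \<Longrightarrow> g u = h u" "u \<in> U"
  shows "total_derivs s J g u = total_derivs s J h u"
  using assms(3)
proof (induction J arbitrary: u)
  case (Cons i J)
  then show ?case using total_deriv_cong[OF assms(1), of "total_derivs s J g" "total_derivs s J h"] by simp
qed (simp add: assms(2))

text \<open>Chain rule, with \<open>pd_curve_jet\<close> shifting each index by \<open>i\<close>.
  The top-order coordinates, absent from \<open>total_deriv\<close>, would contribute derivatives of
  \<open>g\<close> that vanish because \<open>k < s\<close>.\<close>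

lemma pd_along_curve:
  fixes y :: "'N::finite \<Rightarrow> ('n::finite \<Rightarrow> real) \<Rightarrow> real"
  assumes W: "openin (powertop_real UNIV) W" and y: "\<And>A. smooth_on UNIV W (y A)"
    and U: "openin (powertop_real (velocity_index s)) U" and yU: "\<And>t. t \<in> W \<Longrightarrow> curve_jet s y t \<in> U"
    and g: "smooth_on (velocity_index s) U g" and ord: "jet_order_le k s U g" "k < s"
    and t: "t \<in> W"
  shows "pd i (\<lambda>t. g (curve_jet s y t)) t = total_deriv s i g (curve_jet s y t)"
proof -
  have eta: "(\<lambda>a\<in>velocity_index s. curve_jet s y t a) = curve_jet s y t" for t
    using extensional_restrict[OF curve_jet_extensional[of s y t]] by simp
  have "pd i (\<lambda>t. g (\<lambda>a\<in>velocity_index s. curve_jet s y t a)) t =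
    (\<Sum>a\<in>velocity_index s. pd a g (\<lambda>a\<in>velocity_index s. curve_jet s y t a) * pd i (\<lambda>t. curve_jet s y t a) t)"
  proof (rule chain_rule(2)[OF finite W finite_velocity_index U])
    show "ck (Suc 0) (velocity_index s) U g" using g by (simp only: smooth_on_iff_ck)
    show "pdifferentiable i (\<lambda>t. curve_jet s y t a) t" if "a \<in> velocity_index s" for a
      by (rule smooth_on_pdifferentiable[OF smooth_on_curve_jet[where y = y, OF y that] UNIV_I t])
    show "(\<lambda>a\<in>velocity_index s. curve_jet s y t a) \<in> U" unfolding eta by (rule yU[OF t])
  qed
  then have "pd i (\<lambda>t. g (curve_jet s y t)) t =
    (\<Sum>a\<in>velocity_index s. pd a g (curve_jet s y t) * pd i (\<lambda>t. curve_jet s y t a) t)"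
    unfolding eta .
  also have "\<dots> = (\<Sum>a\<in>{a. size (snd a) < s}. pd a g (curve_jet s y t) * pd i (\<lambda>t. curve_jet s y t a) t)"
  proof (rule sum.mono_neutral_right)
    show "\<forall>a\<in>velocity_index s - {a. size (snd a) < s}. pd a g (curve_jet s y t) * pd i (\<lambda>t. curve_jet s y t a) t = 0"
      using ord yU[OF t] unfolding jet_order_le_def by fastforce
  qed auto
  also have "\<dots> = total_deriv s i g (curve_jet s y t)"
    unfolding total_deriv_def by (rule sum.cong) (simp_all add: pd_curve_jet[OF W y t] mult.commute)
  finally show ?thesis .
qed

lemma smooth_on_total_deriv:
  fixes g :: "('N::finite \<times> 'n::finite multiset \<Rightarrow> real) \<Rightarrow> real"
  assumes U: "openin (powertop_real (velocity_index s)) U" and g: "smooth_on (velocity_index s) U g"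
  shows "smooth_on (velocity_index s) U (total_deriv s i g)"
proof -
  have "smooth_on (velocity_index s) U
     (\<lambda>u. \<Sum>a\<in>{a. size (snd a) < s}. u (fst a, add_mset i (snd a)) * pd a g u)"
    by (intro smooth_on_sum smooth_on_mult U finite_velocity_index smooth_on_coord smooth_on_pd[OF g]) auto
  then show ?thesis by (simp add: total_deriv_def[abs_def])
qed

lemma smooth_on_total_derivs:
  fixes g :: "('N::finite \<times> 'n::finite multiset \<Rightarrow> real) \<Rightarrow> real"
  assumes "openin (powertop_real (velocity_index s)) U" "smooth_on (velocity_index s) U g"
  shows "smooth_on (velocity_index s) U (total_derivs s J g)"
  by (induction J) (auto intro: smooth_on_total_deriv assms)

text \<open>The commutator of a coordinate derivative with d_i. The explicit factor of d_i
  differentiates to 1 at the single index obtained by removing \<open>i\<close> from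
  \<open>a\<close>; the rest commutes by symmetry of second derivatives. Removing \<open>i\<close>
  lowers the size below \<open>s\<close>, so truncation does not disturb the formula.\<close>

lemma pd_total_deriv:
  fixes g :: "('N::finite \<times> 'n::finite multiset \<Rightarrow> real) \<Rightarrow> real"
  assumes U: "openin (powertop_real (velocity_index s)) U" and g: "smooth_on (velocity_index s) U g"
    and u: "u \<in> U" and a: "a \<in> velocity_index s"
  shows "pd a (total_deriv s i g) u =
    (if i \<in># snd a then pd (fst a, snd a - {#i#}) g u else 0) + total_deriv s i (pd a g) u"
proof -
  let ?L = "{b. size (snd b) < s} :: ('N \<times> 'n multiset) set"
  let ?sh = "\<lambda>b. (fst b, add_mset i (snd b))"
  have pg: "pdifferentiable a (pd b g) u" if "b \<in> ?L" for b
    using smooth_on_pdifferentiable[OF smooth_on_pd[OF g, of b] a u] that by simp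
  have "pd a (total_deriv s i g) u = pd a (\<lambda>u. \<Sum>b\<in>?L. u (?sh b) * pd b g u) u"
    by (simp add: total_deriv_def[abs_def])
  also have "\<dots> = (\<Sum>b\<in>?L. pd a (\<lambda>u. u (?sh b) * pd b g u) u)"
    by (intro pd_sum pdifferentiable_mult pdifferentiable_coord pg)
  also have "\<dots> = (\<Sum>b\<in>?L. (if a = ?sh b then pd b g u else 0) + u (?sh b) * pd b (pd a g) u)"
  proof (rule sum.cong)
    fix b assume b: "b \<in> ?L"
    have "pd a (pd b g) u = pd b (pd a g) u"
      by (rule smooth_on_pd_commute[OF finite_velocity_index U g u a]) (use b in simp)
    then show "pd a (\<lambda>u. u (?sh b) * pd b g u) u
       = (if a = ?sh b then pd b g u else 0) + u (?sh b) * pd b (pd a g) u"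
      using pd_mult[of a "\<lambda>u. u (?sh b)" u "pd b g"] pg[OF b] pdifferentiable_coord[of a "?sh b" u]
      by (simp add: pd_coord)
  qed simp
  also have "\<dots> = (\<Sum>b\<in>?L. if a = ?sh b then pd b g u else 0) + total_deriv s i (pd a g) u"
    by (simp add: sum.distrib total_deriv_def)
  also have "(\<Sum>b\<in>?L. if a = ?sh b then pd b g u else 0) =
    (if i \<in># snd a then pd (fst a, snd a - {#i#}) g u else 0)"
  proof (cases "i \<in># snd a")
    case True
    then obtain M where M: "snd a = add_mset i M" by (meson mset_add)
    then have "a = ?sh b \<longleftrightarrow> b = (fst a, M)" for b
      by (cases a, cases b) auto
    moreover have "(fst a, M) \<in> ?L" using a M by simp
    moreover have "finite ?L" by (rule finite_lower_index)
    ultimately show ?thesis using M by simp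
  next
    case False
    then have "a \<noteq> ?sh b" for b by (metis snd_conv union_single_eq_member)
    then show ?thesis using False by simp
  qed
  finally show ?thesis .
qed

text \<open>Both terms of the commutator vanish: the index with \<open>i\<close> removed still has
  order above \<open>k\<close>.\<close>

lemma jet_order_le_total_deriv:
  fixes g :: "('N::finite \<times> 'n::finite multiset \<Rightarrow> real) \<Rightarrow> real"
  assumes U: "openin (powertop_real (velocity_index s)) U" and g: "smooth_on (velocity_index s) U g"
    and ord: "jet_order_le k s U g"
  shows "jet_order_le (Suc k) s U (total_deriv s i g)"
  unfolding jet_order_le_def
proof (intro ballI impI)
  fix a :: "'N \<times> 'n multiset" and u assume a: "a \<in> velocity_index s" "Suc k < size (snd a)" and u: "u \<in> U"
  have "total_deriv s i (pd a g) u = total_deriv s i (\<lambda>_. 0) u"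
    by (rule total_deriv_cong[OF U _ u]) (use ord a in \<open>auto simp: jet_order_le_def\<close>)
  moreover have "pd (fst a, snd a - {#i#}) g u = 0" if "i \<in># snd a"
    using ord a u that by (auto simp: jet_order_le_def size_Diff_singleton)
  ultimately show "pd a (total_deriv s i g) u = 0"
    unfolding pd_total_deriv[OF U g u a(1)] by (simp add: total_deriv_def pd_const)
qed

lemma jet_order_le_total_derivs:
  fixes g :: "('N::finite \<times> 'n::finite multiset \<Rightarrow> real) \<Rightarrow> real"
  assumes "openin (powertop_real (velocity_index s)) U" "smooth_on (velocity_index s) U g"
    "jet_order_le k s U g"
  shows "jet_order_le (k + length J) s U (total_derivs s J g)"
  by (induction J) (use assms in \<open>auto intro: jet_order_le_total_deriv smooth_on_total_derivs\<close>)

text \<open>The derivatives already applied raise the order one by one, so the outermost one acts on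
  a function of order at most \<open>k + length J - 1\<close>, which is still below
  \<open>s\<close>.\<close>

lemma pds_along_curve:
  fixes y :: "'N::finite \<Rightarrow> ('n::finite \<Rightarrow> real) \<Rightarrow> real"
  assumes W: "openin (powertop_real UNIV) W" and y: "\<And>A. smooth_on UNIV W (y A)"
    and U: "openin (powertop_real (velocity_index s)) U" and yU: "\<And>t. t \<in> W \<Longrightarrow> curve_jet s y t \<in> U"
    and g: "smooth_on (velocity_index s) U g" and ord: "jet_order_le k s U g"
    and t: "t \<in> W" and J: "k + length J \<le> s"
  shows "pds J (\<lambda>t. g (curve_jet s y t)) t = total_derivs s J g (curve_jet s y t)"
  using t J
proof (induction J arbitrary: t)
  case (Cons i J)
  have "pd i (pds J (\<lambda>t. g (curve_jet s y t))) t = pd i (\<lambda>t. total_derivs s J g (curve_jet s y t)) t"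
    by (rule pd_cong[OF finite W _ Cons.prems(1)]) (use Cons in auto)
  also have "\<dots> = total_deriv s i (total_derivs s J g) (curve_jet s y t)"
    using pd_along_curve[OF W y U yU smooth_on_total_derivs[OF U g] jet_order_le_total_derivs[OF U g ord] _ Cons.prems(1)]
      Cons.prems(2) by simp
  finally show ?case by simp
qed simp

section \<open>Functions on the base and derivatives of their total derivatives\<close>

definition lift0 :: "(('N \<Rightarrow> real) \<Rightarrow> real) \<Rightarrow> ('N \<times> 'n multiset \<Rightarrow> real) \<Rightarrow> real" where
  "lift0 f u = f (\<lambda>A. u (A, {#}))"

lemma openin_lift0:
  assumes "openin (powertop_real (UNIV :: 'N::finite set)) X"
  shows "openin (powertop_real (velocity_index s :: ('N \<times> 'n::finite multiset) set))
    {u \<in> extensional (velocity_index s). (\<lambda>A. u (A, {#})) \<in> X}"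
proof -
  let ?E = "extensional (velocity_index s) :: ('N \<times> 'n multiset \<Rightarrow> real) set"
  have "openin (powertop_real (velocity_index s)) ?E"
    using openin_topspace[of "powertop_real (velocity_index s :: ('N \<times> 'n multiset) set)"]
    by (simp add: PiE_UNIV_domain PiE_def)
  from openin_preimage[OF this _ assms, of "\<lambda>A u. u (A, {#})"]
  show ?thesis by (simp add: cont_on_coord restrict_UNIV)
qed

lemma smooth_on_lift0:
  assumes X: "openin (powertop_real (UNIV :: 'N::finite set)) X" and f: "smooth_on UNIV X f"
  shows "smooth_on (velocity_index s :: ('N \<times> 'n::finite multiset) set)
    {u \<in> extensional (velocity_index s). (\<lambda>A. u (A, {#})) \<in> X} (lift0 f)"
proof -
  have "smooth_on (velocity_index s :: ('N \<times> 'n multiset) set)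
    {u \<in> extensional (velocity_index s). (\<lambda>A. u (A, {#})) \<in> X} (\<lambda>u. f (\<lambda>A\<in>UNIV. u (A, {#})))"
    by (rule smooth_on_compose[OF finite_velocity_index openin_lift0[OF X] finite X f,
        where g = "\<lambda>A u. u (A, {#})"]) (auto intro: smooth_on_coord simp: restrict_UNIV)
  then show ?thesis by (simp add: restrict_UNIV lift0_def[abs_def])
qed

lemma pd_lift0:
  "pd a (lift0 f) u = (if snd a = {#} then lift0 (pd (fst a) f) u else 0)"
proof (cases a)
  case (Pair B M)
  have "(\<lambda>A. (u((B, {#}) := h)) (A, {#})) = (\<lambda>A. u (A, {#}))(B := h)" for h
    by auto
  then show ?thesis
    by (simp add: Pair lift0_def pd_def)
qed

lemma jet_order_le_lift0: "jet_order_le 0 s U (lift0 f)"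
  by (auto simp: jet_order_le_def pd_lift0)

text \<open>Every entry goes to one of two subsequences. The result is a list, not a set, because
  equal pairs arising from different positions must be counted separately, as in the Leibniz
  rule.\<close>

fun splits :: "'a list \<Rightarrow> ('a list \<times> 'a list) list" where
  "splits [] = [([], [])]"
| "splits (i # K) = map (\<lambda>p. (i # fst p, snd p)) (splits K) @ map (\<lambda>p. (fst p, i # snd p)) (splits K)"

lemma length_splits: "p \<in> set (splits K) \<Longrightarrow> length (fst p) + length (snd p) = length K"
  by (induction K arbitrary: p) auto

lemma total_deriv_sum_list:
  fixes F :: "'a \<Rightarrow> ('N::finite \<times> 'n::finite multiset \<Rightarrow> real) \<Rightarrow> real"
  assumes "\<And>x. x \<in> set xs \<Longrightarrow> smooth_on (velocity_index s) U (F x)" "u \<in> U"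
    "openin (powertop_real (velocity_index s)) U"
  shows "total_deriv s i (\<lambda>u. \<Sum>x\<leftarrow>xs. F x u) u = (\<Sum>x\<leftarrow>xs. total_deriv s i (F x) u)"
    and "smooth_on (velocity_index s) U (\<lambda>u. \<Sum>x\<leftarrow>xs. F x u)"
proof -
  have "total_deriv s i (\<lambda>u. \<Sum>x\<leftarrow>xs. F x u) u = (\<Sum>x\<leftarrow>xs. total_deriv s i (F x) u) \<and>
    smooth_on (velocity_index s) U (\<lambda>u. \<Sum>x\<leftarrow>xs. F x u)"
    using assms(1)
  proof (induction xs)
    case Nil
    then show ?case by (simp add: total_deriv_def pd_const smooth_on_const)
  next
    case (Cons x xs)
    let ?G = "\<lambda>u. \<Sum>x\<leftarrow>xs. F x u"
    have x: "smooth_on (velocity_index s) U (F x)" and G: "smooth_on (velocity_index s) U ?G"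
      using Cons by auto
    have "total_deriv s i (\<lambda>u. F x u + ?G u) u = total_deriv s i (F x) u + total_deriv s i ?G u"
      unfolding total_deriv_def sum.distrib[symmetric]
    proof (rule sum.cong)
      fix a :: "'N \<times> 'n multiset" assume "a \<in> {a. size (snd a) < s}"
      then have a: "a \<in> velocity_index s" by simp
      have "pd a (\<lambda>u. F x u + ?G u) u = pd a (F x) u + pd a ?G u"
        by (rule pd_add[OF smooth_on_pdifferentiable[OF x a assms(2)] smooth_on_pdifferentiable[OF G a assms(2)]])
      then show "u (fst a, add_mset i (snd a)) * pd a (\<lambda>u. F x u + ?G u) u =
        u (fst a, add_mset i (snd a)) * pd a (F x) u + u (fst a, add_mset i (snd a)) * pd a ?G u"
        by (simp add: distrib_left)
    qed simp
    moreover have "smooth_on (velocity_index s) U (\<lambda>u. F x u + ?G u)"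
      using ck_add[OF finite_velocity_index assms(3)] x G by (simp add: smooth_on_iff_ck)
    ultimately show ?case using Cons by simp
  qed
  then show "total_deriv s i (\<lambda>u. \<Sum>x\<leftarrow>xs. F x u) u = (\<Sum>x\<leftarrow>xs. total_deriv s i (F x) u)"
    and "smooth_on (velocity_index s) U (\<lambda>u. \<Sum>x\<leftarrow>xs. F x u)" by auto
qed

text \<open>Moving the coordinate derivative inwards past d_i either consumes an \<open>i\<close> of
  its index, by the commutator, or leaves d_i in place. At the end the base function reacts only if
  the whole index has been consumed, so the consumed entries form \<open>snd a\<close> and the
  surviving ones are applied to the derivative of \<open>f\<close>.\<close>

lemma pd_total_derivs_lift0:
  fixes f :: "('N::finite \<Rightarrow> real) \<Rightarrow> real" and K :: "'n::finite list"
  assumes X: "openin (powertop_real UNIV) X" and f: "smooth_on UNIV X f"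
    and a: "a \<in> velocity_index s"
    and u: "u \<in> {u \<in> extensional (velocity_index s). (\<lambda>A. u (A, {#})) \<in> X}" (is "_ \<in> ?U")
  shows "pd a (total_derivs s K (lift0 f)) u =
    (\<Sum>p\<leftarrow>splits K. if mset (fst p) = snd a then total_derivs s (snd p) (lift0 (pd (fst a) f)) u else 0)"
  using a u
proof (induction K arbitrary: a u)
  case Nil
  then show ?case by (auto simp: pd_lift0)
next
  case (Cons i K)
  note U = openin_lift0[OF X, where s = s and 'n = 'n]
  have L: "smooth_on (velocity_index s) ?U (total_derivs s T (lift0 h))" if "smooth_on UNIV X h" for h and T :: "'n list"
    by (rule smooth_on_total_derivs[OF U smooth_on_lift0[OF X that]])
  let ?F = "\<lambda>p u. if mset (fst p) = snd a then total_derivs s (snd p) (lift0 (pd (fst a) f)) u else 0"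
  have F: "smooth_on (velocity_index s) ?U (?F p)" for p
    using L[OF smooth_on_pd[OF f UNIV_I], of "snd p" "fst a"]
    by (cases "mset (fst p) = snd a") (simp_all add: smooth_on_const)
  have "total_deriv s i (pd a (total_derivs s K (lift0 f))) u = total_deriv s i (\<lambda>u. \<Sum>p\<leftarrow>splits K. ?F p u) u"
    by (rule total_deriv_cong[OF U Cons.IH Cons.prems(2)]) (rule Cons.prems(1))
  also have "\<dots> = (\<Sum>p\<leftarrow>splits K. total_deriv s i (?F p) u)"
    by (rule total_deriv_sum_list(1)[OF F Cons.prems(2) U])
  also have "\<dots> = (\<Sum>p\<leftarrow>splits K. if mset (fst p) = snd a then total_derivs s (i # snd p) (lift0 (pd (fst a) f)) u else 0)"
    by (intro arg_cong[of _ _ sum_list] map_cong) (auto simp: total_deriv_def pd_const)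
  finally have 1: "total_deriv s i (pd a (total_derivs s K (lift0 f))) u =
    (\<Sum>p\<leftarrow>splits K. if mset (fst p) = snd a then total_derivs s (i # snd p) (lift0 (pd (fst a) f)) u else 0)" .
  \<comment> \<open>The commutator term: the splittings that put \<open>i\<close> into the first
    part, by the induction hypothesis at the index without \<open>i\<close>.\<close>
  have 2: "(if i \<in># snd a then pd (fst a, snd a - {#i#}) (total_derivs s K (lift0 f)) u else 0) =
    (\<Sum>p\<leftarrow>splits K. if mset (i # fst p) = snd a then total_derivs s (snd p) (lift0 (pd (fst a) f)) u else 0)"
  proof (cases "i \<in># snd a")
    case True
    then obtain M where M: "snd a = add_mset i M" by (meson mset_add)
    then show ?thesis
      using Cons.IH[of "(fst a, M)" u, unfolded fst_conv snd_conv] Cons.prems by simp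
  next
    case False
    then have "mset (i # S) \<noteq> snd a" for S by (metis mset.simps(2) union_single_eq_member)
    then show ?thesis by (simp add: False del: mset.simps)
  qed
  show ?case
    using pd_total_deriv[OF U L[OF f] Cons.prems(2,1), of i K] 1 2 by (simp add: comp_def cong: if_cong)
qed

section \<open>Linearity of iterated derivatives and the alternating Leibniz identity\<close>

lemma pds_zero: "pds J (\<lambda>_. 0) = (\<lambda>_. 0)"
  by (induction J) (simp_all add: pd_const)

lemma pds_add:
  assumes "finite I" "openin (powertop_real I) U" "smooth_on I U f" "smooth_on I U g" "x \<in> U" "J \<in> lists I"
  shows "pds J (\<lambda>x. f x + g x) x = pds J f x + pds J g x"
  using assms(6,5)
proof (induction J arbitrary: x)
  case (Cons i J)
  have "pd i (pds J (\<lambda>x. f x + g x)) x = pd i (\<lambda>x. pds J f x + pds J g x) x"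
    by (rule pd_cong[OF assms(1,2) Cons.IH Cons.prems(1) Cons.hyps(1)])
  also have "\<dots> = pd i (pds J f) x + pd i (pds J g) x"
    by (intro pd_add
        smooth_on_pdifferentiable[OF smooth_on_pds[OF assms(3) Cons.hyps(2)] Cons.hyps(1) Cons.prems(1)]
        smooth_on_pdifferentiable[OF smooth_on_pds[OF assms(4) Cons.hyps(2)] Cons.hyps(1) Cons.prems(1)])
  finally show ?case by simp
qed simp

lemma smooth_on_add:
  assumes "finite I" "openin (powertop_real I) U" "smooth_on I U f" "smooth_on I U g"
  shows "smooth_on I U (\<lambda>x. f x + g x)"
  using ck_add[OF assms(1,2)] assms(3,4) by (simp add: smooth_on_iff_ck)

lemma pds_sum:
  assumes "finite I" "openin (powertop_real I) U" "\<And>a. a \<in> S \<Longrightarrow> smooth_on I U (f a)"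
    "x \<in> U" "J \<in> lists I"
  shows "pds J (\<lambda>x. \<Sum>a\<in>S. f a x) x = (\<Sum>a\<in>S. pds J (f a) x)"
  using assms(3)
proof (induction S rule: infinite_finite_induct)
  case (insert a S)
  have "pds J (\<lambda>x. f a x + (\<Sum>a\<in>S. f a x)) x = pds J (f a) x + pds J (\<lambda>x. \<Sum>a\<in>S. f a x) x"
    by (rule pds_add[OF assms(1,2) _ _ assms(4,5)])
      (use smooth_on_sum[OF assms(1,2), of S f] insert.prems in auto)
  then show ?case using insert by simp
qed (simp_all add: pds_zero)

lemma pds_sum_list:
  assumes "finite I" "openin (powertop_real I) U" "\<And>a. a \<in> set xs \<Longrightarrow> smooth_on I U (f a)"
    "x \<in> U" "J \<in> lists I"
  shows "pds J (\<lambda>x. \<Sum>a\<leftarrow>xs. f a x) x = (\<Sum>a\<leftarrow>xs. pds J (f a) x)"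
    and "smooth_on I U (\<lambda>x. \<Sum>a\<leftarrow>xs. f a x)"
proof -
  have "pds J (\<lambda>x. \<Sum>a\<leftarrow>xs. f a x) x = (\<Sum>a\<leftarrow>xs. pds J (f a) x) \<and> smooth_on I U (\<lambda>x. \<Sum>a\<leftarrow>xs. f a x)"
    using assms(3)
  proof (induction xs)
    case (Cons a xs)
    then have "smooth_on I U (f a)" "smooth_on I U (\<lambda>x. \<Sum>a\<leftarrow>xs. f a x)" by auto
    from pds_add[OF assms(1,2) this assms(4,5)] smooth_on_add[OF assms(1,2) this]
    show ?case using Cons by simp
  qed (simp add: pds_zero smooth_on_const)
  then show "pds J (\<lambda>x. \<Sum>a\<leftarrow>xs. f a x) x = (\<Sum>a\<leftarrow>xs. pds J (f a) x)"
    and "smooth_on I U (\<lambda>x. \<Sum>a\<leftarrow>xs. f a x)" by auto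
qed

text \<open>For one entry \<open>i\<close> this says that minus the derivative of a product plus the
  part falling on \<open>Q\<close> leaves minus the part falling on \<open>P\<close>. The identity
  composes this over all entries of \<open>K\<close>: putting \<open>i\<close> into the first part
  differentiates the whole sum for the remaining list, putting it into the second replaces
  \<open>Q\<close> by its derivative, so the induction must vary \<open>Q\<close>.\<close>

lemma sum_list_eq_pds_splits:
  fixes P Q :: "('n::finite \<Rightarrow> real) \<Rightarrow> real"
  assumes W: "openin (powertop_real UNIV) W" and P: "smooth_on UNIV W P" and Q: "smooth_on UNIV W Q"
    and t: "t \<in> W"
  shows "(\<Sum>p\<leftarrow>splits K. (-1) ^ length (fst p) * pds (fst p) (\<lambda>t. P t * pds (snd p) Q t) t) =
    (-1) ^ length K * (pds K P t * Q t)"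
  using Q t
proof (induction K arbitrary: Q t)
  case (Cons i K)
  let ?f = "\<lambda>p t. (-1) ^ length (fst p) * pds (fst p) (\<lambda>t. P t * pds (snd p) Q t) t"
  have f: "smooth_on UNIV W (?f p)" for p
    by (intro smooth_on_mult smooth_on_pds smooth_on_const W P Cons.prems(1)) simp_all
  have pK: "smooth_on UNIV W (pds K P)" by (intro smooth_on_pds P) simp
  have "(\<Sum>p\<leftarrow>splits K. pd i (?f p) t) = pd i (\<lambda>t. \<Sum>p\<leftarrow>splits K. ?f p t) t"
    using pds_sum_list(1)[of UNIV W "splits K" ?f t "[i]", OF finite W f Cons.prems(2)] by simp
  also have "\<dots> = pd i (\<lambda>t. (-1) ^ length K * (pds K P t * Q t)) t"
    by (rule pd_cong[OF finite W Cons.IH[OF Cons.prems(1)] Cons.prems(2) UNIV_I])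
  also have "\<dots> = (-1) ^ length K * (pd i (pds K P) t * Q t + pds K P t * pd i Q t)"
    using pd_mult[of i "\<lambda>_. (-1) ^ length K" t "\<lambda>t. pds K P t * Q t"] pd_mult[of i "pds K P" t Q]
      pdifferentiable_const[of i _ t] smooth_on_pdifferentiable[OF pK UNIV_I Cons.prems(2), of i]
      smooth_on_pdifferentiable[OF Cons.prems(1) UNIV_I Cons.prems(2), of i]
      pdifferentiable_mult[of i "pds K P" t Q]
    by (simp add: pd_const)
  finally have 1: "(\<Sum>p\<leftarrow>splits K. pd i (?f p) t) =
    (-1) ^ length K * (pd i (pds K P) t * Q t + pds K P t * pd i Q t)" .
  have pdf: "pd i (?f p) t = (-1) ^ length (fst p) * pds (i # fst p) (\<lambda>t. P t * pds (snd p) Q t) t" for p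
    using pd_mult[of i "\<lambda>_. (-1) ^ length (fst p)" t "pds (fst p) (\<lambda>t. P t * pds (snd p) Q t)"]
      pdifferentiable_const[of i _ t] smooth_on_pdifferentiable[OF _ UNIV_I Cons.prems(2), of "pds (fst p) (\<lambda>t. P t * pds (snd p) Q t)" i]
      smooth_on_pds[OF smooth_on_mult[OF finite W P smooth_on_pds[OF Cons.prems(1)]], of "snd p" "fst p"]
    by (simp add: pd_const)
  \<comment> \<open>The derivative by \<open>i\<close> is moved to the innermost place, where it
    acts on \<open>Q\<close> itself and the induction hypothesis for \<open>pd i Q\<close>
    applies.\<close>
  have 2: "pds S (\<lambda>t. P t * pds (i # T) Q t) t = pds S (\<lambda>t. P t * pds T (pd i Q) t) t" for S T
  proof (rule pds_cong[OF finite W _ Cons.prems(2)])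
    fix t assume "t \<in> W"
    then have "pds (i # T) Q t = pds (T @ [i]) Q t"
      by (intro pds_mset_cong[OF finite W Cons.prems(1)]) auto
    then show "P t * pds (i # T) Q t = P t * pds T (pd i Q) t" by (simp add: pds_append)
  qed simp
  have 3: "(\<Sum>p\<leftarrow>splits K. (-1) ^ length (fst p) * pds (fst p) (\<lambda>t. P t * pds (i # snd p) Q t) t) =
    (-1) ^ length K * (pds K P t * pd i Q t)"
    unfolding 2 by (rule Cons.IH[OF smooth_on_pd[OF Cons.prems(1) UNIV_I] Cons.prems(2)])
  have 4: "(\<Sum>p\<leftarrow>splits K. (-1) ^ length (i # fst p) * pds (i # fst p) (\<lambda>t. P t * pds (snd p) Q t) t) =
    - (\<Sum>p\<leftarrow>splits K. pd i (?f p) t)"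
    unfolding pdf by (simp add: uminus_sum_list_map comp_def)
  have "(\<Sum>p\<leftarrow>splits (i # K). (-1) ^ length (fst p) * pds (fst p) (\<lambda>t. P t * pds (snd p) Q t) t) =
    (\<Sum>p\<leftarrow>splits K. (-1) ^ length (i # fst p) * pds (i # fst p) (\<lambda>t. P t * pds (snd p) Q t) t) +
    (\<Sum>p\<leftarrow>splits K. (-1) ^ length (fst p) * pds (fst p) (\<lambda>t. P t * pds (i # snd p) Q t) t)"
    by (simp only: splits.simps map_append sum_list_append map_map comp_def fst_conv snd_conv)
  also have "\<dots> = (-1) ^ length (i # K) * (pds (i # K) P t * Q t)"
    unfolding 3 4 1 by (simp add: algebra_simps)
  finally show ?case .
qed simp

section \<open>Prolonged coordinate changes and the Euler operator\<close>

lemma list_of_mset_empty [simp]: "list_of_mset {#} = []"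
  by (metis length_0_conv length_list_of_mset size_empty)

lemma lift0_curve_jet [simp]: "lift0 f (curve_jet s y t) = f (\<lambda>A. y A t)"
  by (simp add: lift0_def curve_jet_def)

lemma smooth_on_along_curve:
  fixes y :: "'N::finite \<Rightarrow> ('n::finite \<Rightarrow> real) \<Rightarrow> real"
  assumes W: "openin (powertop_real UNIV) W" and y: "\<And>A. smooth_on UNIV W (y A)"
    and U: "openin (powertop_real (velocity_index s)) U" and yU: "\<And>t. t \<in> W \<Longrightarrow> curve_jet s y t \<in> U"
    and g: "smooth_on (velocity_index s) U g"
  shows "smooth_on UNIV W (\<lambda>t. g (curve_jet s y t))"
proof -
  have eta: "(\<lambda>a\<in>velocity_index s. curve_jet s y t a) = curve_jet s y t" for t
    using extensional_restrict[OF curve_jet_extensional[of s y t]] by simp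
  have "smooth_on UNIV W (\<lambda>t. g (\<lambda>a\<in>velocity_index s. curve_jet s y t a))"
    by (rule smooth_on_compose[OF finite W finite_velocity_index U g, where g = "\<lambda>a t. curve_jet s y t a"])
      (use smooth_on_curve_jet[where y = y, OF y] yU in \<open>simp_all only: eta\<close>)
  then show ?thesis unfolding eta .
qed

lemma smooth_on_compose_UNIV:
  fixes y :: "'N::finite \<Rightarrow> ('n::finite \<Rightarrow> real) \<Rightarrow> real"
  assumes W: "openin (powertop_real UNIV) W" and y: "\<And>A. smooth_on UNIV W (y A)"
    and X: "openin (powertop_real UNIV) X" and yX: "\<And>t. t \<in> W \<Longrightarrow> (\<lambda>A. y A t) \<in> X"
    and f: "smooth_on UNIV X f"
  shows "smooth_on UNIV W (\<lambda>t. f (\<lambda>A. y A t))"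
  using smooth_on_compose[OF finite W finite X f, where g = y] y yX by (simp add: restrict_UNIV)

lemma curve_jet_in_lift0_domain:
  "(\<lambda>A. y A t) \<in> X \<Longrightarrow> curve_jet s y t \<in> {u \<in> extensional (velocity_index s). (\<lambda>A. u (A, {#})) \<in> X}"
  using curve_jet_extensional[of s y t] by (simp add: curve_jet_def)

text \<open>Replaces an explicit formula for higher derivatives of a composite. A lifted function
  has order 0, so all lengths up to \<open>s\<close> are available.\<close>

lemma pds_compose_eq_total_derivs:
  fixes y :: "'N::finite \<Rightarrow> ('n::finite \<Rightarrow> real) \<Rightarrow> real"
  assumes W: "openin (powertop_real UNIV) W" and y: "\<And>A. smooth_on UNIV W (y A)"
    and X: "openin (powertop_real UNIV) X" and yX: "\<And>t. t \<in> W \<Longrightarrow> (\<lambda>A. y A t) \<in> X"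
    and f: "smooth_on UNIV X f" and t: "t \<in> W" and J: "length J \<le> s"
  shows "pds J (\<lambda>t. f (\<lambda>A. y A t)) t = total_derivs s J (lift0 f) (curve_jet s y t)"
  using pds_along_curve[where y = y, OF W y openin_lift0[OF X] curve_jet_in_lift0_domain[where y = y, OF yX]
      smooth_on_lift0[OF X f] jet_order_le_lift0 t, of J] J
  by simp

text \<open>The prolongation of the coordinate change \<open>F\<close> to jets of order
  \<open>s\<close>.\<close>

definition jet_transition ::
  "nat \<Rightarrow> ('N \<Rightarrow> ('N \<Rightarrow> real) \<Rightarrow> real) \<Rightarrow> ('N \<times> 'n multiset \<Rightarrow> real) \<Rightarrow> 'N \<times> 'n multiset \<Rightarrow> real" where
  "jet_transition s F u = (\<lambda>a\<in>velocity_index s. total_derivs s (list_of_mset (snd a)) (lift0 (F (fst a))) u)"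

lemma curve_jet_compose:
  fixes y :: "'N::finite \<Rightarrow> ('n::finite \<Rightarrow> real) \<Rightarrow> real"
  assumes W: "openin (powertop_real UNIV) W" and y: "\<And>A. smooth_on UNIV W (y A)"
    and X: "openin (powertop_real UNIV) X" and yX: "\<And>t. t \<in> W \<Longrightarrow> (\<lambda>A. y A t) \<in> X"
    and F: "\<And>A. smooth_on UNIV X (F A)" and t: "t \<in> W"
  shows "curve_jet s (\<lambda>A t. F A (\<lambda>C. y C t)) t = jet_transition s F (curve_jet s y t)"
  unfolding jet_transition_def curve_jet_def[of s "\<lambda>A t. F A (\<lambda>C. y C t)"]
  by (intro restrict_ext pds_compose_eq_total_derivs[OF W y X yX F t]) simp_all

text \<open>The variational derivative along the curve \<open>y\<close>, with genuine derivatives in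
  \<open>t\<close> instead of truncated formal ones. The sum runs up to \<open>s\<close>; for a
  Lagrangian of order r the terms beyond r are zero.\<close>

definition euler_op ::
  "nat \<Rightarrow> ('N \<Rightarrow> ('n::finite \<Rightarrow> real) \<Rightarrow> real) \<Rightarrow> (('N \<times> 'n multiset \<Rightarrow> real) \<Rightarrow> real) \<Rightarrow> 'N \<Rightarrow> ('n \<Rightarrow> real) \<Rightarrow> real" where
  "euler_op s y L B t =
    (\<Sum>M | size M \<le> s. (-1) ^ size M * pds (list_of_mset M) (\<lambda>t. pd (B, M) L (curve_jet s y t)) t)"

lemma sum_sum_list_swap: "(\<Sum>x\<in>S. \<Sum>p\<leftarrow>xs. h x p) = (\<Sum>p\<leftarrow>xs. \<Sum>x\<in>S. h x p)"
  by (induction xs) (simp_all add: sum.distrib)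

text \<open>The chain rule turns the left side into a sum over target indices \<open>a\<close>,
  splittings of \<open>a\<close>, and multisets \<open>M\<close> that must match the first part.
  Summing over \<open>M\<close> first leaves, for each \<open>a\<close>, the alternating sum over
  splittings, which collapses to one derivative on the Lagrangian side times an underived Jacobian
  entry.\<close>

lemma euler_op_transform:
  fixes y :: "'N::finite \<Rightarrow> ('n::finite \<Rightarrow> real) \<Rightarrow> real"
  assumes W: "openin (powertop_real UNIV) W" and y: "\<And>A. smooth_on UNIV W (y A)"
    and X: "openin (powertop_real UNIV) X" and F: "\<And>A. smooth_on UNIV X (F A)"
    and U: "openin (powertop_real (velocity_index s)) U"
    and UX: "\<And>u. u \<in> U \<Longrightarrow> (\<lambda>A. u (A, {#})) \<in> X"
    and yU: "\<And>t. t \<in> W \<Longrightarrow> curve_jet s y t \<in> U"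
    and U': "openin (powertop_real (velocity_index s)) U'"
    and L': "smooth_on (velocity_index s) U' L'"
    and UU': "\<And>u. u \<in> U \<Longrightarrow> jet_transition s F u \<in> U'"
    and L: "\<And>u. u \<in> U \<Longrightarrow> L u = L' (jet_transition s F u)"
    and t: "t \<in> W"
  shows "euler_op s y L B t =
    (\<Sum>A\<in>UNIV. euler_op s (\<lambda>A t. F A (\<lambda>C. y C t)) L' A t * pd B (F A) (\<lambda>C. y C t))"
proof -
  let ?I = "velocity_index s :: ('N \<times> 'n multiset) set"
  let ?X = "{u \<in> extensional ?I. (\<lambda>A. u (A, {#})) \<in> X}"
  define y' where "y' A t = F A (\<lambda>C. y C t)" for A t
  define \<psi> where "\<psi> a = total_derivs s (list_of_mset (snd a)) (lift0 (F (fst a)))" for a :: "'N \<times> 'n multiset"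
  \<comment> \<open>The two factors of the Leibniz identity: \<open>P\<close> belongs to the
    transformed Lagrangian, \<open>Q\<close> is an entry of the Jacobian, both along the
    curve.\<close>
  define P where "P a t = pd a L' (curve_jet s y' t)" for a t
  define Q where "Q A t = pd B (F A) (\<lambda>C. y C t)" for A t
  have yX: "(\<lambda>A. y A t) \<in> X" if "t \<in> W" for t
    using UX[OF yU[OF that]] by (simp add: curve_jet_def)
  have UX': "U \<subseteq> ?X"
    using UX openin_powertop_real_extensional[OF U] by blast
  have y': "smooth_on UNIV W (y' A)" for A
    unfolding y'_def[abs_def] by (rule smooth_on_compose_UNIV[OF W y X yX F])
  have jy': "curve_jet s y' t = jet_transition s F (curve_jet s y t)" if "t \<in> W" for t
    using curve_jet_compose[OF W y X yX F that, of s] by (simp add: y'_def[abs_def])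
  have yU': "curve_jet s y' t \<in> U'" if "t \<in> W" for t
    using UU'[OF yU[OF that]] jy'[OF that] by simp
  have P: "smooth_on UNIV W (P a)" if "a \<in> ?I" for a
    unfolding P_def[abs_def] by (rule smooth_on_along_curve[OF W y' U' yU' smooth_on_pd[OF L' that]])
  have Q: "smooth_on UNIV W (Q A)" for A
    unfolding Q_def[abs_def] by (rule smooth_on_compose_UNIV[OF W y X yX smooth_on_pd[OF F UNIV_I]])
  have \<psi>: "smooth_on ?I U (\<psi> a)" for a
    unfolding \<psi>_def
    by (rule smooth_on_subset[OF smooth_on_total_derivs[OF openin_lift0[OF X] smooth_on_lift0[OF X F]] UX'])
  have trans: "jet_transition s F u = (\<lambda>a\<in>?I. \<psi> a u)" for u
    by (simp only: jet_transition_def \<psi>_def)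
  let ?G = "\<lambda>M a p t. if mset (fst p) = M then P a t * pds (snd p) (Q (fst a)) t else 0"
  \<comment> \<open>Total derivatives of the Jacobian entries, evaluated on the jet of the curve,
    become ordinary derivatives of \<open>Q\<close>.\<close>
  have R: "pd (B, M) L (curve_jet s y t) = (\<Sum>a\<in>?I. \<Sum>p\<leftarrow>splits (list_of_mset (snd a)). ?G M a p t)"
    if M: "size M \<le> s" and t: "t \<in> W" for M t
  proof -
    let ?u = "curve_jet s y t"
    note u = yU[OF t]
    have BM: "(B, M) \<in> ?I" using M by simp
    have "pd (B, M) L ?u = pd (B, M) (\<lambda>u. L' (\<lambda>a\<in>?I. \<psi> a u)) ?u"
      by (rule pd_cong[OF finite_velocity_index U _ u BM]) (simp only: L trans)
    also have "\<dots> = (\<Sum>a\<in>?I. pd a L' (\<lambda>a\<in>?I. \<psi> a ?u) * pd (B, M) (\<psi> a) ?u)"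
    proof (rule chain_rule(2)[OF finite_velocity_index U finite_velocity_index U'])
      show "ck (Suc 0) ?I U' L'" using L' by (simp only: smooth_on_iff_ck)
      show "pdifferentiable (B, M) (\<psi> a) ?u" if "a \<in> ?I" for a
        by (rule smooth_on_pdifferentiable[OF \<psi> BM u])
      show "(\<lambda>a\<in>?I. \<psi> a ?u) \<in> U'" using UU'[OF u] by (simp only: trans)
    qed
    also have "\<dots> = (\<Sum>a\<in>?I. P a t * pd (B, M) (\<psi> a) ?u)"
      by (simp only: P_def jy'[OF t] trans)
    also have "\<dots> = (\<Sum>a\<in>?I. \<Sum>p\<leftarrow>splits (list_of_mset (snd a)). ?G M a p t)"
    proof (rule sum.cong)
      fix a assume a: "a \<in> ?I"
      have "pd (B, M) (\<psi> a) ?u = (\<Sum>p\<leftarrow>splits (list_of_mset (snd a)).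
        if mset (fst p) = M then total_derivs s (snd p) (lift0 (pd B (F (fst a)))) ?u else 0)"
        unfolding \<psi>_def using pd_total_derivs_lift0[OF X F BM subsetD[OF UX' u], of "list_of_mset (snd a)" "fst a"]
        by (simp cong: if_cong)
      also have "\<dots> = (\<Sum>p\<leftarrow>splits (list_of_mset (snd a)).
        if mset (fst p) = M then pds (snd p) (Q (fst a)) t else 0)"
      proof (intro arg_cong[of _ _ sum_list] map_cong if_cong refl)
        fix p assume "p \<in> set (splits (list_of_mset (snd a)))"
        then have "length (snd p) \<le> s" using length_splits[of p] a by fastforce
        from pds_compose_eq_total_derivs[OF W y X yX smooth_on_pd[OF F UNIV_I] t this]
        show "total_derivs s (snd p) (lift0 (pd B (F (fst a)))) ?u = pds (snd p) (Q (fst a)) t"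
          by (simp add: Q_def[abs_def])
      qed
      finally show "P a t * pd (B, M) (\<psi> a) ?u = (\<Sum>p\<leftarrow>splits (list_of_mset (snd a)). ?G M a p t)"
        by (simp add: sum_list_const_mult[symmetric] if_distrib[of "\<lambda>x. P a t * x"] cong: if_cong)
    qed simp
    finally show ?thesis .
  qed
  have PQ: "smooth_on UNIV W (\<lambda>t. P a t * pds T (Q A) t)" if "a \<in> ?I" for a A T
    by (intro smooth_on_mult finite W P[OF that] smooth_on_pds Q) simp
  have G: "smooth_on UNIV W (?G M a p)" if "a \<in> ?I" for M a p
    using PQ[OF that] by (cases "mset (fst p) = M") (simp_all add: smooth_on_const)
  let ?H = "\<lambda>a p. pds (fst p) (\<lambda>t. P a t * pds (snd p) (Q (fst a)) t) t"
  \<comment> \<open>Only terms whose first part represents \<open>M\<close> survive, and for these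
    the derivative may be taken in the order of that first part.\<close>
  have dR: "pds (list_of_mset M) (\<lambda>t. pd (B, M) L (curve_jet s y t)) t =
    (\<Sum>a\<in>?I. \<Sum>p\<leftarrow>splits (list_of_mset (snd a)). if mset (fst p) = M then ?H a p else 0)"
    if M: "size M \<le> s" for M
  proof -
    let ?J = "list_of_mset M"
    have J: "?J \<in> lists UNIV" by simp
    have "pds ?J (\<lambda>t. pd (B, M) L (curve_jet s y t)) t =
      pds ?J (\<lambda>t. \<Sum>a\<in>?I. \<Sum>p\<leftarrow>splits (list_of_mset (snd a)). ?G M a p t) t"
      by (rule pds_cong[OF finite W R[OF M] t J])
    also have "\<dots> = (\<Sum>a\<in>?I. pds ?J (\<lambda>t. \<Sum>p\<leftarrow>splits (list_of_mset (snd a)). ?G M a p t) t)"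
      by (rule pds_sum[OF finite W pds_sum_list(2)[OF finite W G t J] t J])
    also have "\<dots> = (\<Sum>a\<in>?I. \<Sum>p\<leftarrow>splits (list_of_mset (snd a)). pds ?J (?G M a p) t)"
      by (rule sum.cong[OF refl pds_sum_list(1)[OF finite W G t J]])
    also have "\<dots> = (\<Sum>a\<in>?I. \<Sum>p\<leftarrow>splits (list_of_mset (snd a)). if mset (fst p) = M then ?H a p else 0)"
    proof (intro sum.cong refl arg_cong[of _ _ sum_list] map_cong)
      fix a p assume a: "a \<in> ?I"
      show "pds ?J (?G M a p) t = (if mset (fst p) = M then ?H a p else 0)"
        using pds_mset_cong[OF finite W PQ[OF a] t, of ?J "fst p" "snd p" "fst a"]
        by (cases "mset (fst p) = M") (simp_all add: pds_zero)
    qed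
    finally show ?thesis .
  qed
  have "euler_op s y L B t = (\<Sum>M | size M \<le> s. \<Sum>a\<in>?I. \<Sum>p\<leftarrow>splits (list_of_mset (snd a)).
    if mset (fst p) = M then (-1) ^ size M * ?H a p else 0)"
    unfolding euler_op_def
    by (intro sum.cong refl)
      (simp add: dR sum_distrib_left sum_list_const_mult[symmetric] if_distrib[of "\<lambda>x. _ * x"] cong: if_cong)
  also have "\<dots> = (\<Sum>a\<in>?I. \<Sum>M | size M \<le> s. \<Sum>p\<leftarrow>splits (list_of_mset (snd a)).
    if mset (fst p) = M then (-1) ^ size M * ?H a p else 0)"
    by (rule sum.swap)
  \<comment> \<open>Each splitting meets exactly one \<open>M\<close>; its size is at most
    \<open>s\<close> because the first part is a subsequence.\<close>
  also have "\<dots> = (\<Sum>a\<in>?I. \<Sum>p\<leftarrow>splits (list_of_mset (snd a)). (-1) ^ length (fst p) * ?H a p)"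
  proof (intro sum.cong refl, unfold sum_sum_list_swap, intro arg_cong[of _ _ sum_list] map_cong refl)
    fix a p assume a: "a \<in> ?I" "p \<in> set (splits (list_of_mset (snd a)))"
    then have "size (mset (fst p)) \<le> s" using length_splits[of p] by fastforce
    then show "(\<Sum>M | size M \<le> s. if mset (fst p) = M then (-1) ^ size M * ?H a p else 0) =
      (-1) ^ length (fst p) * ?H a p"
      by (simp add: finite_multisets_size_le)
  qed
  also have "\<dots> = (\<Sum>a\<in>?I. (-1) ^ size (snd a) * (pds (list_of_mset (snd a)) (P a) t * Q (fst a) t))"
    by (intro sum.cong refl) (simp only: sum_list_eq_pds_splits[OF W P Q t] length_list_of_mset)
  also have "\<dots> = (\<Sum>A\<in>UNIV. \<Sum>M | size M \<le> s. (-1) ^ size M * (pds (list_of_mset M) (P (A, M)) t * Q A t))"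
    unfolding velocity_index_eq by (subst sum.cartesian_product) (simp add: case_prod_beta)
  also have "\<dots> = (\<Sum>A\<in>UNIV. euler_op s y' L' A t * Q A t)"
    by (simp add: euler_op_def P_def[abs_def] sum_distrib_right mult.assoc)
  finally show ?thesis
    by (simp add: y'_def[abs_def] Q_def)
qed

section \<open>Charts of the velocity manifolds\<close>

definition full_rank :: "('N \<Rightarrow> 'n::finite \<Rightarrow> real) \<Rightarrow> bool" where
  "full_rank a \<longleftrightarrow> (\<forall>w. (\<forall>A. (\<Sum>j\<in>UNIV. w j * a A j) = 0) \<longrightarrow> (\<forall>j. w j = 0))"

text \<open>An injective linear map on a finite-dimensional space satisfies
  \<open>B * norm w \<le> norm (T a w)\<close> with \<open>B > 0\<close>. A perturbation of the
  matrix that changes the image of \<open>w\<close> by less than \<open>B * norm w\<close> cannot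
  create a kernel.\<close>

lemma openin_full_rank:
  "openin (powertop_real UNIV) {a :: 'N::finite \<times> 'n::finite \<Rightarrow> real. full_rank (\<lambda>A j. a (A, j))}"
  unfolding openin_powertop_real_iff[OF finite]
proof (intro conjI ballI)
  fix a :: "'N \<times> 'n \<Rightarrow> real" assume "a \<in> {a. full_rank (\<lambda>A j. a (A, j))}"
  then have rank: "\<forall>w. (\<forall>A. (\<Sum>j\<in>UNIV. w j * a (A, j)) = 0) \<longrightarrow> (\<forall>j. w j = 0)"
    by (simp add: full_rank_def)
  define T where "T b w = (\<chi> A. \<Sum>j\<in>UNIV. w $ j * b (A, j))" for b :: "'N \<times> 'n \<Rightarrow> real" and w :: "real ^ 'n"
  have lin: "linear (T b)" for b
    by (rule linearI) (simp_all add: T_def vec_eq_iff sum.distrib sum_distrib_left algebra_simps)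
  have "inj (T a)"
  proof (subst linear_injective_0[OF lin], intro allI impI)
    fix w assume "T a w = 0"
    then have "\<forall>j. w $ j = 0"
      using rank[rule_format, of "\<lambda>j. w $ j"] by (simp add: T_def vec_eq_iff)
    then show "w = 0" by (simp add: vec_eq_iff)
  qed
  then obtain B where B: "B > 0" "\<And>w. B * norm w \<le> norm (T a w)"
    using linear_inj_bounded_below_pos[OF lin] by metis
  \<comment> \<open>The l1 bound on the perturbed image adds one entry error for each pair in
    \<open>'N\<close> and \<open>'n\<close>.\<close>
  define d where "d = B / (CARD('N) * CARD('n))"
  have d: "d > 0" using B(1) by (simp add: d_def)
  show "\<exists>d>0. cube UNIV a d \<subseteq> {a. full_rank (\<lambda>A j. a (A, j))}"
  proof (intro exI[of _ d] conjI d subsetI CollectI)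
    fix b assume b: "b \<in> cube UNIV a d"
    show "full_rank (\<lambda>A j. b (A, j))"
      unfolding full_rank_def
    proof (intro allI impI, rule ccontr)
      fix w j0 assume w: "\<forall>A. (\<Sum>j\<in>UNIV. w j * b (A, j)) = 0" and j0: "w j0 \<noteq> 0"
      define v where "v = (\<chi> j. w j)"
      have v: "norm v > 0" using j0 by (auto simp: v_def vec_eq_iff)
      have "T b v = 0" using w by (simp add: T_def v_def vec_eq_iff)
      then have "T a v = T a v - T b v" by simp
      then have "norm (T a v) = norm (T a v - T b v)" by simp
      also have "\<dots> \<le> (\<Sum>A\<in>UNIV. \<bar>(T a v - T b v) $ A\<bar>)" by (rule norm_le_l1_cart)
      also have "\<dots> < (\<Sum>A\<in>(UNIV :: 'N set). \<Sum>j\<in>(UNIV :: 'n set). norm v * d)"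
      proof (rule sum_strict_mono)
        fix A :: 'N
        have "\<bar>(T a v - T b v) $ A\<bar> = \<bar>\<Sum>j\<in>UNIV. v $ j * (a (A, j) - b (A, j))\<bar>"
          by (simp add: T_def sum_subtractf right_diff_distrib)
        also have "\<dots> \<le> (\<Sum>j\<in>UNIV. \<bar>v $ j * (a (A, j) - b (A, j))\<bar>)" by (rule sum_abs)
        also have "\<dots> < (\<Sum>j\<in>(UNIV :: 'n set). norm v * d)"
        proof (rule sum_strict_mono)
          fix j :: 'n
          have "\<bar>a (A, j) - b (A, j)\<bar> < d" using b by (simp add: cube_def abs_minus_commute)
          then have "norm v * \<bar>a (A, j) - b (A, j)\<bar> < norm v * d" using v by simp
          moreover have "\<bar>v $ j\<bar> * \<bar>a (A, j) - b (A, j)\<bar> \<le> norm v * \<bar>a (A, j) - b (A, j)\<bar>"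
            by (intro mult_right_mono component_le_norm_cart) simp
          ultimately show "\<bar>v $ j * (a (A, j) - b (A, j))\<bar> < norm v * d" by (simp add: abs_mult)
        qed simp_all
        finally show "\<bar>(T a v - T b v) $ A\<bar> < (\<Sum>j\<in>(UNIV :: 'n set). norm v * d)" .
      qed simp_all
      also have "\<dots> = B * norm v" by (simp add: d_def)
      finally show False using B(2)[of v] by simp
    qed
  qed
qed simp

text \<open>The rank can be read off the first-order coordinates, which exist only for
  \<open>0 < s\<close>. For \<open>s = 0\<close> even regular velocities fill the whole open set,
  provided that n <= N.\<close>

definition velocity_image ::
  "bool \<Rightarrow> nat \<Rightarrow> ('N \<Rightarrow> real) set \<Rightarrow> ('N \<times> 'n::finite multiset \<Rightarrow> real) set" where
  "velocity_image reg s X = {u \<in> extensional (velocity_index s). (\<lambda>A. u (A, {#})) \<in> X \<and>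
     (reg \<and> 0 < s \<longrightarrow> full_rank (\<lambda>A j. u (A, {#j#})))}"

lemma openin_velocity_image:
  assumes X: "openin (powertop_real (UNIV :: 'N::finite set)) X"
  shows "openin (powertop_real (velocity_index s)) (velocity_image reg s X :: ('N \<times> 'n::finite multiset \<Rightarrow> real) set)"
proof (cases "reg \<and> 0 < s")
  case True
  have "openin (powertop_real (velocity_index s))
    {u \<in> {u \<in> extensional (velocity_index s). (\<lambda>A. u (A, {#})) \<in> X}.
      (\<lambda>b\<in>UNIV. u (fst b, {#snd b :: 'n#})) \<in> {a. full_rank (\<lambda>A j. a (A, j))}}"
    by (rule openin_preimage[OF openin_lift0[OF X] _ openin_full_rank,
        where g = "\<lambda>b u. u (fst b, {#snd b#})"]) (use True in \<open>auto intro!: cont_on_coord\<close>)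
  also have "{u \<in> {u \<in> extensional (velocity_index s). (\<lambda>A. u (A, {#})) \<in> X}.
      (\<lambda>b\<in>UNIV. u (fst b, {#snd b :: 'n#})) \<in> {a. full_rank (\<lambda>A j. a (A, j))}} = velocity_image reg s X"
    using True by (auto simp: velocity_image_def)
  finally show ?thesis .
next
  case False
  then show ?thesis using openin_lift0[OF X, where s = s and 'n = 'n] by (auto simp: velocity_image_def)
qed

section \<open>Polynomial curves with prescribed derivatives at the origin\<close>

definition monom_fun :: "'n::finite multiset \<Rightarrow> ('n \<Rightarrow> real) \<Rightarrow> real" where
  "monom_fun M t = (\<Prod>j\<in>UNIV. (1 / fact (count M j)) * t j ^ count M j)"

lemma smooth_on_power:
  assumes "finite I" "openin (powertop_real I) U" "smooth_on I U f"
  shows "smooth_on I U (\<lambda>x. f x ^ k)"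
  by (induction k) (auto intro: smooth_on_const smooth_on_mult assms)

lemma smooth_on_prod:
  assumes "finite I" "openin (powertop_real I) U" "\<And>a. a \<in> S \<Longrightarrow> smooth_on I U (f a)"
  shows "smooth_on I U (\<lambda>x. \<Prod>a\<in>S. f a x)"
  using assms(3)
  by (induction S rule: infinite_finite_induct) (auto intro: smooth_on_const smooth_on_mult assms(1,2))

lemma openin_UNIV: "openin (powertop_real (UNIV :: 'a set)) UNIV"
  using openin_topspace[of "powertop_real (UNIV :: 'a set)"] by simp

lemma smooth_on_monom_fun: "smooth_on UNIV UNIV (monom_fun M)"
  unfolding monom_fun_def[abs_def]
  by (intro smooth_on_prod smooth_on_mult smooth_on_const smooth_on_power smooth_on_coord finite openin_UNIV UNIV_I)

text \<open>The factorials in the denominator absorb the exponent produced by differentiation, so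
  that a derivative just deletes \<open>i\<close>.\<close>

lemma pd_monom_fun: "pd i (monom_fun M) = (if i \<in># M then monom_fun (M - {#i#}) else (\<lambda>_. 0))"
proof
  fix t :: "'a \<Rightarrow> real"
  define R where "R M = (\<Prod>j\<in>UNIV - {i}. (1 / fact (count M j)) * t j ^ count M j)" for M
  have split: "monom_fun M (t(i := h)) = (1 / fact (count M i)) * h ^ count M i * R M" for M h
    unfolding monom_fun_def R_def by (subst prod.remove[of UNIV i]) (auto intro!: arg_cong2[of _ _ _ _ "(*)"] prod.cong)
  have pd: "pd i (monom_fun M) t = (1 / fact (count M i)) * (real (count M i) * t i ^ (count M i - 1)) * R M"
  proof (rule pd_eqI)
    show "((\<lambda>h. monom_fun M (t(i := h))) has_real_derivative
      (1 / fact (count M i)) * (real (count M i) * t i ^ (count M i - 1)) * R M) (at (t i))"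
      unfolding split by (intro DERIV_cmult_right DERIV_cmult) (use DERIV_pow[of "count M i" "t i"] in simp)
  qed
  show "pd i (monom_fun M) t = (if i \<in># M then monom_fun (M - {#i#}) else (\<lambda>_. 0)) t"
  proof (cases "i \<in># M")
    case True
    then obtain M' where M: "M = add_mset i M'" by (meson mset_add)
    have "R M = R M'" unfolding R_def by (rule prod.cong) (auto simp: M)
    then show ?thesis
      using split[of M' "t i"] unfolding pd by (simp add: M del: of_nat_Suc)
  next
    case False
    then have "count M i = 0" by (simp add: not_in_iff)
    then show ?thesis using False unfolding pd by simp
  qed
qed

lemma pds_monom_fun:
  "pds J (monom_fun M) = (if mset J \<subseteq># M then monom_fun (M - mset J) else (\<lambda>_. 0))"
proof (induction J)
  case (Cons i J)
  have "add_mset i (mset J) \<subseteq># M \<longleftrightarrow> mset J \<subseteq># M \<and> i \<in># M - mset J"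
  proof
    assume "add_mset i (mset J) \<subseteq># M"
    then obtain K where "M = add_mset i (mset J) + K" by (auto simp: subset_mset.le_iff_add)
    then show "mset J \<subseteq># M \<and> i \<in># M - mset J" by simp
  next
    assume *: "mset J \<subseteq># M \<and> i \<in># M - mset J"
    then obtain K where K: "M = mset J + K" by (auto simp: subset_mset.le_iff_add)
    with * obtain K' where "K = add_mset i K'" by (auto dest: multi_member_split)
    then show "add_mset i (mset J) \<subseteq># M" by (simp add: K)
  qed
  then show ?case
    using Cons by (auto simp: pd_monom_fun pd_const)
qed simp

lemma monom_fun_zero: "monom_fun M (\<lambda>_. 0) = (if M = {#} then 1 else 0)"
proof (cases "M = {#}")
  case False
  then obtain j where "j \<in># M" by blast
  then have "\<exists>j\<in>UNIV. (1 / fact (count M j)) * (0::real) ^ count M j = 0"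
    by (intro bexI[of _ j]) (auto simp: power_0_left)
  then show ?thesis using False by (simp add: monom_fun_def prod_zero_iff)
qed (simp add: monom_fun_def)

text \<open>The normalised monomials are dual to the derivatives at 0: their coefficients in a
  polynomial are its jet coordinates there.\<close>

lemma pds_monom_fun_zero: "pds J (monom_fun M) (\<lambda>_. 0) = (if mset J = M then 1 else 0)"
proof -
  have "mset J \<subseteq># M \<Longrightarrow> M - mset J = {#} \<longleftrightarrow> mset J = M"
    by (metis Diff_eq_empty_iff_mset subset_mset.antisym subset_mset.diff_add add.left_neutral diff_cancel)
  then show ?thesis by (auto simp: pds_monom_fun monom_fun_zero)
qed

lemma pds_cmult:
  assumes "finite I" "openin (powertop_real I) U" "smooth_on I U f" "x \<in> U" "J \<in> lists I"
  shows "pds J (\<lambda>x. c * f x) x = c * pds J f x"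
  using assms(5,4)
proof (induction J arbitrary: x)
  case (Cons i J)
  have "pd i (pds J (\<lambda>x. c * f x)) x = pd i (\<lambda>x. c * pds J f x) x"
    by (rule pd_cong[OF assms(1,2) Cons.IH Cons.prems Cons.hyps(1)])
  then show ?case
    using pd_mult[of i "\<lambda>_. c" x "pds J f"] pdifferentiable_const[of i c x]
      smooth_on_pdifferentiable[OF smooth_on_pds[OF assms(3) Cons.hyps(2)] Cons.hyps(1) Cons.prems]
    by (simp add: pd_const)
qed simp

section \<open>Jets of maps and velocity charts\<close>

locale velocity_manifold =
  fixes \<A> :: "('x, 'N::finite) chart set" and reg :: bool
  assumes smooth_atlas: "smooth_atlas UNIV \<A>"
begin

definition transition_map :: "'x set \<Rightarrow> ('x \<Rightarrow> 'N \<Rightarrow> real) \<Rightarrow> ('x \<Rightarrow> 'N \<Rightarrow> real) \<Rightarrow> 'N \<Rightarrow> ('N \<Rightarrow> real) \<Rightarrow> real" where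
  "transition_map V \<phi> \<psi> A u = \<psi> (inv_into V \<phi> u) A"

abbreviation crd :: "('x \<Rightarrow> 'N \<Rightarrow> real) \<Rightarrow> (('n \<Rightarrow> real) \<Rightarrow> 'x) \<Rightarrow> 'N \<Rightarrow> ('n \<Rightarrow> real) \<Rightarrow> real" where
  "crd \<phi> \<gamma> \<equiv> \<lambda>A t. \<phi> (\<gamma> t) A"

lemma chartD:
  assumes "(V, \<phi>) \<in> \<A>"
  shows inj_on_chart: "inj_on \<phi> V" and openin_chart: "openin (powertop_real UNIV) (\<phi> ` V)"
  using smooth_atlas assms by (auto simp: smooth_atlas_def is_chart_def)

lemma transitionD:
  assumes "(V, \<phi>) \<in> \<A>" "(V', \<psi>) \<in> \<A>"
  shows openin_overlap: "openin (powertop_real UNIV) (\<phi> ` (V \<inter> V'))"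
    and smooth_on_transition_map: "smooth_on UNIV (\<phi> ` (V \<inter> V')) (transition_map V \<phi> \<psi> A)"
  using smooth_atlas assms
  by (force simp: smooth_atlas_def compatible_def smooth_transition_def transition_map_def[abs_def])+

lemma transition_map_apply: "(V, \<phi>) \<in> \<A> \<Longrightarrow> x \<in> V \<Longrightarrow> transition_map V \<phi> \<psi> A (\<phi> x) = \<psi> x A"
  by (simp add: transition_map_def inv_into_f_f[OF inj_on_chart])

text \<open>Smoothness only provides some chart around each point. That \<open>\<gamma> u\<close>
  lies in the given domain is read in that chart as membership in the open image of the overlap,
  which yields the smaller neighbourhood; the transition map then transfers smoothness.\<close>

lemma smooth_map_chart:
  fixes \<gamma> :: "('n::finite \<Rightarrow> real) \<Rightarrow> 'x"
  assumes \<gamma>: "smooth_map \<A> U \<gamma>" and t: "t \<in> U" and c: "(V, \<phi>) \<in> \<A>" and tV: "\<gamma> t \<in> V"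
  obtains W where "openin (powertop_real UNIV) W" "t \<in> W" "W \<subseteq> U" "\<gamma> ` W \<subseteq> V"
    "\<And>A. smooth_on UNIV W (crd \<phi> \<gamma> A)"
proof -
  obtain V' \<psi> W' where W': "(V', \<psi>) \<in> \<A>" "openin (powertop_real UNIV) W'" "t \<in> W'" "W' \<subseteq> U" "\<gamma> ` W' \<subseteq> V'"
    "\<And>A. smooth_on UNIV W' (crd \<psi> \<gamma> A)"
    using \<gamma> t unfolding smooth_map_def by fast
  define W where "W = {u \<in> W'. \<psi> (\<gamma> u) \<in> \<psi> ` (V' \<inter> V)}"
  have "openin (powertop_real UNIV) {u \<in> W'. (\<lambda>A\<in>UNIV. crd \<psi> \<gamma> A u) \<in> \<psi> ` (V' \<inter> V)}"
    by (rule openin_preimage[OF W'(2) smooth_on_imp_cont_on[OF W'(6)] openin_overlap[OF W'(1) c]])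
  then have W: "openin (powertop_real UNIV) W" by (simp add: W_def restrict_UNIV)
  have WV: "\<gamma> u \<in> V' \<inter> V" if "u \<in> W" for u
    using that W'(5) inj_on_chart[OF W'(1)] by (auto simp: W_def dest: inj_onD)
  show thesis
  proof
    show "openin (powertop_real UNIV) W" by (rule W)
    show "t \<in> W" using W'(3,5) tV by (auto simp: W_def)
    show "W \<subseteq> U" using W'(4) by (auto simp: W_def)
    show "\<gamma> ` W \<subseteq> V" using WV by blast
    fix A
    have s: "smooth_on UNIV W (crd \<psi> \<gamma> B)" for B
      by (rule smooth_on_subset[OF W'(6)]) (auto simp: W_def)
    have "smooth_on UNIV W (\<lambda>u. transition_map V' \<psi> \<phi> A (\<lambda>B. crd \<psi> \<gamma> B u))"
      by (rule smooth_on_compose_UNIV[OF W s openin_overlap[OF W'(1) c] _ smooth_on_transition_map[OF W'(1) c]])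
        (simp add: W_def)
    then show "smooth_on UNIV W (crd \<phi> \<gamma> A)"
      by (rule smooth_on_cong[OF finite W, rotated]) (use WV transition_map_apply[OF W'(1)] in simp)
  qed
qed

lemma velocity_map_chart:
  fixes \<gamma> :: "('n::finite \<Rightarrow> real) \<Rightarrow> 'x"
  assumes \<gamma>: "\<gamma> \<in> velocity_maps reg \<A>" and c: "(V, \<phi>) \<in> \<A>" and V: "\<gamma> (\<lambda>_. 0) \<in> V"
  shows "\<exists>W. openin (powertop_real UNIV) W \<and> (\<lambda>_. 0) \<in> W \<and> \<gamma> ` W \<subseteq> V \<and>
    (\<forall>A. smooth_on UNIV W (crd \<phi> \<gamma> A)) \<and>
    (reg \<longrightarrow> (\<forall>t\<in>W. full_rank (\<lambda>A j. pd j (crd \<phi> \<gamma> A) t)))"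
proof -
  obtain U where U: "openin (powertop_real UNIV) U" "(\<lambda>_. 0) \<in> U"
    "if reg then immersion \<A> U \<gamma> else smooth_map \<A> U \<gamma>"
    using \<gamma> unfolding velocity_maps_def by blast
  have sm: "smooth_map \<A> U \<gamma>" using U(3) by (auto simp: immersion_def split: if_splits)
  obtain W where W: "openin (powertop_real UNIV) W" "(\<lambda>_. 0) \<in> W" "W \<subseteq> U" "\<gamma> ` W \<subseteq> V"
    "\<And>A. smooth_on UNIV W (crd \<phi> \<gamma> A)"
    using smooth_map_chart[OF sm U(2) c V] by blast
  have "full_rank (\<lambda>A j. pd j (crd \<phi> \<gamma> A) t)" if "reg" "t \<in> W" for t
  proof -
    have "immersion \<A> U \<gamma>" "t \<in> U" "\<gamma> t \<in> V" using U(3) that W by auto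
    then show ?thesis using c unfolding immersion_def full_rank_def by fast
  qed
  with W show ?thesis by (intro exI[of _ W]) simp
qed

lemma jet_self: "\<gamma> \<in> velocity_maps reg \<A> \<Longrightarrow> \<gamma> \<in> jet reg \<A> r \<gamma>"
  by (simp add: jet_def case_prod_beta)

lemma jet_eq: "\<delta> \<in> jet reg \<A> r \<gamma> \<Longrightarrow> jet reg \<A> r \<delta> = jet reg \<A> r \<gamma>"
  unfolding jet_def by (auto simp: case_prod_beta)

lemma jetD:
  assumes "\<delta> \<in> jet reg \<A> r \<gamma>"
  shows "\<delta> \<in> velocity_maps reg \<A>" "\<delta> (\<lambda>_. 0) = \<gamma> (\<lambda>_. 0)"
    "(V, \<phi>) \<in> \<A> \<Longrightarrow> \<gamma> (\<lambda>_. 0) \<in> V \<Longrightarrow> length J \<le> r \<Longrightarrow>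
      pds J (crd \<phi> \<delta> A) (\<lambda>_. 0) = pds J (crd \<phi> \<gamma> A) (\<lambda>_. 0)"
  using assms unfolding jet_def by blast+

lemma representative_jet:
  "\<gamma> \<in> velocity_maps reg \<A> \<Longrightarrow> representative (jet reg \<A> r \<gamma>) \<in> jet reg \<A> r \<gamma>"
  unfolding representative_def by (rule someI[of "\<lambda>\<gamma>'. \<gamma>' \<in> _"]) (rule jet_self)

lemma velocities_overD:
  assumes "p \<in> velocities_over reg \<A> s V"
  shows "representative p \<in> velocity_maps reg \<A>" "representative p (\<lambda>_. 0) \<in> V"
    "jet reg \<A> s (representative p) = p"
proof -
  obtain \<gamma> where \<gamma>: "p = jet reg \<A> s \<gamma>" "\<gamma> \<in> velocity_maps reg \<A>" "\<gamma> (\<lambda>_. 0) \<in> V"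
    using assms unfolding velocities_over_def by blast
  have rep: "representative p \<in> jet reg \<A> s \<gamma>" using representative_jet[OF \<gamma>(2)] by (simp add: \<gamma>(1))
  show "representative p \<in> velocity_maps reg \<A>" "representative p (\<lambda>_. 0) \<in> V"
    using jetD(1,2)[OF rep] \<gamma>(3) by simp_all
  show "jet reg \<A> s (representative p) = p" using jet_eq[OF rep] by (simp add: \<gamma>(1))
qed

lemma velocities_overI:
  "\<gamma> \<in> velocity_maps reg \<A> \<Longrightarrow> \<gamma> (\<lambda>_. 0) \<in> V \<Longrightarrow> jet reg \<A> s \<gamma> \<in> velocities_over reg \<A> s V"
  unfolding velocities_over_def by blast

lemma velocities_over_Int:
  "velocities_over reg \<A> s V \<inter> velocities_over reg \<A> s V' = velocities_over reg \<A> s (V \<inter> V')"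
proof (intro set_eqI iffI IntI)
  fix p assume "p \<in> velocities_over reg \<A> s V \<inter> velocities_over reg \<A> s V'"
  then have p: "p \<in> velocities_over reg \<A> s V" "p \<in> velocities_over reg \<A> s V'" by auto
  then show "p \<in> velocities_over reg \<A> s (V \<inter> V')"
    using velocities_overI[OF velocities_overD(1)[OF p(1)], of "V \<inter> V'" s]
      velocities_overD(2,3)[OF p(1)] velocities_overD(2)[OF p(2)] by simp
qed (auto simp: velocities_over_def)

lemma velocity_chart_map_eq:
  "velocity_chart_map s \<phi> p = curve_jet s (crd \<phi> (representative p)) (\<lambda>_. 0)"
  by (auto simp: velocity_chart_map_def curve_jet_def velocity_coord_def list_of_mset_def fun_eq_iff)

lemma curve_jet_cong_jet:
  assumes "\<delta> \<in> jet reg \<A> s \<gamma>" "(V, \<phi>) \<in> \<A>" "\<gamma> (\<lambda>_. 0) \<in> V"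
  shows "curve_jet s (crd \<phi> \<delta>) (\<lambda>_. 0) = curve_jet s (crd \<phi> \<gamma>) (\<lambda>_. 0)"
  unfolding curve_jet_def by (intro restrict_ext jetD(3)[OF assms]) simp

lemma velocity_chart_map_jet:
  assumes "\<gamma> \<in> velocity_maps reg \<A>" "(V, \<phi>) \<in> \<A>" "\<gamma> (\<lambda>_. 0) \<in> V"
  shows "velocity_chart_map s \<phi> (jet reg \<A> s \<gamma>) = curve_jet s (crd \<phi> \<gamma>) (\<lambda>_. 0)"
  unfolding velocity_chart_map_eq by (rule curve_jet_cong_jet[OF representative_jet[OF assms(1)] assms(2,3)])

lemma pds_chart_change:
  fixes \<gamma> :: "('n::finite \<Rightarrow> real) \<Rightarrow> 'x"
  assumes \<gamma>: "\<gamma> \<in> velocity_maps reg \<A>" and c: "(V, \<phi>) \<in> \<A>" and d: "(V', \<psi>) \<in> \<A>"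
    and V: "\<gamma> (\<lambda>_. 0) \<in> V" and V': "\<gamma> (\<lambda>_. 0) \<in> V'" and J: "length J \<le> s"
  shows "pds J (crd \<psi> \<gamma> A) (\<lambda>_. 0) = total_derivs s J (lift0 (transition_map V \<phi> \<psi> A)) (curve_jet s (crd \<phi> \<gamma>) (\<lambda>_. 0))"
proof -
  obtain W1 where W1: "openin (powertop_real UNIV) W1" "(\<lambda>_. 0) \<in> W1" "\<gamma> ` W1 \<subseteq> V"
    "\<forall>A. smooth_on UNIV W1 (crd \<phi> \<gamma> A)"
    using velocity_map_chart[OF \<gamma> c V] by (elim exE conjE) (rule that)
  obtain W2 where W2: "openin (powertop_real UNIV) W2" "(\<lambda>_. 0) \<in> W2" "\<gamma> ` W2 \<subseteq> V'"
    using velocity_map_chart[OF \<gamma> d V'] by (elim exE conjE) (rule that)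
  let ?W = "W1 \<inter> W2"
  have W: "openin (powertop_real UNIV) ?W" using W1(1) W2(1) by (rule openin_Int)
  have 0: "(\<lambda>_. 0) \<in> ?W" using W1(2) W2(2) by simp
  have WV: "\<gamma> t \<in> V \<inter> V'" if "t \<in> ?W" for t using W1(3) W2(3) that by blast
  have s: "smooth_on UNIV ?W (crd \<phi> \<gamma> A)" for A by (rule smooth_on_subset[OF W1(4)[rule_format]]) blast
  have "pds J (crd \<psi> \<gamma> A) (\<lambda>_. 0) = pds J (\<lambda>t. transition_map V \<phi> \<psi> A (\<lambda>B. crd \<phi> \<gamma> B t)) (\<lambda>_. 0)"
    by (rule pds_cong[OF finite W _ 0]) (use WV transition_map_apply[OF c] in auto)
  also have "\<dots> = total_derivs s J (lift0 (transition_map V \<phi> \<psi> A)) (curve_jet s (crd \<phi> \<gamma>) (\<lambda>_. 0))"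
    by (rule pds_compose_eq_total_derivs[OF W s openin_overlap[OF c d] _ smooth_on_transition_map[OF c d] 0 J]) (use WV in simp)
  finally show ?thesis .
qed

text \<open>Jets are compared in all charts at once. One chart decides, because derivatives in any
  other chart are functions of the jet coordinates in the first, by
  \<open>pds_chart_change\<close>.\<close>

lemma jet_determined:
  fixes \<gamma> \<delta> :: "('n::finite \<Rightarrow> real) \<Rightarrow> 'x"
  assumes \<gamma>: "\<gamma> \<in> velocity_maps reg \<A>" "\<gamma> (\<lambda>_. 0) \<in> V" and \<delta>: "\<delta> \<in> velocity_maps reg \<A>" "\<delta> (\<lambda>_. 0) \<in> V"
    and c: "(V, \<phi>) \<in> \<A>"
    and eq: "curve_jet s (crd \<phi> \<gamma>) (\<lambda>_. 0) = curve_jet s (crd \<phi> \<delta>) (\<lambda>_. 0)"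
  shows "jet reg \<A> s \<gamma> = jet reg \<A> s \<delta>"
proof -
  have "lift0 (\<lambda>u. u A) (curve_jet s (crd \<phi> \<gamma>) (\<lambda>_. 0)) = lift0 (\<lambda>u. u A) (curve_jet s (crd \<phi> \<delta>) (\<lambda>_. 0))" for A
    using eq by simp
  then have "\<phi> (\<gamma> (\<lambda>_. 0)) = \<phi> (\<delta> (\<lambda>_. 0))" by (simp add: fun_eq_iff)
  then have 0: "\<gamma> (\<lambda>_. 0) = \<delta> (\<lambda>_. 0)" using inj_on_chart[OF c] \<gamma>(2) \<delta>(2) by (blast dest: inj_onD)
  have "pds J (crd \<psi> \<gamma> A) (\<lambda>_. 0) = pds J (crd \<psi> \<delta> A) (\<lambda>_. 0)"
    if "(V', \<psi>) \<in> \<A>" "\<delta> (\<lambda>_. 0) \<in> V'" "length J \<le> s" for V' \<psi> A J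
    using pds_chart_change[OF \<gamma>(1) c that(1) \<gamma>(2) _ that(3)] pds_chart_change[OF \<delta>(1) c that(1) \<delta>(2) that(2,3)]
      0 that(2) eq by simp
  then have "\<gamma> \<in> jet reg \<A> s \<delta>" using 0 \<gamma>(1) unfolding jet_def by blast
  then show ?thesis by (rule jet_eq)
qed

lemma inj_on_velocity_chart_map:
  assumes c: "(V, \<phi>) \<in> \<A>"
  shows "inj_on (velocity_chart_map s \<phi>) (velocities_over reg \<A> s V :: ('n::finite, 'x) jet set)"
proof (rule inj_onI)
  fix p q :: "('n, 'x) jet"
  assume p: "p \<in> velocities_over reg \<A> s V" and q: "q \<in> velocities_over reg \<A> s V"
    and eq: "velocity_chart_map s \<phi> p = velocity_chart_map s \<phi> q"
  show "p = q"
    using jet_determined[OF velocities_overD(1,2)[OF p] velocities_overD(1,2)[OF q] c, of s]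
      eq velocities_overD(3)[OF p] velocities_overD(3)[OF q] by (simp add: velocity_chart_map_eq)
qed

text \<open>By the chain rule a vector killed by the Jacobian in \<open>\<psi>\<close> is killed by
  the one in \<open>\<phi>\<close>. This is needed because \<open>immersion\<close> asks for full
  rank in every chart.\<close>

lemma full_rank_chart_change:
  fixes \<gamma> :: "('n::finite \<Rightarrow> real) \<Rightarrow> 'x"
  assumes c: "(V, \<phi>) \<in> \<A>" and d: "(V', \<psi>) \<in> \<A>" and W: "openin (powertop_real UNIV) W"
    and WV: "\<And>t. t \<in> W \<Longrightarrow> \<gamma> t \<in> V \<inter> V'" and s: "\<And>A. smooth_on UNIV W (crd \<psi> \<gamma> A)" and t: "t \<in> W"
    and rank: "full_rank (\<lambda>A j. pd j (crd \<phi> \<gamma> A) t)"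
  shows "full_rank (\<lambda>A j. pd j (crd \<psi> \<gamma> A) t)"
proof -
  have pd: "pd j (crd \<phi> \<gamma> A) t =
    (\<Sum>B\<in>UNIV. pd B (transition_map V' \<psi> \<phi> A) (\<psi> (\<gamma> t)) * pd j (crd \<psi> \<gamma> B) t)" for j A
  proof -
    have "pd j (crd \<phi> \<gamma> A) t = pd j (\<lambda>t. transition_map V' \<psi> \<phi> A (\<lambda>B\<in>UNIV. crd \<psi> \<gamma> B t)) t"
      by (rule pd_cong[OF finite W _ t UNIV_I]) (use WV transition_map_apply[OF d] in \<open>simp add: restrict_UNIV\<close>)
    also have "\<dots> = (\<Sum>B\<in>UNIV. pd B (transition_map V' \<psi> \<phi> A) (\<lambda>B\<in>UNIV. crd \<psi> \<gamma> B t) * pd j (crd \<psi> \<gamma> B) t)"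
    proof (rule chain_rule(2)[OF finite W finite openin_overlap[OF d c]])
      show "ck (Suc 0) UNIV (\<psi> ` (V' \<inter> V)) (transition_map V' \<psi> \<phi> A)"
        using smooth_on_transition_map[OF d c] by (simp only: smooth_on_iff_ck)
      show "pdifferentiable j (crd \<psi> \<gamma> B) t" for B by (rule smooth_on_pdifferentiable[OF s UNIV_I t])
      show "(\<lambda>B\<in>UNIV. crd \<psi> \<gamma> B t) \<in> \<psi> ` (V' \<inter> V)" using WV[OF t] by (simp add: restrict_UNIV)
    qed
    finally show ?thesis by (simp add: restrict_UNIV)
  qed
  show ?thesis
    unfolding full_rank_def
  proof (rule allI, rule impI)
    fix w assume w: "\<forall>A. (\<Sum>j\<in>UNIV. w j * pd j (crd \<psi> \<gamma> A) t) = 0"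
    have "(\<Sum>j\<in>UNIV. w j * pd j (crd \<phi> \<gamma> A) t) = 0" for A
    proof -
      have "(\<Sum>j\<in>UNIV. w j * pd j (crd \<phi> \<gamma> A) t) =
        (\<Sum>j\<in>UNIV. \<Sum>B\<in>UNIV. pd B (transition_map V' \<psi> \<phi> A) (\<psi> (\<gamma> t)) * (w j * pd j (crd \<psi> \<gamma> B) t))"
        unfolding pd by (simp add: sum_distrib_left mult.left_commute)
      also have "\<dots> = (\<Sum>B\<in>UNIV. pd B (transition_map V' \<psi> \<phi> A) (\<psi> (\<gamma> t)) * (\<Sum>j\<in>UNIV. w j * pd j (crd \<psi> \<gamma> B) t))"
        by (subst sum.swap) (simp add: sum_distrib_left)
      finally show ?thesis using w by simp
    qed
    then show "\<forall>j. w j = 0" using rank unfolding full_rank_def by blast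
  qed
qed

lemma in_velocity_imageI:
  fixes \<gamma> :: "('n::finite \<Rightarrow> real) \<Rightarrow> 'x"
  assumes W: "openin (powertop_real UNIV) W" and s: "\<And>A. smooth_on UNIV W (crd \<phi> \<gamma> A)" and t: "t \<in> W"
    and X: "\<phi> (\<gamma> t) \<in> X" and rank: "reg \<Longrightarrow> full_rank (\<lambda>A j. pd j (crd \<phi> \<gamma> A) t)"
  shows "curve_jet s (crd \<phi> \<gamma>) t \<in> velocity_image reg s X"
proof -
  have "curve_jet s (crd \<phi> \<gamma>) t (A, {#j#}) = pd j (crd \<phi> \<gamma> A) t" if "0 < s" for A j
    using curve_jet_mset[where y = "crd \<phi> \<gamma>", OF W s t, of "[j]" s A] that by simp
  moreover have "(\<lambda>A. curve_jet s (crd \<phi> \<gamma>) t (A, {#})) \<in> X"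
    using X by (simp add: curve_jet_def)
  ultimately show ?thesis
    using rank curve_jet_extensional[of s "crd \<phi> \<gamma>" t] by (simp add: velocity_image_def)
qed

lemma velocity_chart_map_in_image:
  fixes p :: "('n::finite, 'x) jet"
  assumes c: "(V, \<phi>) \<in> \<A>" and V0: "V0 \<subseteq> V" and p: "p \<in> velocities_over reg \<A> s V0"
  shows "velocity_chart_map s \<phi> p \<in> velocity_image reg s (\<phi> ` V0)"
proof -
  let ?\<gamma> = "representative p"
  obtain W where W: "openin (powertop_real UNIV) W" "(\<lambda>_. 0) \<in> W" "?\<gamma> ` W \<subseteq> V"
    "\<forall>A. smooth_on UNIV W (crd \<phi> ?\<gamma> A)" "reg \<longrightarrow> (\<forall>t\<in>W. full_rank (\<lambda>A j. pd j (crd \<phi> ?\<gamma> A) t))"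
    using velocity_map_chart[OF velocities_overD(1)[OF p] c subsetD[OF V0 velocities_overD(2)[OF p]]]
    by (elim exE conjE) (rule that)
  show ?thesis
    unfolding velocity_chart_map_eq
    by (rule in_velocity_imageI[OF W(1) W(4)[rule_format] W(2)])
      (use velocities_overD(2)[OF p] W(2,5) in auto)
qed

text \<open>The curve given in coordinates is pulled back by the chart and restricted to an open set
  on which it stays in \<open>V0\<close> and, for regular velocities, keeps full rank.\<close>

lemma velocity_map_of_coordinates:
  fixes Y :: "'N \<Rightarrow> ('n::finite \<Rightarrow> real) \<Rightarrow> real"
  assumes c: "(V, \<phi>) \<in> \<A>" and V0: "V0 \<subseteq> V" "openin (powertop_real UNIV) (\<phi> ` V0)"
    and Y: "\<And>A. smooth_on UNIV UNIV (Y A)" and Y0: "(\<lambda>A. Y A (\<lambda>_. 0)) \<in> \<phi> ` V0"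
    and rank: "reg \<Longrightarrow> full_rank (\<lambda>A j. pd j (Y A) (\<lambda>_. 0))"
  obtains \<gamma> W where "\<gamma> \<in> velocity_maps reg \<A>" "\<gamma> (\<lambda>_. 0) \<in> V0" "openin (powertop_real UNIV) W" "(\<lambda>_. 0) \<in> W"
    "\<forall>t\<in>W. \<forall>A. crd \<phi> \<gamma> A t = Y A t"
proof -
  define W1 where "W1 = {t \<in> UNIV. (\<lambda>A\<in>UNIV. Y A t) \<in> \<phi> ` V0}"
  \<comment> \<open>A regular velocity is the jet of a map that is immersive on a neighbourhood, so
    the rank at 0 must be spread to an open set.\<close>
  define W2 where "W2 = {t \<in> UNIV. (\<lambda>b\<in>UNIV. pd (snd b) (Y (fst b)) t) \<in> {a. full_rank (\<lambda>A j. a (A, j))}}"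
  define W where "W = (if reg then W1 \<inter> W2 else W1)"
  define \<gamma> where "\<gamma> t = inv_into V \<phi> (\<lambda>A. Y A t)" for t
  have W1: "openin (powertop_real UNIV) W1"
    unfolding W1_def by (rule openin_preimage[OF openin_UNIV smooth_on_imp_cont_on[OF Y] V0(2)])
  have W2: "openin (powertop_real UNIV) W2"
    unfolding W2_def
    by (rule openin_preimage[OF openin_UNIV _ openin_full_rank, where g = "\<lambda>b t. pd (snd b) (Y (fst b)) t"])
      (rule smooth_on_imp_cont_on[OF smooth_on_pd[OF Y UNIV_I]])
  have W: "openin (powertop_real UNIV) W"
    using W1 openin_Int[OF W1 W2] by (simp add: W_def)
  have 0: "(\<lambda>_. 0) \<in> W"
    using Y0 rank by (simp add: W_def W1_def W2_def restrict_UNIV)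
  have YW: "(\<lambda>A. Y A t) \<in> \<phi> ` V0" if "t \<in> W" for t
    using that by (auto simp: W_def W1_def restrict_UNIV split: if_splits)
  have \<gamma>V: "\<gamma> t \<in> V0" if "t \<in> W" for t
    using YW[OF that] V0(1) inj_on_chart[OF c] by (auto simp: \<gamma>_def inv_into_f_f subset_iff)
  have \<gamma>Y: "crd \<phi> \<gamma> A t = Y A t" if "t \<in> W" for A t
    using f_inv_into_f[of "\<lambda>A. Y A t" \<phi> V] YW[OF that] V0(1) by (auto simp: \<gamma>_def fun_eq_iff)
  have s: "smooth_on UNIV W (crd \<phi> \<gamma> A)" for A
    by (rule smooth_on_cong[OF finite W _ smooth_on_subset[OF Y subset_UNIV]]) (rule \<gamma>Y[symmetric])
  have sm: "smooth_map \<A> W \<gamma>"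
    unfolding smooth_map_def
  proof
    fix t assume t: "t \<in> W"
    show "\<exists>(V, \<phi>)\<in>\<A>. \<exists>W'. openin (powertop_real UNIV) W' \<and> t \<in> W' \<and> W' \<subseteq> W \<and> \<gamma> ` W' \<subseteq> V \<and>
        (\<forall>A. smooth_on UNIV W' (\<lambda>u. \<phi> (\<gamma> u) A))"
      by (rule bexI[OF _ c], rule case_prodI, rule exI[of _ W]) (use W t s \<gamma>V V0(1) in auto)
  qed
  have "immersion \<A> W \<gamma>" if reg
    unfolding immersion_def
  proof (intro conjI sm ballI, clarify)
    fix t V' \<psi> w j assume t: "t \<in> W" and d: "(V', \<psi>) \<in> \<A>" and V': "\<gamma> t \<in> V'"
      and w: "\<forall>A. (\<Sum>j\<in>UNIV. w j * pd j (\<lambda>u. \<psi> (\<gamma> u) A) t) = 0"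
    obtain W' where W': "openin (powertop_real UNIV) W'" "t \<in> W'" "W' \<subseteq> W" "\<gamma> ` W' \<subseteq> V'"
      "\<And>A. smooth_on UNIV W' (crd \<psi> \<gamma> A)"
      using smooth_map_chart[OF sm t d V'] by blast
    have "pd j (crd \<phi> \<gamma> A) t = pd j (Y A) t" for j A
      by (rule pd_cong[OF finite W \<gamma>Y t UNIV_I])
    then have "full_rank (\<lambda>A j. pd j (crd \<phi> \<gamma> A) t)"
      using t that by (simp add: W_def W2_def)
    then have "full_rank (\<lambda>A j. pd j (crd \<psi> \<gamma> A) t)"
      by (rule full_rank_chart_change[OF c d W'(1) _ W'(5) W'(2), rotated])
        (use W'(3,4) \<gamma>V V0(1) in blast)
    then show "w j = 0" using w unfolding full_rank_def by blast
  qed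
  then have "\<gamma> \<in> velocity_maps reg \<A>"
    unfolding velocity_maps_def using W 0 sm by auto
  then show thesis
    using \<gamma>V[OF 0] W 0 \<gamma>Y by (intro that[of \<gamma> W]) auto
qed

text \<open>The Taylor polynomial with coefficients \<open>u\<close> is a curve whose jet has the
  coordinates \<open>u\<close>. Allowing subsets \<open>V0\<close> of the chart domain covers the
  overlaps of charts as well.\<close>

lemma velocity_image_subset:
  assumes dim: "CARD('n::finite) \<le> CARD('N)" and c: "(V, \<phi>) \<in> \<A>"
    and V0: "V0 \<subseteq> V" "openin (powertop_real UNIV) (\<phi> ` V0)"
    and u: "u \<in> velocity_image reg s (\<phi> ` V0)"
  shows "u \<in> velocity_chart_map s \<phi> ` (velocities_over reg \<A> s V0 :: ('n, 'x) jet set)"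
proof -
  obtain e :: "'n \<Rightarrow> 'N" where e: "inj e"
    using card_le_inj[of "UNIV :: 'n set" "UNIV :: 'N set"] dim by auto
  \<comment> \<open>For \<open>s = 0\<close> the coordinates \<open>u\<close> leave the first derivatives of the curve free; the coefficients
    from \<open>e\<close> make it an immersion.\<close>
  define b where "b A M = (if size M \<le> s then u (A, M) else if M = {#inv e A#} \<and> A \<in> range e then 1 else 0)"
    for A M
  \<comment> \<open>The degree goes up to \<open>Suc s\<close>, so that first-order terms are
    present even for \<open>s = 0\<close>.\<close>
  define Y where "Y A t = (\<Sum>M | size M \<le> Suc s. b A M * monom_fun M t)" for A and t :: "'n \<Rightarrow> real"
  have Y: "smooth_on UNIV UNIV (Y A)" for A
    unfolding Y_def[abs_def]
    by (intro smooth_on_sum smooth_on_mult finite openin_UNIV smooth_on_const smooth_on_monom_fun)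
  have pdsY: "pds J (Y A) (\<lambda>_. 0) = b A (mset J)" if "length J \<le> Suc s" for J A
  proof -
    have "pds J (Y A) (\<lambda>_. 0) = (\<Sum>M | size M \<le> Suc s. pds J (\<lambda>t. b A M * monom_fun M t) (\<lambda>_. 0))"
      unfolding Y_def[abs_def]
      by (rule pds_sum[OF finite openin_UNIV])
        (auto intro!: smooth_on_mult finite openin_UNIV smooth_on_const smooth_on_monom_fun)
    also have "\<dots> = (\<Sum>M | size M \<le> Suc s. b A M * pds J (monom_fun M) (\<lambda>_. 0))"
      by (intro sum.cong refl pds_cmult[OF finite openin_UNIV smooth_on_monom_fun]) auto
    also have "\<dots> = b A (mset J)"
      using that by (simp add: pds_monom_fun_zero finite_multisets_size_le if_distrib cong: if_cong)
    finally show ?thesis .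
  qed
  have Y0: "(\<lambda>A. Y A (\<lambda>_. 0)) \<in> \<phi> ` V0"
    using u pdsY[of "[]"] by (simp add: velocity_image_def b_def)
  have rank: "full_rank (\<lambda>A j. pd j (Y A) (\<lambda>_. 0))" if reg
  proof (cases "0 < s")
    case True
    then have "pd j (Y A) (\<lambda>_. 0) = u (A, {#j#})" for A j
      using pdsY[of "[j]" A] by (simp add: b_def)
    then show ?thesis using u that True by (simp add: velocity_image_def)
  next
    case False
    then have pdY: "pd j (Y A) (\<lambda>_. 0) = (if A = e j then 1 else 0)" for A j
      using pdsY[of "[j]" A] e by (auto simp: b_def inv_f_f)
    show ?thesis
      unfolding full_rank_def pdY
    proof (intro allI impI)
      fix w :: "'n \<Rightarrow> real" and j assume w: "\<forall>A. (\<Sum>j\<in>UNIV. w j * (if A = e j then 1 else 0)) = 0"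
      have "(\<Sum>i\<in>UNIV. w i * (if e j = e i then 1 else 0)) = (\<Sum>i\<in>UNIV. if i = j then w i else 0)"
        using e by (intro sum.cong) (auto dest: injD)
      then show "w j = 0" using w[rule_format, of "e j"] by simp
    qed
  qed
  obtain \<gamma> W where \<gamma>: "\<gamma> \<in> velocity_maps reg \<A>" "\<gamma> (\<lambda>_. 0) \<in> V0"
    and W: "openin (powertop_real UNIV) W" "(\<lambda>_. 0) \<in> W" "\<forall>t\<in>W. \<forall>A. crd \<phi> \<gamma> A t = Y A t"
    by (rule velocity_map_of_coordinates[OF c V0 Y Y0 rank])
  have "curve_jet s (crd \<phi> \<gamma>) (\<lambda>_. 0) = u"
  proof (rule extensionalityI[OF curve_jet_extensional])
    show "u \<in> extensional (velocity_index s)" using u by (simp add: velocity_image_def)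
    fix a :: "'N \<times> 'n multiset" assume a: "a \<in> velocity_index s"
    have "pds (list_of_mset (snd a)) (crd \<phi> \<gamma> (fst a)) (\<lambda>_. 0) = pds (list_of_mset (snd a)) (Y (fst a)) (\<lambda>_. 0)"
      by (rule pds_cong[OF finite W(1) _ W(2)]) (use W(3) in auto)
    also have "\<dots> = u a"
      using pdsY[of "list_of_mset (snd a)" "fst a"] a by (simp add: b_def)
    finally show "curve_jet s (crd \<phi> \<gamma>) (\<lambda>_. 0) a = u a" using a by (simp add: curve_jet_def)
  qed
  moreover have "velocity_chart_map s \<phi> (jet reg \<A> s \<gamma>) = curve_jet s (crd \<phi> \<gamma>) (\<lambda>_. 0)"
    by (rule velocity_chart_map_jet[OF \<gamma>(1) c subsetD[OF V0(1) \<gamma>(2)]])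
  ultimately show ?thesis
    using velocities_overI[OF \<gamma>, of s] by (metis image_eqI)
qed

lemma velocity_chart_map_image:
  assumes "CARD('n::finite) \<le> CARD('N)" "(V, \<phi>) \<in> \<A>" "V0 \<subseteq> V" "openin (powertop_real UNIV) (\<phi> ` V0)"
  shows "velocity_chart_map s \<phi> ` (velocities_over reg \<A> s V0 :: ('n, 'x) jet set) = velocity_image reg s (\<phi> ` V0)"
  using velocity_chart_map_in_image[OF assms(2,3)] velocity_image_subset[OF assms] by blast

end

section \<open>The Euler-Lagrange form\<close>

text \<open>The weight is the reciprocal of the number of sequences that represent the multiset of
  \<open>J\<close>. A summand depending only on this multiset is thus counted once per
  multiset.\<close>

lemma sum_lists_by_mset:
  fixes h :: "'n::finite multiset \<Rightarrow> real"
  assumes fin: "finite {J :: 'n list. P (length J)}"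
  shows "(\<Sum>J | P (length J). (\<Prod>l\<in>UNIV. fact (count_list J l)) / fact (length J) * h (mset J)) =
    (\<Sum>M | P (size M). h M)"
proof -
  let ?S = "{J :: 'n list. P (length J)}"
  let ?c = "\<lambda>J. (\<Prod>l\<in>UNIV. fact (count_list J l)) / fact (length J) * h (mset J)"
  have img: "{M :: 'n multiset. P (size M)} = mset ` ?S"
  proof (intro set_eqI iffI)
    fix M :: "'n multiset" assume "M \<in> {M. P (size M)}"
    then show "M \<in> mset ` ?S" by (intro image_eqI[of _ _ "list_of_mset M"]) simp_all
  qed auto
  have "(\<Sum>M | P (size M). h M) = (\<Sum>M | P (size M). \<Sum>J | J \<in> ?S \<and> mset J = M. ?c J)"
  proof (rule sum.cong)
    fix M :: "'n multiset" assume M: "M \<in> {M. P (size M)}"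
    then have eq: "{J. J \<in> ?S \<and> mset J = M} = permutations_of_multiset M"
      by (auto simp: permutations_of_multiset_def)
    have "(\<Prod>l\<in>UNIV. fact (count M l)) = (\<Prod>l\<in>set_mset M. fact (count M l) :: real)"
      by (rule prod.mono_neutral_right) (auto simp: not_in_iff)
    moreover have "real (card (permutations_of_multiset M)) * (\<Prod>l\<in>set_mset M. fact (count M l)) = fact (size M)"
      using arg_cong[OF card_permutations_of_multiset_aux[of M], of real] by simp
    ultimately have card: "real (card (permutations_of_multiset M)) * ((\<Prod>l\<in>UNIV. fact (count M l)) / fact (size M)) = 1"
      by simp
    have "(\<Sum>J | J \<in> ?S \<and> mset J = M. ?c J) =
      (\<Sum>J\<in>permutations_of_multiset M. (\<Prod>l\<in>UNIV. fact (count M l)) / fact (size M) * h M)"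
      unfolding eq by (rule sum.cong) (auto simp: permutations_of_multiset_def count_mset)
    also have "\<dots> = h M" using card by (simp add: mult.assoc[symmetric])
    finally show "h M = (\<Sum>J | J \<in> ?S \<and> mset J = M. ?c J)" by simp
  qed simp
  also have "\<dots> = (\<Sum>J\<in>?S. ?c J)"
    by (rule sum.group) (use fin img in auto)
  finally show ?thesis by simp
qed

lemma finite_lists_length_less: "finite {J :: 'n::finite list. length J < s}"
  by (rule finite_subset[OF _ finite_lists_length_le[of UNIV s]]) auto

lemma finite_lists_length_le_UNIV: "finite {J :: 'n::finite list. length J \<le> s}"
  by (rule finite_subset[OF _ finite_lists_length_le[of UNIV s]]) auto

text \<open>\<open>atlas_topology\<close> is given by a predicate on sets, which must first be seen
  to define a topology. Injectivity of the charts enters for intersections.\<close>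

lemma openin_atlas_topology:
  assumes "\<And>c. c \<in> B \<Longrightarrow> is_chart I c"
  shows "openin (atlas_topology I B) W \<longleftrightarrow>
    W \<subseteq> points B \<and> (\<forall>(V, \<phi>)\<in>B. openin (powertop_real I) (\<phi> ` (W \<inter> V)))"
proof -
  let ?P = "\<lambda>W. W \<subseteq> points B \<and> (\<forall>(V, \<phi>)\<in>B. openin (powertop_real I) (\<phi> ` (W \<inter> V)))"
  have "istopology ?P"
    unfolding istopology_def
  proof (intro conjI allI impI)
    fix S T assume S: "?P S" and T: "?P T"
    have "openin (powertop_real I) (\<phi> ` (S \<inter> T \<inter> V))" if c: "(V, \<phi>) \<in> B" for V \<phi>
    proof -
      have "inj_on \<phi> V" using assms[OF c] by (simp add: is_chart_def)
      then have "\<phi> ` ((S \<inter> V) \<inter> (T \<inter> V)) = \<phi> ` (S \<inter> V) \<inter> \<phi> ` (T \<inter> V)"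
        by (rule inj_on_image_Int) auto
      moreover have "openin (powertop_real I) (\<phi> ` (S \<inter> V) \<inter> \<phi> ` (T \<inter> V))"
        using S T c by (intro openin_Int) auto
      ultimately show ?thesis by (simp add: Int_ac)
    qed
    then show "S \<inter> T \<subseteq> points B" "\<forall>(V, \<phi>)\<in>B. openin (powertop_real I) (\<phi> ` (S \<inter> T \<inter> V))"
      using S by blast+
  next
    fix K assume K: "\<forall>S\<in>K. ?P S"
    have "openin (powertop_real I) (\<phi> ` (\<Union>K \<inter> V))" if c: "(V, \<phi>) \<in> B" for V \<phi>
    proof -
      have "\<phi> ` (\<Union>K \<inter> V) = (\<Union>S\<in>K. \<phi> ` (S \<inter> V))" by blast
      moreover have "openin (powertop_real I) (\<Union>S\<in>K. \<phi> ` (S \<inter> V))"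
        by (rule openin_Union) (use K c in auto)
      ultimately show ?thesis by simp
    qed
    then show "\<Union>K \<subseteq> points B" "\<forall>(V, \<phi>)\<in>B. openin (powertop_real I) (\<phi> ` (\<Union>K \<inter> V))"
      using K by blast+
  qed
  then show ?thesis
    unfolding atlas_topology_def by (simp add: topology_inverse')
qed

lemma euler_op_cong:
  fixes y y' :: "'N::finite \<Rightarrow> ('n::finite \<Rightarrow> real) \<Rightarrow> real"
  assumes W: "openin (powertop_real UNIV) W" and eq: "\<And>A t. t \<in> W \<Longrightarrow> y A t = y' A t" and t: "t \<in> W"
  shows "euler_op s y L B t = euler_op s y' L B t"
proof -
  have "curve_jet s y t = curve_jet s y' t" if "t \<in> W" for t
    unfolding curve_jet_def by (intro restrict_ext pds_cong[OF finite W eq that]) simp_all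
  then have "pds J (\<lambda>t. pd a L (curve_jet s y t)) t = pds J (\<lambda>t. pd a L (curve_jet s y' t)) t" for a J
    by (intro pds_cong[OF finite W _ t]) simp_all
  then show ?thesis by (simp add: euler_op_def)
qed

lemma jet_order_le_pd:
  fixes g :: "('N::finite \<times> 'n::finite multiset \<Rightarrow> real) \<Rightarrow> real"
  assumes U: "openin (powertop_real (velocity_index s)) U" and g: "smooth_on (velocity_index s) U g"
    and ord: "jet_order_le k s U g" and a: "a \<in> velocity_index s"
  shows "jet_order_le k s U (pd a g)"
  unfolding jet_order_le_def
proof (intro ballI impI)
  fix b :: "'N \<times> 'n multiset" and u assume b: "b \<in> velocity_index s" "k < size (snd b)" and u: "u \<in> U"
  have "pd b (pd a g) u = pd a (pd b g) u"
    by (rule smooth_on_pd_commute[OF finite_velocity_index U g u b(1) a])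
  also have "\<dots> = pd a (\<lambda>_. 0) u"
    by (rule pd_cong[OF finite_velocity_index U _ u a]) (use ord b in \<open>auto simp: jet_order_le_def\<close>)
  finally show "pd b (pd a g) u = 0" by (simp add: pd_const)
qed

section \<open>The velocity manifold, its overlaps and coordinate vectors\<close>

locale velocity_manifold_dim = velocity_manifold \<A> reg
  for \<A> :: "('x, 'N::finite) chart set" and reg :: bool +
  fixes source :: "'n::finite itself"
  assumes dim: "CARD('n) \<le> CARD('N)"
begin

abbreviation vel_over :: "nat \<Rightarrow> 'x set \<Rightarrow> ('n, 'x) jet set" where
  "vel_over s V \<equiv> velocities_over reg \<A> s V"

abbreviation vel_inv :: "nat \<Rightarrow> 'x set \<Rightarrow> ('x \<Rightarrow> 'N \<Rightarrow> real) \<Rightarrow> ('N \<times> 'n multiset \<Rightarrow> real) \<Rightarrow> ('n, 'x) jet" where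
  "vel_inv s V \<phi> \<equiv> inv_into (vel_over s V) (velocity_chart_map s \<phi>)"

abbreviation vel_atlas :: "nat \<Rightarrow> (('n, 'x) jet, 'N \<times> 'n multiset) chart set" where
  "vel_atlas s \<equiv> velocity_atlas reg \<A> s"

abbreviation vel_index :: "nat \<Rightarrow> ('N \<times> 'n multiset) set" where
  "vel_index s \<equiv> velocity_index s"

abbreviation vel_image :: "nat \<Rightarrow> ('N \<Rightarrow> real) set \<Rightarrow> ('N \<times> 'n multiset \<Rightarrow> real) set" where
  "vel_image s X \<equiv> velocity_image reg s X"

lemma vel_image_open:
  "(V, \<phi>) \<in> \<A> \<Longrightarrow> openin (powertop_real (vel_index s)) (vel_image s (\<phi> ` V))"
  by (intro openin_velocity_image openin_chart)

lemma vel_image_overlap_open: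
  "(V, \<phi>) \<in> \<A> \<Longrightarrow> (V', \<psi>) \<in> \<A> \<Longrightarrow> openin (powertop_real (vel_index s)) (vel_image s (\<phi> ` (V \<inter> V')))"
  by (intro openin_velocity_image openin_overlap)

lemma chart_map_vel_over:
  "(V, \<phi>) \<in> \<A> \<Longrightarrow> p \<in> vel_over s V \<Longrightarrow> velocity_chart_map s \<phi> p \<in> vel_image s (\<phi> ` V)"
  using velocity_chart_map_in_image by blast

lemma vel_image_eq: "(V, \<phi>) \<in> \<A> \<Longrightarrow> velocity_chart_map s \<phi> ` vel_over s V = vel_image s (\<phi> ` V)"
  by (rule velocity_chart_map_image[OF dim _ subset_refl openin_chart])

lemma vel_inv_chart_map: "(V, \<phi>) \<in> \<A> \<Longrightarrow> p \<in> vel_over s V \<Longrightarrow> vel_inv s V \<phi> (velocity_chart_map s \<phi> p) = p"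
  by (rule inv_into_f_f[OF inj_on_velocity_chart_map])

lemma chart_map_vel_inv:
  assumes "(V, \<phi>) \<in> \<A>" "u \<in> vel_image s (\<phi> ` V)"
  shows "velocity_chart_map s \<phi> (vel_inv s V \<phi> u) = u" "vel_inv s V \<phi> u \<in> vel_over s V"
  using assms(2) f_inv_into_f[of u "velocity_chart_map s \<phi>" "vel_over s V"]
    inv_into_into[of u "velocity_chart_map s \<phi>" "vel_over s V"]
  unfolding vel_image_eq[OF assms(1), symmetric] by simp_all

text \<open>Surjectivity over the intersection yields a jet over both domains at once, so that
  inverse charts can be eliminated on overlaps.\<close>

lemma vel_inv_overlap:
  assumes c: "(V, \<phi>) \<in> \<A>" and d: "(V', \<psi>) \<in> \<A>" and u: "u \<in> vel_image s (\<phi> ` (V \<inter> V'))"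
  obtains p where "p \<in> vel_over s V" "p \<in> vel_over s V'" "u = velocity_chart_map s \<phi> p" "vel_inv s V \<phi> u = p"
proof -
  obtain p where p: "u = velocity_chart_map s \<phi> p" "p \<in> vel_over s (V \<inter> V')"
    using velocity_image_subset[OF dim c Int_lower1 openin_overlap[OF c d] u] by blast
  then have "p \<in> vel_over s V" "p \<in> vel_over s V'" by (auto simp flip: velocities_over_Int)
  then show thesis using p(1) vel_inv_chart_map[OF c] by (intro that[of p]) auto
qed

lemma velocity_chart_map_0:
  fixes p :: "('n, 'x) jet" and \<phi> :: "'x \<Rightarrow> 'N \<Rightarrow> real"
  shows "velocity_chart_map s \<phi> p (A, {#}) = \<phi> (representative p (\<lambda>_. 0)) A"
  by (simp add: velocity_chart_map_eq curve_jet_def)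

lemma mem_vel_atlas: "c \<in> vel_atlas s \<longleftrightarrow> (\<exists>V \<phi>. (V, \<phi>) \<in> \<A> \<and> c = (vel_over s V, velocity_chart_map s \<phi>))"
  unfolding velocity_atlas_def velocity_chart_def by force

lemma is_chart_vel_atlas: "c \<in> vel_atlas s \<Longrightarrow> is_chart (vel_index s) c"
  using inj_on_velocity_chart_map vel_image_eq vel_image_open by (auto simp: mem_vel_atlas is_chart_def)

lemma chart_map_image_Int:
  assumes c: "(V, \<phi>) \<in> \<A>" and d: "(V', \<psi>) \<in> \<A>"
  shows "velocity_chart_map s \<psi> ` (vel_over s V \<inter> vel_over s V') = vel_image s (\<psi> ` (V' \<inter> V))"
  unfolding velocities_over_Int Int_commute[of V V']
  by (rule velocity_chart_map_image[OF dim d Int_lower1 openin_overlap[OF d c]])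

lemma openin_vel_over:
  assumes c: "(V, \<phi>) \<in> \<A>"
  shows "openin (atlas_topology (vel_index s) (vel_atlas s)) (vel_over s V)"
proof (rule openin_atlas_topology[THEN iffD2], erule is_chart_vel_atlas, intro conjI ballI)
  show "vel_over s V \<subseteq> points (vel_atlas s)"
    using c unfolding points_def by (force simp: mem_vel_atlas)
  fix d assume "d \<in> vel_atlas s"
  then obtain V' \<psi> where d: "(V', \<psi>) \<in> \<A>" "d = (vel_over s V', velocity_chart_map s \<psi>)"
    by (auto simp: mem_vel_atlas)
  show "case d of (V', \<psi>) \<Rightarrow> openin (powertop_real (vel_index s)) (\<psi> ` (vel_over s V \<inter> V'))"
    unfolding d(2) prod.case chart_map_image_Int[OF c d(1)] by (rule vel_image_overlap_open[OF d(1) c])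
qed

lemma velocity_coord_vel_inv:
  assumes c: "(V, \<phi>) \<in> \<A>" and d: "(V', \<psi>) \<in> \<A>" and u: "u \<in> vel_image s (\<psi> ` (V' \<inter> V))"
  shows "velocity_coord \<phi> A [] (vel_inv s V' \<psi> u) = lift0 (transition_map V' \<psi> \<phi> A) u"
proof -
  obtain p where p: "p \<in> vel_over s V'" "p \<in> vel_over s V" "u = velocity_chart_map s \<psi> p" "vel_inv s V' \<psi> u = p"
    using vel_inv_overlap[OF d c u] .
  have "lift0 (transition_map V' \<psi> \<phi> A) u = transition_map V' \<psi> \<phi> A (\<psi> (representative p (\<lambda>_. 0)))"
    unfolding lift0_def p(3) velocity_chart_map_0 ..
  also have "\<dots> = \<phi> (representative p (\<lambda>_. 0)) A"
    by (rule transition_map_apply[OF d velocities_overD(2)[OF p(1)]])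
  finally show ?thesis unfolding p(4) by (simp add: velocity_coord_def)
qed

lemma smooth_on_lift0_transition_map:
  assumes c: "(V, \<phi>) \<in> \<A>" and d: "(V', \<psi>) \<in> \<A>"
  shows "smooth_on (vel_index s) (vel_image s (\<psi> ` (V' \<inter> V))) (lift0 (transition_map V' \<psi> \<phi> A))"
  by (rule smooth_on_subset[OF smooth_on_lift0[OF openin_overlap[OF d c] smooth_on_transition_map[OF d c]]])
    (auto simp: velocity_image_def)

text \<open>Without this, tangent vectors would take their dummy value 0 on x^A. In another velocity
  chart x^A is a lifted transition function, which is smooth.\<close>

lemma smooth_near_velocity_coord:
  assumes c: "(V, \<phi>) \<in> \<A>" and p: "p \<in> vel_over s V"
  shows "smooth_near (vel_index s) (vel_atlas s) p (velocity_coord \<phi> A [])"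
  unfolding smooth_near_def
proof (intro exI[of _ "vel_over s V"] conjI ballI openin_vel_over[OF c] p)
  fix d assume "d \<in> vel_atlas s"
  then obtain V' \<psi> where d: "(V', \<psi>) \<in> \<A>" "d = (vel_over s V', velocity_chart_map s \<psi>)"
    by (auto simp: mem_vel_atlas)
  have "smooth_on (vel_index s) (vel_image s (\<psi> ` (V' \<inter> V))) (\<lambda>u. velocity_coord \<phi> A [] (vel_inv s V' \<psi> u))"
    by (rule smooth_on_cong[OF finite_velocity_index vel_image_overlap_open[OF d(1) c]
          velocity_coord_vel_inv[OF c d(1), symmetric] smooth_on_lift0_transition_map[OF c d(1)]])
  then show "case d of (V', \<psi>) \<Rightarrow> smooth_on (vel_index s) (\<psi> ` (vel_over s V \<inter> V'))
      (\<lambda>u. velocity_coord \<phi> A [] (inv_into V' \<psi> u))"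
    unfolding d(2) prod.case chart_map_image_Int[OF c d(1)] .
qed

text \<open>x^A lives on the base, so only coordinate vectors of order 0 see it, and these produce
  the Jacobian of the base charts.\<close>

lemma coord_vector_velocity_coord:
  assumes c: "(V, \<phi>) \<in> \<A>" and d: "(V', \<psi>) \<in> \<A>" and p: "p \<in> vel_over s V" "p \<in> vel_over s V'"
    and a: "a \<in> vel_index s"
  shows "coord_vector (vel_index s) (vel_atlas s) (vel_over s V', velocity_chart_map s \<psi>) a p (velocity_coord \<phi> A []) =
    (if snd a = {#} then pd (fst a) (transition_map V' \<psi> \<phi> A) (\<psi> (representative p (\<lambda>_. 0))) else 0)"
proof -
  have u: "velocity_chart_map s \<psi> p \<in> vel_image s (\<psi> ` (V' \<inter> V))"
    using p unfolding chart_map_image_Int[OF c d, symmetric] by blast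
  have "pd a (\<lambda>u. velocity_coord \<phi> A [] (vel_inv s V' \<psi> u)) (velocity_chart_map s \<psi> p) =
    pd a (lift0 (transition_map V' \<psi> \<phi> A)) (velocity_chart_map s \<psi> p)"
    by (rule pd_cong[OF finite_velocity_index vel_image_overlap_open[OF d c] velocity_coord_vel_inv[OF c d] u a])
  then show ?thesis
    using smooth_near_velocity_coord[OF c p(1)]
    by (simp add: coord_vector_def coord_deriv_def pd_lift0 lift0_def velocity_chart_map_0)
qed

lemma vel_deriv_eq:
  "vel_deriv reg \<A> s (V, \<phi>) A J F q =
    (\<Prod>l\<in>UNIV. fact (count_list J l)) / fact (length J) *
    pd (A, mset J) (\<lambda>u. F (vel_inv s V \<phi> u)) (velocity_chart_map s \<phi> q)"
  by (simp add: vel_deriv_def coord_deriv_def velocity_chart_def)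

lemma velocity_coord_eq:
  assumes c: "(V, \<phi>) \<in> \<A>" and q: "q \<in> vel_over s V" and J: "length J \<le> s"
  shows "velocity_coord \<phi> A J q = velocity_chart_map s \<phi> q (A, mset J)"
proof -
  let ?\<gamma> = "representative q"
  obtain W where W: "openin (powertop_real UNIV) W" "(\<lambda>_. 0) \<in> W" "?\<gamma> ` W \<subseteq> V"
    "\<forall>A. smooth_on UNIV W (crd \<phi> ?\<gamma> A)"
    using velocity_map_chart[OF velocities_overD(1)[OF q] c velocities_overD(2)[OF q]]
    by (elim exE conjE) (rule that)
  show ?thesis
    unfolding velocity_chart_map_eq velocity_coord_def
    by (rule curve_jet_mset[where y = "crd \<phi> ?\<gamma>", OF W(1) W(4)[rule_format] W(2) J, symmetric])
qed

text \<open>Apart from the combinatorial weight, the summand depends on \<open>J\<close> only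
  through \<open>mset J\<close>, so the weighted sum over sequences collapses to multisets.\<close>

lemma formal_deriv_eq:
  assumes c: "(V, \<phi>) \<in> \<A>" and q: "q \<in> vel_over s V"
  shows "formal_deriv reg \<A> s (V, \<phi>) i F q = total_deriv s i (\<lambda>u. F (vel_inv s V \<phi> u)) (velocity_chart_map s \<phi> q)"
proof -
  let ?u = "velocity_chart_map s \<phi> q"
  let ?D = "\<lambda>A M. ?u (A, add_mset i M) * pd (A, M) (\<lambda>u. F (vel_inv s V \<phi> u)) ?u"
  have "formal_deriv reg \<A> s (V, \<phi>) i F q =
    (\<Sum>A\<in>UNIV. \<Sum>J | length J < s. (\<Prod>l\<in>UNIV. fact (count_list J l)) / fact (length J) * ?D A (mset J))"
    unfolding formal_deriv_def
  proof (intro sum.cong refl)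
    fix A and J :: "'n list" assume "J \<in> {J. length J < s}"
    then have "velocity_coord \<phi> A (i # J) q = ?u (A, add_mset i (mset J))"
      using velocity_coord_eq[OF c q, of "i # J" A] by simp
    then show "velocity_coord (snd (V, \<phi>)) A (i # J) q * vel_deriv reg \<A> s (V, \<phi>) A J F q =
      (\<Prod>l\<in>UNIV. fact (count_list J l)) / fact (length J) * ?D A (mset J)"
      by (simp add: vel_deriv_eq)
  qed
  also have "\<dots> = (\<Sum>A\<in>UNIV. \<Sum>M | size M < s. ?D A M)"
    by (intro sum.cong refl sum_lists_by_mset finite_lists_length_less)
  also have "\<dots> = (\<Sum>a\<in>UNIV \<times> {M. size M < s}. ?D (fst a) (snd a))"
    by (simp add: sum.cartesian_product case_prod_beta)
  also have "UNIV \<times> {M. size M < s} = {a :: 'N \<times> 'n multiset. size (snd a) < s}" by auto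
  finally show ?thesis by (simp add: total_deriv_def)
qed

lemma formal_derivs_eq:
  assumes c: "(V, \<phi>) \<in> \<A>" and q: "q \<in> vel_over s V"
  shows "formal_derivs reg \<A> s (V, \<phi>) J F q = total_derivs s J (\<lambda>u. F (vel_inv s V \<phi> u)) (velocity_chart_map s \<phi> q)"
  using q
proof (induction J arbitrary: q)
  case Nil
  then show ?case by (simp add: formal_derivs_def vel_inv_chart_map[OF c])
next
  case (Cons i J)
  have "formal_derivs reg \<A> s (V, \<phi>) (i # J) F q =
    total_deriv s i (\<lambda>u. formal_derivs reg \<A> s (V, \<phi>) J F (vel_inv s V \<phi> u)) (velocity_chart_map s \<phi> q)"
    using formal_deriv_eq[OF c Cons.prems, of i "formal_derivs reg \<A> s (V, \<phi>) J F"]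
    by (simp add: formal_derivs_def)
  also have "\<dots> = total_deriv s i (total_derivs s J (\<lambda>u. F (vel_inv s V \<phi> u))) (velocity_chart_map s \<phi> q)"
    by (rule total_deriv_cong[OF vel_image_open[OF c] _ chart_map_vel_over[OF c Cons.prems]])
      (simp add: Cons.IH chart_map_vel_inv[OF c])
  finally show ?case by simp
qed

section \<open>The Lagrangian in charts and covariance of the Euler-Lagrange expressions\<close>

context
  fixes r s :: nat and L :: "('n, 'x) jet \<Rightarrow> real"
  assumes L: "smooth_function (vel_index r) (vel_atlas r) L" and rs: "2 * r \<le> s"
begin

definition Lloc :: "'x set \<Rightarrow> ('x \<Rightarrow> 'N \<Rightarrow> real) \<Rightarrow> ('N \<times> 'n multiset \<Rightarrow> real) \<Rightarrow> real" where
  "Lloc V \<phi> u = L (jet_proj reg \<A> r (vel_inv s V \<phi> u))"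

text \<open>In induced charts the projection of jets just forgets the coordinates of order above
  \<open>r\<close>.\<close>

lemma Lloc_eq:
  assumes c: "(V, \<phi>) \<in> \<A>" and u: "u \<in> vel_image s (\<phi> ` V)"
  shows "(\<lambda>a\<in>vel_index r. u a) \<in> vel_image r (\<phi> ` V)" "Lloc V \<phi> u = L (vel_inv r V \<phi> (\<lambda>a\<in>vel_index r. u a))"
proof -
  let ?q = "vel_inv s V \<phi> u"
  note q = chart_map_vel_inv[OF c u]
  note \<gamma> = velocities_overD(1,2)[OF q(2)]
  have j: "jet_proj reg \<A> r ?q \<in> vel_over r V"
    unfolding jet_proj_def by (rule velocities_overI[OF \<gamma>])
  have "velocity_chart_map r \<phi> (jet_proj reg \<A> r ?q) = curve_jet r (crd \<phi> (representative ?q)) (\<lambda>_. 0)"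
    unfolding jet_proj_def by (rule velocity_chart_map_jet[OF \<gamma>(1) c \<gamma>(2)])
  also have "\<dots> = (\<lambda>a\<in>vel_index r. velocity_chart_map s \<phi> ?q a)"
    unfolding velocity_chart_map_eq curve_jet_def using rs by (intro restrict_ext) auto
  finally have eq: "velocity_chart_map r \<phi> (jet_proj reg \<A> r ?q) = (\<lambda>a\<in>vel_index r. u a)"
    unfolding q(1) .
  show "(\<lambda>a\<in>vel_index r. u a) \<in> vel_image r (\<phi> ` V)"
    using chart_map_vel_over[OF c j] unfolding eq .
  show "Lloc V \<phi> u = L (vel_inv r V \<phi> (\<lambda>a\<in>vel_index r. u a))"
    using vel_inv_chart_map[OF c j] unfolding eq by (simp only: Lloc_def)
qed

lemma smooth_on_Lloc:
  assumes c: "(V, \<phi>) \<in> \<A>"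
  shows "smooth_on (vel_index s) (vel_image s (\<phi> ` V)) (Lloc V \<phi>)"
proof -
  have "smooth_on (vel_index r) (vel_image r (\<phi> ` V)) (\<lambda>u. L (vel_inv r V \<phi> u))"
  proof -
    have "(vel_over r V, velocity_chart_map r \<phi>) \<in> vel_atlas r" using c by (auto simp: mem_vel_atlas)
    then show ?thesis using L unfolding smooth_function_def vel_image_eq[OF c, symmetric] by blast
  qed
  then have "smooth_on (vel_index s) (vel_image s (\<phi> ` V)) (\<lambda>u. L (vel_inv r V \<phi> (\<lambda>a\<in>vel_index r. u a)))"
    by (rule smooth_on_compose[OF finite_velocity_index vel_image_open[OF c] finite_velocity_index vel_image_open[OF c],
        where g = "\<lambda>a u. u a"]) (use rs Lloc_eq(1)[OF c] in \<open>auto intro!: smooth_on_coord simp del: restrict_apply\<close>)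
  then show ?thesis
    by (rule smooth_on_cong[OF finite_velocity_index vel_image_open[OF c] Lloc_eq(2)[OF c, symmetric], rotated])
qed

lemma jet_order_le_Lloc:
  assumes c: "(V, \<phi>) \<in> \<A>"
  shows "jet_order_le r s (vel_image s (\<phi> ` V)) (Lloc V \<phi>)"
  unfolding jet_order_le_def
proof (intro ballI impI)
  fix a :: "'N \<times> 'n multiset" and u
  assume a: "a \<in> vel_index s" "r < size (snd a)" and u: "u \<in> vel_image s (\<phi> ` V)"
  have "(\<lambda>b\<in>vel_index r. (u(a := h)) b) = (\<lambda>b\<in>vel_index r. u b)" for h
    using a(2) by (intro restrict_ext) auto
  then have "pd a (\<lambda>u. L (vel_inv r V \<phi> (\<lambda>b\<in>vel_index r. u b))) u = 0"
    by (simp only: pd_def deriv_const)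
  then show "pd a (Lloc V \<phi>) u = 0"
    using pd_cong[OF finite_velocity_index vel_image_open[OF c] Lloc_eq(2)[OF c] u a(1)] by simp
qed

abbreviation EL :: "'x set \<Rightarrow> ('x \<Rightarrow> 'N \<Rightarrow> real) \<Rightarrow> 'N \<Rightarrow> ('n, 'x) jet \<Rightarrow> real" where
  "EL V \<phi> \<equiv> euler_lagrange reg \<A> r s L (V, \<phi>)"

definition ELterm :: "'x set \<Rightarrow> ('x \<Rightarrow> 'N \<Rightarrow> real) \<Rightarrow> 'N \<Rightarrow> 'n list \<Rightarrow> ('N \<times> 'n multiset \<Rightarrow> real) \<Rightarrow> real" where
  "ELterm V \<phi> A J u = (\<Prod>l\<in>UNIV. fact (count_list J l)) / fact (length J) * pd (A, mset J) (Lloc V \<phi>) u"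

lemma smooth_on_ELterm:
  assumes c: "(V, \<phi>) \<in> \<A>" and J: "length J \<le> r"
  shows "smooth_on (vel_index s) (vel_image s (\<phi> ` V)) (ELterm V \<phi> A J)"
  unfolding ELterm_def[abs_def]
  using rs J by (intro smooth_on_mult smooth_on_const smooth_on_pd[OF smooth_on_Lloc[OF c]]
      finite_velocity_index vel_image_open[OF c]) simp

lemma EL_eq:
  assumes c: "(V, \<phi>) \<in> \<A>" and q: "q \<in> vel_over s V"
  shows "EL V \<phi> A q = (\<Sum>J | length J \<le> r. (-1) ^ length J * total_derivs s J (ELterm V \<phi> A J) (velocity_chart_map s \<phi> q))"
  unfolding euler_lagrange_def
proof (intro sum.cong refl arg_cong2[of _ _ _ _ "(*)"])
  fix J :: "'n list"
  show "formal_derivs reg \<A> s (V, \<phi>) J (vel_deriv reg \<A> s (V, \<phi>) A J (\<lambda>q. L (jet_proj reg \<A> r q))) q =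
    total_derivs s J (ELterm V \<phi> A J) (velocity_chart_map s \<phi> q)"
    unfolding formal_derivs_eq[OF c q] vel_deriv_eq
    by (rule total_derivs_cong[OF vel_image_open[OF c] _ chart_map_vel_over[OF c q]])
      (simp add: chart_map_vel_inv[OF c] ELterm_def Lloc_def[abs_def])
qed

lemma smooth_on_EL:
  assumes c: "(V, \<phi>) \<in> \<A>"
  shows "smooth_on (vel_index s) (vel_image s (\<phi> ` V)) (\<lambda>u. EL V \<phi> A (vel_inv s V \<phi> u))"
proof (rule smooth_on_cong[OF finite_velocity_index vel_image_open[OF c]])
  show "smooth_on (vel_index s) (vel_image s (\<phi> ` V))
    (\<lambda>u. \<Sum>J | length J \<le> r. (-1) ^ length J * total_derivs s J (ELterm V \<phi> A J) u)"
    by (intro smooth_on_sum smooth_on_mult smooth_on_const smooth_on_total_derivs smooth_on_ELterm[OF c]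
        finite_velocity_index vel_image_open[OF c]) simp
qed (simp add: EL_eq[OF c] chart_map_vel_inv[OF c])

text \<open>A derivative of the Lagrangian by a jet coordinate has order at most \<open>r\<close>,
  and at most \<open>r\<close> formal derivatives follow; since \<open>2 * r \<le> s\<close> they
  are all true derivatives along a representative curve. After reordering \<open>J\<close>, the
  weighted sum over sequences becomes the sum over multisets.\<close>

lemma EL_eq_euler_op:
  assumes c: "(V, \<phi>) \<in> \<A>" and q: "q \<in> vel_over s V"
  shows "EL V \<phi> A q = euler_op s (crd \<phi> (representative q)) (Lloc V \<phi>) A (\<lambda>_. 0)"
proof -
  let ?\<gamma> = "representative q"
  let ?y = "crd \<phi> ?\<gamma>"
  let ?U = "vel_image s (\<phi> ` V)"
  obtain W where W: "openin (powertop_real UNIV) W" "(\<lambda>_. 0) \<in> W" "?\<gamma> ` W \<subseteq> V"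
    "\<forall>A. smooth_on UNIV W (crd \<phi> ?\<gamma> A)" "reg \<longrightarrow> (\<forall>t\<in>W. full_rank (\<lambda>A j. pd j (crd \<phi> ?\<gamma> A) t))"
    using velocity_map_chart[OF velocities_overD(1)[OF q] c velocities_overD(2)[OF q]]
    by (elim exE conjE) (rule that)
  note y = W(4)[rule_format]
  note U = vel_image_open[OF c, of s]
  have yU: "curve_jet s ?y t \<in> ?U" if "t \<in> W" for t
    by (rule in_velocity_imageI[OF W(1) y that]) (use W(3,5) that in auto)
  let ?h = "\<lambda>M. pds (list_of_mset M) (\<lambda>t. pd (A, M) (Lloc V \<phi>) (curve_jet s ?y t)) (\<lambda>_. 0)"
  have sm: "smooth_on UNIV W (\<lambda>t. pd (A, M) (Lloc V \<phi>) (curve_jet s ?y t))" if "size M \<le> s" for M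
    using that by (intro smooth_on_along_curve[OF W(1) y U yU smooth_on_pd[OF smooth_on_Lloc[OF c]]]) simp_all
  have "EL V \<phi> A q = (\<Sum>J | length J \<le> r.
    (\<Prod>l\<in>UNIV. fact (count_list J l)) / fact (length J) * ((-1) ^ size (mset J) * ?h (mset J)))"
    unfolding EL_eq[OF c q]
  proof (rule sum.cong)
    fix J :: "'n list" assume "J \<in> {J. length J \<le> r}"
    then have J: "length J \<le> r" by simp
    then have a: "(A, mset J) \<in> vel_index s" using rs by simp
    let ?k = "(\<Prod>l\<in>UNIV. fact (count_list J l)) / fact (length J) :: real"
    have "jet_order_le r s ?U (\<lambda>u. ?k * pd (A, mset J) (Lloc V \<phi>) u)"
      unfolding jet_order_le_def
    proof (intro ballI impI)
      fix b :: "'N \<times> 'n multiset" and u assume b: "b \<in> vel_index s" "r < size (snd b)" and u: "u \<in> ?U"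
      have "pd b (pd (A, mset J) (Lloc V \<phi>)) u = 0"
        using jet_order_le_pd[OF U smooth_on_Lloc[OF c] jet_order_le_Lloc[OF c] a] b u
        unfolding jet_order_le_def by blast
      then show "pd b (\<lambda>u. ?k * pd (A, mset J) (Lloc V \<phi>) u) u = 0"
        using pds_cmult[OF finite_velocity_index U smooth_on_pd[OF smooth_on_Lloc[OF c] a] u, of "[b]" ?k] b(1)
        by simp
    qed
    then have ord: "jet_order_le r s ?U (ELterm V \<phi> A J)" by (simp only: ELterm_def[abs_def])
    have "total_derivs s J (ELterm V \<phi> A J) (velocity_chart_map s \<phi> q) =
      pds J (\<lambda>t. ELterm V \<phi> A J (curve_jet s ?y t)) (\<lambda>_. 0)"
      unfolding velocity_chart_map_eq
      by (rule pds_along_curve[OF W(1) y U yU smooth_on_ELterm[OF c J] ord W(2), symmetric]) (use J rs in simp_all)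
    also have "\<dots> = ?k * pds J (\<lambda>t. pd (A, mset J) (Lloc V \<phi>) (curve_jet s ?y t)) (\<lambda>_. 0)"
      unfolding ELterm_def by (rule pds_cmult[OF finite W(1) sm W(2)]) (use a in simp_all)
    also have "pds J (\<lambda>t. pd (A, mset J) (Lloc V \<phi>) (curve_jet s ?y t)) (\<lambda>_. 0) = ?h (mset J)"
      by (rule pds_mset_cong[OF finite W(1) sm W(2)]) (use a in simp_all)
    finally show "(-1) ^ length J * total_derivs s J (ELterm V \<phi> A J) (velocity_chart_map s \<phi> q) =
      ?k * ((-1) ^ size (mset J) * ?h (mset J))" by simp
  qed simp
  also have "\<dots> = (\<Sum>M | size M \<le> r. (-1) ^ size M * ?h M)"
    by (rule sum_lists_by_mset[OF finite_lists_length_le_UNIV])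
  \<comment> \<open>The additional terms differentiate the Lagrangian by coordinates of order above
    \<open>r\<close> and hence vanish along the whole curve.\<close>
  also have "\<dots> = (\<Sum>M | size M \<le> s. (-1) ^ size M * ?h M)"
  proof (rule sum.mono_neutral_left)
    show "\<forall>M\<in>{M. size M \<le> s} - {M. size M \<le> r}. (-1) ^ size M * ?h M = 0"
    proof
      fix M :: "'n multiset" assume M: "M \<in> {M. size M \<le> s} - {M. size M \<le> r}"
      have "?h M = pds (list_of_mset M) (\<lambda>_. 0) (\<lambda>_ :: 'n. 0)"
        by (rule pds_cong[OF finite W(1) _ W(2)])
          (use M jet_order_le_Lloc[OF c] yU in \<open>auto simp: jet_order_le_def\<close>)
      then show "(-1) ^ size M * ?h M = 0" by (simp add: pds_zero)
    qed
  qed (use rs in \<open>auto simp: finite_multisets_size_le\<close>)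
  finally show ?thesis by (simp add: euler_op_def)
qed

text \<open>Both sides are evaluated on one representative of \<open>p\<close>. The map
  \<open>?F\<close> leads from \<open>\<psi>\<close> to \<open>\<phi>\<close>, so its Jacobian
  carries the components from \<open>\<phi>\<close> back to \<open>\<psi>\<close>.\<close>

lemma EL_transform:
  assumes c: "(V, \<phi>) \<in> \<A>" and d: "(V', \<psi>) \<in> \<A>" and p: "p \<in> vel_over s V" "p \<in> vel_over s V'"
  shows "EL V' \<psi> B p = (\<Sum>A\<in>UNIV. EL V \<phi> A p * pd B (transition_map V' \<psi> \<phi> A) (\<psi> (representative p (\<lambda>_. 0))))"
proof -
  let ?\<gamma> = "representative p"
  have \<gamma>0: "?\<gamma> (\<lambda>_. 0) \<in> V" "?\<gamma> (\<lambda>_. 0) \<in> V'" using velocities_overD(2) p by blast+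
  obtain W1 where W1: "openin (powertop_real UNIV) W1" "(\<lambda>_. 0) \<in> W1" "?\<gamma> ` W1 \<subseteq> V"
    using velocity_map_chart[OF velocities_overD(1)[OF p(1)] c \<gamma>0(1)] by (elim exE conjE) (rule that)
  obtain W2 where W2: "openin (powertop_real UNIV) W2" "(\<lambda>_. 0) \<in> W2" "?\<gamma> ` W2 \<subseteq> V'"
    "\<forall>A. smooth_on UNIV W2 (crd \<psi> ?\<gamma> A)" "reg \<longrightarrow> (\<forall>t\<in>W2. full_rank (\<lambda>A j. pd j (crd \<psi> ?\<gamma> A) t))"
    using velocity_map_chart[OF velocities_overD(1)[OF p(2)] d \<gamma>0(2)] by (elim exE conjE) (rule that)
  let ?W = "W1 \<inter> W2"
  let ?F = "transition_map V' \<psi> \<phi>"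
  have W: "openin (powertop_real UNIV) ?W" using W1(1) W2(1) by (rule openin_Int)
  have 0: "(\<lambda>_. 0) \<in> ?W" using W1(2) W2(2) by simp
  have y: "smooth_on UNIV ?W (crd \<psi> ?\<gamma> A)" for A by (rule smooth_on_subset[OF W2(4)[rule_format]]) blast
  have yU: "curve_jet s (crd \<psi> ?\<gamma>) t \<in> vel_image s (\<psi> ` (V' \<inter> V))" if "t \<in> ?W" for t
    by (rule in_velocity_imageI[OF W y that]) (use W1(3) W2(3,5) that in auto)
  \<comment> \<open>The prolonged base transition is the transition of the velocity charts, and it
    relates the two local forms of the Lagrangian.\<close>
  have trans: "jet_transition s ?F u = velocity_chart_map s \<phi> (vel_inv s V' \<psi> u)"
    "Lloc V' \<psi> u = Lloc V \<phi> (jet_transition s ?F u)" "jet_transition s ?F u \<in> vel_image s (\<phi> ` V)"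
    if u: "u \<in> vel_image s (\<psi> ` (V' \<inter> V))" for u
  proof -
    obtain q where q: "q \<in> vel_over s V'" "q \<in> vel_over s V" "u = velocity_chart_map s \<psi> q" "vel_inv s V' \<psi> u = q"
      using vel_inv_overlap[OF d c u] .
    have "jet_transition s ?F (velocity_chart_map s \<psi> q) = velocity_chart_map s \<phi> q"
      unfolding jet_transition_def velocity_chart_map_eq curve_jet_def[of s "crd \<phi> (representative q)"]
      by (rule restrict_ext, rule pds_chart_change[OF velocities_overD(1)[OF q(1)] d c
            velocities_overD(2)[OF q(1)] velocities_overD(2)[OF q(2)], symmetric]) simp
    then show *: "jet_transition s ?F u = velocity_chart_map s \<phi> (vel_inv s V' \<psi> u)"
      unfolding q(4) q(3)[symmetric] .
    show "jet_transition s ?F u \<in> vel_image s (\<phi> ` V)"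
      unfolding * q(4) by (rule chart_map_vel_over[OF c q(2)])
    show "Lloc V' \<psi> u = Lloc V \<phi> (jet_transition s ?F u)"
      unfolding Lloc_def * q(4) vel_inv_chart_map[OF c q(2)] ..
  qed
  have "EL V' \<psi> B p = euler_op s (crd \<psi> ?\<gamma>) (Lloc V' \<psi>) B (\<lambda>_. 0)"
    by (rule EL_eq_euler_op[OF d p(2)])
  also have "\<dots> = (\<Sum>A\<in>UNIV. euler_op s (\<lambda>A t. ?F A (\<lambda>C. crd \<psi> ?\<gamma> C t)) (Lloc V \<phi>) A (\<lambda>_. 0) *
      pd B (?F A) (\<lambda>C. crd \<psi> ?\<gamma> C (\<lambda>_. 0)))"
    by (rule euler_op_transform[OF W y openin_overlap[OF d c] smooth_on_transition_map[OF d c]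
          vel_image_overlap_open[OF d c] _ yU vel_image_open[OF c] smooth_on_Lloc[OF c] trans(3) trans(2) 0])
      (auto simp: velocity_image_def)
  also have "\<dots> = (\<Sum>A\<in>UNIV. EL V \<phi> A p * pd B (?F A) (\<psi> (?\<gamma> (\<lambda>_. 0))))"
  proof (intro sum.cong refl)
    fix A
    have "euler_op s (\<lambda>A t. ?F A (\<lambda>C. crd \<psi> ?\<gamma> C t)) (Lloc V \<phi>) A (\<lambda>_. 0) =
      euler_op s (crd \<phi> ?\<gamma>) (Lloc V \<phi>) A (\<lambda>_. 0)"
      by (rule euler_op_cong[OF W _ 0]) (use W2(3) transition_map_apply[OF d] in auto)
    then show "euler_op s (\<lambda>A t. ?F A (\<lambda>C. crd \<psi> ?\<gamma> C t)) (Lloc V \<phi>) A (\<lambda>_. 0) *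
        pd B (?F A) (\<lambda>C. crd \<psi> ?\<gamma> C (\<lambda>_. 0)) = EL V \<phi> A p * pd B (?F A) (\<psi> (?\<gamma> (\<lambda>_. 0)))"
      by (simp add: EL_eq_euler_op[OF c p(1)])
  qed
  finally show ?thesis .
qed

section \<open>Gluing the local expressions to a 1-form\<close>

lemma EL_pairing:
  assumes c: "(V, \<phi>) \<in> \<A>" and d: "(V', \<psi>) \<in> \<A>" and p: "p \<in> vel_over s V" "p \<in> vel_over s V'"
    and v: "\<And>f. v f = (\<Sum>i\<in>vel_index s. a i *
      coord_vector (vel_index s) (vel_atlas s) (vel_over s V', velocity_chart_map s \<psi>) i p f)"
  shows "(\<Sum>A\<in>UNIV. EL V \<phi> A p * v (velocity_coord \<phi> A [])) = (\<Sum>B\<in>UNIV. a (B, {#}) * EL V' \<psi> B p)"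
proof -
  let ?J = "\<lambda>B A. pd B (transition_map V' \<psi> \<phi> A) (\<psi> (representative p (\<lambda>_. 0)))"
  have "v (velocity_coord \<phi> A []) = (\<Sum>B\<in>UNIV. a (B, {#}) * ?J B A)" for A
  proof -
    have "v (velocity_coord \<phi> A []) = (\<Sum>i\<in>vel_index s. a i * (if snd i = {#} then ?J (fst i) A else 0))"
      unfolding v by (intro sum.cong refl) (simp add: coord_vector_velocity_coord[OF c d p])
    also have "\<dots> = (\<Sum>i\<in>(\<lambda>B. (B, {#})) ` UNIV. a i * (if snd i = {#} then ?J (fst i) A else 0))"
      by (rule sum.mono_neutral_right) (auto simp: image_iff prod_eq_iff)
    also have "\<dots> = (\<Sum>B\<in>UNIV. a (B, {#}) * ?J B A)"
      by (subst sum.reindex) (auto simp: inj_on_def)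
    finally show ?thesis .
  qed
  then have "(\<Sum>A\<in>UNIV. EL V \<phi> A p * v (velocity_coord \<phi> A [])) =
    (\<Sum>A\<in>UNIV. \<Sum>B\<in>UNIV. a (B, {#}) * (EL V \<phi> A p * ?J B A))"
    by (simp add: sum_distrib_left mult.left_commute)
  also have "\<dots> = (\<Sum>B\<in>UNIV. a (B, {#}) * EL V' \<psi> B p)"
    unfolding EL_transform[OF c d p] by (subst sum.swap) (simp add: sum_distrib_left)
  finally show ?thesis .
qed

lemma tangent_spaceE:
  assumes "v \<in> tangent_space (vel_index s) (vel_atlas s) p"
  obtains V' \<psi> a where "(V', \<psi>) \<in> \<A>" "p \<in> vel_over s V'"
    "\<And>f. v f = (\<Sum>i\<in>vel_index s. a i *
      coord_vector (vel_index s) (vel_atlas s) (vel_over s V', velocity_chart_map s \<psi>) i p f)"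
proof -
  obtain c a where *: "c \<in> vel_atlas s" "p \<in> fst c"
    "v = (\<lambda>f. \<Sum>i\<in>vel_index s. a i * coord_vector (vel_index s) (vel_atlas s) c i p f)"
    using assms unfolding tangent_space_def by blast
  from *(1) obtain V' \<psi> where d: "(V', \<psi>) \<in> \<A>" "c = (vel_over s V', velocity_chart_map s \<psi>)"
    by (auto simp: mem_vel_atlas)
  show thesis by (rule that[OF d(1), of a]) (use * d in simp_all)
qed

text \<open>The chart is picked arbitrarily, depending on \<open>p\<close> but not on
  \<open>v\<close>, so linearity is immediate. By \<open>EL_pairing\<close> the value on tangent
  vectors does not depend on the choice.\<close>

definition EL_form :: "('n, 'x) jet \<Rightarrow> ((('n, 'x) jet \<Rightarrow> real) \<Rightarrow> real) \<Rightarrow> real" where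
  "EL_form p v = (let c = SOME c. c \<in> \<A> \<and> p \<in> vel_over s (fst c) in
     \<Sum>A\<in>UNIV. EL (fst c) (snd c) A p * v (velocity_coord (snd c) A []))"

text \<open>The chosen chart is unknown. \<open>EL_pairing\<close> moves the evaluation to the chart
  in which \<open>v\<close> is expanded.\<close>

lemma EL_form_eq:
  assumes d: "(V', \<psi>) \<in> \<A>" and p: "p \<in> vel_over s V'"
    and v: "\<And>f. v f = (\<Sum>i\<in>vel_index s. a i *
      coord_vector (vel_index s) (vel_atlas s) (vel_over s V', velocity_chart_map s \<psi>) i p f)"
  shows "EL_form p v = (\<Sum>B\<in>UNIV. a (B, {#}) * EL V' \<psi> B p)"
proof -
  define c where "c = (SOME c. c \<in> \<A> \<and> p \<in> vel_over s (fst c))"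
  have "c \<in> \<A> \<and> p \<in> vel_over s (fst c)"
    unfolding c_def by (rule someI[of _ "(V', \<psi>)"]) (use d p in simp)
  then have "(fst c, snd c) \<in> \<A>" "p \<in> vel_over s (fst c)" by auto
  from EL_pairing[OF this(1) d this(2) p v] show ?thesis
    by (simp add: EL_form_def c_def[symmetric])
qed

lemma EL_form_in_chart:
  assumes c: "(V, \<phi>) \<in> \<A>" and p: "p \<in> vel_over s V"
    and v: "v \<in> tangent_space (vel_index s) (vel_atlas s) p"
  shows "EL_form p v = (\<Sum>A\<in>UNIV. EL V \<phi> A p * differential (velocity_coord \<phi> A []) p v)"
proof -
  obtain V' \<psi> a where d: "(V', \<psi>) \<in> \<A>" "p \<in> vel_over s V'"
    "\<And>f. v f = (\<Sum>i\<in>vel_index s. a i *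
      coord_vector (vel_index s) (vel_atlas s) (vel_over s V', velocity_chart_map s \<psi>) i p f)"
    using tangent_spaceE[OF v] by blast
  show ?thesis
    using EL_form_eq[OF d] EL_pairing[OF c d(1) p d(2,3)] by (simp add: differential_def)
qed

lemma one_form_EL_form: "one_form (vel_index s) (vel_atlas s) EL_form"
  unfolding one_form_def
proof (intro conjI ballI allI)
  fix p v w a b
  show "EL_form p (\<lambda>f. a * v f + b * w f) = a * EL_form p v + b * EL_form p w"
    by (simp add: EL_form_def Let_def sum.distrib sum_distrib_left algebra_simps)
next
  fix d :: "(('n, 'x) jet, 'N \<times> 'n multiset) chart" assume "d \<in> vel_atlas s"
  then obtain V \<phi> where c: "(V, \<phi>) \<in> \<A>" "d = (vel_over s V, velocity_chart_map s \<phi>)"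
    by (auto simp: mem_vel_atlas)
  have "smooth_on (vel_index s) (vel_image s (\<phi> ` V)) (\<lambda>u. EL_form (vel_inv s V \<phi> u)
      (coord_vector (vel_index s) (vel_atlas s) d i (vel_inv s V \<phi> u)))" if i: "i \<in> vel_index s" for i
  proof (rule smooth_on_cong[OF finite_velocity_index vel_image_open[OF c(1)]])
    show "smooth_on (vel_index s) (vel_image s (\<phi> ` V))
      (\<lambda>u. \<Sum>B\<in>UNIV. (if (B, {#}) = i then 1 else 0) * EL V \<phi> B (vel_inv s V \<phi> u))"
      by (intro smooth_on_sum smooth_on_mult smooth_on_const smooth_on_EL[OF c(1)]
          finite_velocity_index vel_image_open[OF c(1)])
    fix u assume u: "u \<in> vel_image s (\<phi> ` V)"
    have "EL_form (vel_inv s V \<phi> u) (coord_vector (vel_index s) (vel_atlas s) d i (vel_inv s V \<phi> u)) =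
      (\<Sum>B\<in>UNIV. (if (B, {#}) = i then 1 else 0) * EL V \<phi> B (vel_inv s V \<phi> u))"
    \<comment> \<open>A coordinate vector has Kronecker coefficients, so the component of the form
      is an Euler-Lagrange expression for an index of order 0 and zero otherwise.\<close>
    proof (rule EL_form_eq[OF c(1) chart_map_vel_inv(2)[OF c(1) u], where a = "\<lambda>j. if j = i then 1 else 0"])
      fix f
      show "coord_vector (vel_index s) (vel_atlas s) d i (vel_inv s V \<phi> u) f = (\<Sum>j\<in>vel_index s. (if j = i then 1 else 0) *
        coord_vector (vel_index s) (vel_atlas s) (vel_over s V, velocity_chart_map s \<phi>) j (vel_inv s V \<phi> u) f)"
        using i by (simp add: c(2) if_distrib[of "\<lambda>x. x * _"] cong: if_cong)
    qed
    then show "(\<Sum>B\<in>UNIV. (if (B, {#}) = i then 1 else 0) * EL V \<phi> B (vel_inv s V \<phi> u)) =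
      EL_form (vel_inv s V \<phi> u) (coord_vector (vel_index s) (vel_atlas s) d i (vel_inv s V \<phi> u))" ..
  qed
  then show "case d of (V, \<phi>) \<Rightarrow> \<forall>i\<in>vel_index s. smooth_on (vel_index s) (\<phi> ` V)
      (\<lambda>u. EL_form (inv_into V \<phi> u) (coord_vector (vel_index s) (vel_atlas s) (V, \<phi>) i (inv_into V \<phi> u)))"
    unfolding c(2) prod.case vel_image_eq[OF c(1)] by blast
qed

end

end

theorem proposition3p3:
  fixes \<A> :: "('x, 'N::finite) chart set"
    and L :: "('n::finite, 'x) jet \<Rightarrow> real"
    and r s :: nat
    and reg :: bool
  assumes "smooth_manifold UNIV \<A>"
    and "CARD('n) \<le> CARD('N)"
    and "smooth_function (velocity_index r) (velocity_atlas reg \<A> r) L"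
    and "2 * r \<le> s"
  shows "\<exists>\<omega>. one_form (velocity_index s) (velocity_atlas reg \<A> s) \<omega> \<and>
           (\<forall>(V, \<phi>)\<in>\<A>. \<forall>p\<in>velocities_over reg \<A> s V.
              \<forall>v\<in>tangent_space (velocity_index s) (velocity_atlas reg \<A> s) p.
                \<omega> p v = (\<Sum>A\<in>UNIV. euler_lagrange reg \<A> r s L (V, \<phi>) A p *
                                    differential (velocity_coord \<phi> A []) p v))"
proof -
  interpret velocity_manifold_dim \<A> reg "TYPE('n)"
    using assms(1,2) by unfold_locales (simp_all add: smooth_manifold_def)
  show ?thesis
    using one_form_EL_form[OF assms(3,4)] EL_form_in_chart[OF assms(3,4)] by blast
qed

end
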